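(* Let $\alpha\ge0$, $v>0$ and let $E\in\mathcal{A}^y(v)\cap\mathcal{S}_x^*\cap\mathcal{S}_y$ be a $y$-regular minimizer of the problem $\inf\{\mathcal{P}_\alpha^y(E') : E'\in\mathcal{A}^y(v)\}$, with $y$-profile function $g\in C([0,r])\cap\mathrm{Lip}_{loc}(]0,r[)$, $r\in\,]0,+\infty[$. Then $E$ is unique and is given by $$E=\delta_{\frac1h}\left(\left\{(x,y)\in\mathbb{R}^2 : \left(x,|y|-\varphi_\alpha\left(\tfrac{\sqrt3}{2}\right)\right)\in E_\alpha\right\}\right),$$ where $$h=\left[\frac1v\left(\mathcal{L}^2(E_\alpha)-2\int_0^{\frac{\sqrt3}{2}}\frac{t^{\alpha+2}}{\sqrt{1-t^2}}\,dt\right)\right]^{\frac{1}{\alpha+2}}.$$ The $y$-profile function of $E$ is given by $$g(y)=\tfrac1h\,\varphi_\alpha^{-1}\left(\left|h^{\alpha+1}y-\varphi_\alpha\left(\tfrac{\sqrt3}{2}\right)\right|\right)$$ for all $y\in[0,r]$. In particular, $g\in C^\infty(]0,r[)$ and $r=h^{-(\alpha+1)}\left(r_\alpha+\varphi_\alpha\left(\tfrac{\sqrt3}{2}\right)\right)$, where $r_\alpha=\varphi_\alpha(0)$. Moreover, $g(0)>0$, $g(r)=0$, $g'(r)=-\infty$ and $g(0)^\alpha g'(0)=\frac{1}{\sqrt3}$. Finally, the minimum of the problem is $$\mathcal{P}_\alpha^y(E)=\frac{2}{h^{\alpha+1}}\left[P_\alpha(E_\alpha)+\int_0^{\frac{\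sqrt3}{2}}t^\alpha\left(1-\frac{2}{\sqrt{1-t^2}}\right)dt\right].$$
   Context: For $\alpha\ge0$ and an $\mathcal{L}^2$-measurable set $E\subset\mathbb{R}^2$, the Grushin $\alpha$-perimeter is $$P_\alpha(E)=\sup\left\{\int_E(\partial_x\phi_1+|x|^\alpha\partial_y\phi_2)\,dx\,dy : \phi_1,\phi_2\in C^1_c(\mathbb{R}^2),\ \sup_{\mathbb{R}^2}\sqrt{\phi_1^2+\phi_2^2}\le1\right\}.$$ Set $E^{+y}=E\cap\{y>0\}$, $E^{-y}=E\cap\{y<0\}$. For $v>0$, $\mathcal{A}^y(v)$ is the class of $\mathcal{L}^2$-measurable $E\subset\mathbb{R}^2$ with $\mathcal{L}^2(E^{+y})=\mathcal{L}^2(E^{-y})=v$, and $\mathcal{P}_\alpha^y(E)=\frac12(P_\alpha(E^{+y})+P_\alpha(E^{-y})+P_\alpha(E))$. For $\lambda>0$, $\delta_\lambda(x,y)=(\lambda x,\lambda^{\alpha+1}y)$. The isoperimetric profile is $\varphi_\alpha:[0,1]\to[0,+\infty[$, $\varphi_\alpha(x)=\int_{\arcsin x}^{\pi/2}\sin^{\alpha+1}(t)\,dt$ (strictly decreasing from $r_\alpha=\varphi_\alpha(0)$ to $0$; $\varphi_\alpha^{-1}:[0,r_\alpha]\to[0,1]$ is its inverse), and $E_\alpha=\{(x,y)\in\mathbb{R}^2 : |y|\le\varphi_\alpha(|x|),\ |x|\le1\}$. Sets are considered up to $\mathcal{L}^2$-negligible sets. $\mathcal{S}_y$ is the class of $\mathcal{L}^2$-measurable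 $y$-symmetric sets ($(x,y)\in E$ implies $(x,-y)\in E$). $\mathcal{S}_x^*$ is the class of $\mathcal{L}^2$-measurable $x$-Schwarz symmetric sets, i.e. $x$-symmetric ($(x,y)\in E$ implies $(-x,y)\in E$) and $x$-convex (for each $t$ the section $\{x:(x,t)\in E\}$ is a, possibly empty, open interval). A set $E\in\mathcal{S}_y$ is $y$-transformed-convex if $\Psi(E^{+y})$ is convex, where $\Psi(x,y)=\left(\operatorname{sgn}(x)\frac{|x|^{\alpha+1}}{\alpha+1},\,y\right)$. A $y$-regular minimizer is a minimizer $E\in\mathcal{A}^y(v)\cap\mathcal{S}_x^*\cap\mathcal{S}_y$ of the problem $\inf\{\mathcal{P}_\alpha^y(E') : E'\in\mathcal{A}^y(v)\}$ that is bounded, $y$-transformed-convex and of the form $E=\{(x,y)\in\mathbb{R}^2 : |x|\le g(|y|),\ |y|\le r\}$ for some ($y$-profile) function $g\in C([0,r])\cap\mathrm{Lip}_{loc}(]0,r[)$ with $r\in\,]0,+\infty[$. The values $g'(0)$ and $g'(r)$ denote $\lim_{y\to0^+}g'(y)$ and $\lim_{y\to r^-}g'(y)$. *)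

theory Defs
  imports "HOL-Analysis.Analysis"
begin

text \<open>The plane is \<^typ>\<open>real \<times> real\<close> with Lebesgue measure. Since \<open>0 powr 0 = 0\<close>, the terms
  \<open>\<bar>x\<bar> powr \<alpha>\<close> differ from the usual convention only for \<open>\<alpha> = 0\<close> and \<open>x = 0\<close>; they occur only
  under integrals, where this is a null set.\<close>

definition C1_compact_support :: "(real \<times> real \<Rightarrow> real) \<Rightarrow> bool" where
  "C1_compact_support \<phi> \<longleftrightarrow>
     (\<exists>D :: real \<times> real \<Rightarrow> (real \<times> real) \<Rightarrow>\<^sub>L real. continuous_on UNIV D \<and>
        (\<forall>z. (\<phi> has_derivative blinfun_apply (D z)) (at z))) \<and>
     compact (closure {z. \<phi> z \<noteq> 0})"

definition partial_x :: "(real \<times> real \<Rightarrow> real) \<Rightarrow> real \<times> real \<Rightarrow> real" where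
  "partial_x \<phi> = (\<lambda>(x, y). deriv (\<lambda>s. \<phi> (s, y)) x)"

definition partial_y :: "(real \<times> real \<Rightarrow> real) \<Rightarrow> real \<times> real \<Rightarrow> real" where
  "partial_y \<phi> = (\<lambda>(x, y). deriv (\<lambda>s. \<phi> (x, s)) y)"

definition grushin_perimeter :: "real \<Rightarrow> (real \<times> real) set \<Rightarrow> ereal" where
  "grushin_perimeter \<alpha> E =
     (SUP (\<phi>1, \<phi>2) \<in> {(\<phi>1, \<phi>2). C1_compact_support \<phi>1 \<and> C1_compact_support \<phi>2 \<and>
                              (\<forall>z. sqrt ((\<phi>1 z)\<^sup>2 + (\<phi>2 z)\<^sup>2) \<le> 1)}.
        ereal (LINT z:E|lebesgue. partial_x \<phi>1 z + \<bar>fst z\<bar> powr \<alpha> * partial_y \<phi>2 z))"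

definition upper_part :: "(real \<times> real) set \<Rightarrow> (real \<times> real) set" where
  "upper_part E = E \<inter> {z. snd z > 0}"

definition lower_part :: "(real \<times> real) set \<Rightarrow> (real \<times> real) set" where
  "lower_part E = E \<inter> {z. snd z < 0}"

definition admissible :: "real \<Rightarrow> (real \<times> real) set set" where
  "admissible v = {E \<in> sets lebesgue. emeasure lebesgue (upper_part E) = ennreal v \<and>
                                      emeasure lebesgue (lower_part E) = ennreal v}"

definition double_perimeter :: "real \<Rightarrow> (real \<times> real) set \<Rightarrow> ereal" where
  "double_perimeter \<alpha> E = ereal (1 / 2) *
     (grushin_perimeter \<alpha> (upper_part E) + grushin_perimeter \<alpha> (lower_part E)
      + grushin_perimeter \<alpha> E)"

definition is_minimizer :: "real \<Rightarrow> real \<Rightarrow> (real \<times> real) set \<Rightarrow> bool" where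
  "is_minimizer \<alpha> v E \<longleftrightarrow> E \<in> admissible v \<and>
     (\<forall>E' \<in> admissible v. double_perimeter \<alpha> E \<le> double_perimeter \<alpha> E')"

definition dilation :: "real \<Rightarrow> real \<Rightarrow> real \<times> real \<Rightarrow> real \<times> real" where
  "dilation \<alpha> c = (\<lambda>(x, y). (c * x, c powr (\<alpha> + 1) * y))"

text \<open>The profile is meaningful on \<open>{0..1}\<close> only, its inverse on \<open>{0..iso_profile \<alpha> 0}\<close> only.\<close>

definition iso_profile :: "real \<Rightarrow> real \<Rightarrow> real" where
  "iso_profile \<alpha> x = integral {arcsin x..pi / 2} (\<lambda>t. sin t powr (\<alpha> + 1))"

definition iso_profile_inv :: "real \<Rightarrow> real \<Rightarrow> real" where
  "iso_profile_inv \<alpha> = the_inv_into {0..1} (iso_profile \<alpha>)"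

definition iso_set :: "real \<Rightarrow> (real \<times> real) set" where
  "iso_set \<alpha> = {(x, y). \<bar>y\<bar> \<le> iso_profile \<alpha> \<bar>x\<bar> \<and> \<bar>x\<bar> \<le> 1}"

definition ae_eq :: "(real \<times> real) set \<Rightarrow> (real \<times> real) set \<Rightarrow> bool" where
  "ae_eq E F \<longleftrightarrow> sym_diff E F \<in> null_sets lebesgue"

text \<open>Sets are regarded up to null sets, so a set belongs to a class as soon as some
  representative does.\<close>

definition mod_null :: "(real \<times> real) set set \<Rightarrow> (real \<times> real) set set" where
  "mod_null \<S> = {E. \<exists>F \<in> \<S>. ae_eq E F}"

definition y_symmetric :: "(real \<times> real) set set" where
  "y_symmetric = {E \<in> sets lebesgue. \<forall>x y. (x, y) \<in> E \<longrightarrow> (x, -y) \<in> E}"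

definition x_schwarz_symmetric :: "(real \<times> real) set set" where
  "x_schwarz_symmetric = {E \<in> sets lebesgue. (\<forall>x y. (x, y) \<in> E \<longrightarrow> (-x, y) \<in> E) \<and>
     (\<forall>t. open {x. (x, t) \<in> E} \<and> is_interval {x. (x, t) \<in> E})}"

definition Psi :: "real \<Rightarrow> real \<times> real \<Rightarrow> real \<times> real" where
  "Psi \<alpha> = (\<lambda>(x, y). (sgn x * (\<bar>x\<bar> powr (\<alpha> + 1) / (\<alpha> + 1)), y))"

definition y_transformed_convex :: "real \<Rightarrow> (real \<times> real) set \<Rightarrow> bool" where
  "y_transformed_convex \<alpha> E \<longleftrightarrow> E \<in> y_symmetric \<and> convex (Psi \<alpha> ` upper_part E)"

definition y_profile_set :: "(real \<Rightarrow> real) \<Rightarrow> real \<Rightarrow> (real \<times> real) set" where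
  "y_profile_set g r = {(x, y). \<bar>x\<bar> \<le> g \<bar>y\<bar> \<and> \<bar>y\<bar> \<le> r}"

definition locally_lipschitz_on :: "real set \<Rightarrow> (real \<Rightarrow> real) \<Rightarrow> bool" where
  "locally_lipschitz_on U g \<longleftrightarrow> (\<forall>K. compact K \<and> K \<subseteq> U \<longrightarrow> (\<exists>L. L-lipschitz_on K g))"

text \<open>A profile is a half-width, hence nonnegative. The profile set has closed sections, whereas
  Schwarz symmetry asks for open ones, so membership is read up to null sets. Boundedness and
  transformed convexity are required of the profile set itself: they would otherwise not prevent
  \<open>g\<close> from vanishing near \<open>r\<close>, and \<open>r\<close> would not be determined by \<open>E\<close>.\<close>

definition y_regular_minimizer ::
    "real \<Rightarrow> real \<Rightarrow> (real \<times> real) set \<Rightarrow> (real \<Rightarrow> real) \<Rightarrow> real \<Rightarrow> bool" where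
  "y_regular_minimizer \<alpha> v E g r \<longleftrightarrow>
     is_minimizer \<alpha> v E \<and>
     E \<in> mod_null x_schwarz_symmetric \<and> E \<in> mod_null y_symmetric \<and>
     0 < r \<and> continuous_on {0..r} g \<and> locally_lipschitz_on {0<..<r} g \<and>
     (\<forall>y \<in> {0..r}. 0 \<le> g y) \<and>
     ae_eq E (y_profile_set g r) \<and> bounded (y_profile_set g r) \<and>
     y_transformed_convex \<alpha> (y_profile_set g r)"

text \<open>For open \<open>U\<close> this is \<open>C\<^sup>\<infinity>\<close>.\<close>

definition smooth_on_open :: "real set \<Rightarrow> (real \<Rightarrow> real) \<Rightarrow> bool" where
  "smooth_on_open U g \<longleftrightarrow> (\<forall>n. \<forall>y \<in> U. (deriv ^^ n) g differentiable (at y))"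

definition scale_factor :: "real \<Rightarrow> real \<Rightarrow> real" where
  "scale_factor \<alpha> v =
     (1 / v * (measure lebesgue (iso_set \<alpha>)
        - 2 * integral {0..sqrt 3 / 2} (\<lambda>t. t powr (\<alpha> + 2) / sqrt (1 - t\<^sup>2))))
     powr (1 / (\<alpha> + 2))"

end

theory Submission
  imports Defs
begin

text \<open>The proof is a calibration argument; no first variation of the set is taken.

  Let the set have the profile \<open>g\<close> on \<open>[0, r]\<close>, let \<open>m\<close> be a maximum point of \<open>g\<close>, and put
  \<open>k = 1 / g m\<close>. The set lies in \<open>\<bar>k x\<bar> \<le> 1\<close>, where the fields
  \<open>(k x, - sqrt (1 - (k x)\<^sup>2))\<close> and \<open>(k x, sqrt (1 - (k x)\<^sup>2))\<close> have norm \<open>1\<close>. In the upper half plane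
  the first is used below the height \<open>m\<close> and the second above it, and vertical fields are used at the
  ends. Fields at different heights are glued by steps in \<open>y\<close>, and a change of field contributes
  the jump of its weighted flux (\<open>calibration_lower_bound\<close>). Tested against the upper half, the
  lower half and the whole set, this bounds the double perimeter from below by

  \<open>2 k v + k powr (- \<alpha> - 1) * (4 Q 1 + (V - 2 Q) (k * g 0) + 2 (V - Q) (k * g r))\<close>,

  where \<open>V s\<close> and \<open>Q s\<close> are the integrals of \<open>\<bar>x\<bar> powr \<alpha>\<close> and of
  \<open>\<bar>x\<bar> powr \<alpha> * sqrt (1 - x\<^sup>2)\<close> over \<open>[-s, s]\<close> (\<open>perturbed_lower_bound\<close>). On \<open>[0, 1]\<close> the
  function \<open>V - 2 Q\<close> has its only minimum at \<open>sqrt 3 / 2\<close> and \<open>V - Q\<close> vanishes only at \<open>0\<close>; the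
  remaining function of \<open>k\<close> has its only minimum at the scale factor \<open>h\<close>
  (\<open>bottom_cost_min\<close>, \<open>top_cost_pos\<close>, \<open>cand_value_minimal\<close>). This minimum is also an upper bound
  for the double perimeter of the explicit candidate, by the divergence theorem along its boundary
  curve \<open>x = sin t / h\<close> (\<open>arc_divergence_bound\<close>, \<open>cand_upper\<close>).

  Hence for a minimizer all inequalities are equalities, so that \<open>k = h\<close>, \<open>h * g 0 = sqrt 3 / 2\<close>
  and \<open>g r = 0\<close>. Moreover, rotating the calibrating field by the angle \<open>e x\<close> in a layer
  \<open>a < y < b\<close> on one side of \<open>m\<close> cannot increase the bound. The derivative at \<open>e = 0\<close> therefore
  vanishes, which is the integrated Euler-Lagrange equation

  \<open>h / (\<alpha> + 3) * (g b powr (\<alpha> + 3) - g a powr (\<alpha> + 3)) = \<integral> g * sqrt (1 - (h * g)\<^sup>2)\<close> over \<open>[a, b]\<close>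

  up to the sign (\<open>rotation_gain_deriv\<close>, \<open>equality_case\<close>). It makes \<open>iso_profile \<alpha> (h * g y)\<close>
  affine in \<open>y\<close> wherever \<open>0 < g y < 1 / h\<close>. Transformed convexity shows that \<open>g\<close> has no zero in
  \<open>]0, r[\<close>. So \<open>g\<close> is the candidate profile with a cylinder possibly inserted at its maximum, and the
  volume constraint forces the height of the cylinder to be \<open>0\<close> (\<open>minimizing_profile\<close>).\<close>

section \<open>Test functions and smooth steps\<close>

lemma DERIV_const_minus: "((\<lambda>x. c - x) has_real_derivative -1) F"
  by (auto intro!: derivative_eq_intros)

lemma DERIV_minus_const: "((\<lambda>x. x - c) has_real_derivative 1) F"
  by (auto intro!: derivative_eq_intros)

lemma C1_compact_supportI:
  fixes Dx Dy :: "real \<times> real \<Rightarrow> real"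
  assumes "continuous_on UNIV Dx" "continuous_on UNIV Dy"
    and "\<And>z. (\<phi> has_derivative (\<lambda>w. Dx z * fst w + Dy z * snd w)) (at z)"
    and "bounded {z. \<phi> z \<noteq> 0}"
  shows "C1_compact_support \<phi>"
proof -
  define D :: "real \<times> real \<Rightarrow> (real \<times> real) \<Rightarrow>\<^sub>L real" where "D z = Dx z *\<^sub>R fst_blinfun + Dy z *\<^sub>R snd_blinfun" for z
  have "continuous_on UNIV D"
    unfolding D_def using assms(1,2) by (intro continuous_intros)
  moreover have "blinfun_apply (D z) = (\<lambda>w. Dx z * fst w + Dy z * snd w)" for z
    by (auto simp: D_def blinfun.add_left blinfun.scaleR_left)
  ultimately show ?thesis
    unfolding C1_compact_support_def using assms(3,4) by (auto simp: compact_closure intro!: exI[of _ D])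
qed

lemma C1_compact_support_add:
  assumes "C1_compact_support f" "C1_compact_support g"
  shows "C1_compact_support (\<lambda>z. f z + g z)"
proof -
  obtain D1 where D1: "continuous_on UNIV D1" "\<And>z. (f has_derivative blinfun_apply (D1 z)) (at z)"
    using assms(1) unfolding C1_compact_support_def by auto
  obtain D2 where D2: "continuous_on UNIV D2" "\<And>z. (g has_derivative blinfun_apply (D2 z)) (at z)"
    using assms(2) unfolding C1_compact_support_def by auto
  have "{z. f z + g z \<noteq> 0} \<subseteq> {z. f z \<noteq> 0} \<union> {z. g z \<noteq> 0}" by auto
  moreover have "bounded ({z. f z \<noteq> 0} \<union> {z. g z \<noteq> 0})"
    using assms unfolding C1_compact_support_def by (simp add: compact_closure)
  ultimately have b: "bounded {z. f z + g z \<noteq> 0}" by (rule bounded_subset[rotated])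
  have "continuous_on UNIV (\<lambda>z. D1 z + D2 z)" using D1 D2 by (intro continuous_intros)
  moreover have "((\<lambda>z. f z + g z) has_derivative blinfun_apply (D1 z + D2 z)) (at z)" for z
    using has_derivative_add[OF D1(2) D2(2)] by (simp add: blinfun.add_left[abs_def])
  ultimately show ?thesis
    unfolding C1_compact_support_def using b by (auto simp: compact_closure intro!: exI[of _ "\<lambda>z. D1 z + D2 z"])
qed

lemma C1_compact_support_zero: "C1_compact_support (\<lambda>z. 0)"
  by (rule C1_compact_supportI[where Dx="\<lambda>z. 0" and Dy="\<lambda>z. 0"]) (auto intro!: derivative_eq_intros)

lemma C1_compact_support_sum:
  assumes "\<And>i. i \<in> I \<Longrightarrow> C1_compact_support (f i)"
  shows "C1_compact_support (\<lambda>z. \<Sum>i\<in>I. f i z)"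
  using assms
  by (induction I rule: infinite_finite_induct)
     (auto intro: C1_compact_support_zero C1_compact_support_add)

lemma C1_compact_support_prod:
  fixes A B :: "real \<Rightarrow> real"
  assumes A: "\<And>x. (A has_real_derivative A' x) (at x)" "continuous_on UNIV A'" "\<And>x. \<bar>x\<bar> > N \<Longrightarrow> A x = 0"
    and B: "\<And>x. (B has_real_derivative B' x) (at x)" "continuous_on UNIV B'" "\<And>x. \<bar>x\<bar> > N \<Longrightarrow> B x = 0"
  shows "C1_compact_support (\<lambda>z. B (snd z) * A (fst z))"
proof (rule C1_compact_supportI[where Dx="\<lambda>z. B (snd z) * A' (fst z)" and Dy="\<lambda>z. B' (snd z) * A (fst z)"])
  have cA: "continuous_on UNIV A" and cB: "continuous_on UNIV B"
    using A(1) B(1) by (meson DERIV_continuous_on has_field_derivative_at_within)+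
  show "continuous_on UNIV (\<lambda>z. B (snd z) * A' (fst z))"
    by (intro continuous_intros continuous_on_compose2[OF cB] continuous_on_compose2[OF A(2)]) auto
  show "continuous_on UNIV (\<lambda>z. B' (snd z) * A (fst z))"
    by (intro continuous_intros continuous_on_compose2[OF cA] continuous_on_compose2[OF B(2)]) auto
  show "((\<lambda>z. B (snd z) * A (fst z)) has_derivative
      (\<lambda>w. B (snd z) * A' (fst z) * fst w + B' (snd z) * A (fst z) * snd w)) (at z)" for z :: "real \<times> real"
  proof -
    have dA: "(A has_derivative (*) (A' (fst z))) (at (fst z))"
      and dB: "(B has_derivative (*) (B' (snd z))) (at (snd z))"
      using A(1)[of "fst z"] B(1)[of "snd z"] by (simp_all add: has_field_derivative_def)
    have "((\<lambda>z. A (fst z)) has_derivative (\<lambda>w. A' (fst z) * fst w)) (at z)"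
      by (rule has_derivative_compose[OF has_derivative_fst[OF has_derivative_ident], of A "(*) (A' (fst z))"]) (rule dA)
    moreover have "((\<lambda>z. B (snd z)) has_derivative (\<lambda>w. B' (snd z) * snd w)) (at z)"
      by (rule has_derivative_compose[OF has_derivative_snd[OF has_derivative_ident], of B "(*) (B' (snd z))"]) (rule dB)
    ultimately show ?thesis
      by (auto intro!: derivative_eq_intros simp: algebra_simps)
  qed
  have "z \<in> cbox (-N, -N) (N, N)" if "B (snd z) * A (fst z) \<noteq> 0" for z
    using that A(3)[of "fst z"] B(3)[of "snd z"]
    by (cases z) (force simp: cbox_Pair_eq)
  then have "{z. B (snd z) * A (fst z) \<noteq> 0} \<subseteq> cbox (-N, -N) (N, N)" by blast
  then show "bounded {z. B (snd z) * A (fst z) \<noteq> 0}"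
    using bounded_cbox bounded_subset by blast
qed

text \<open>The cut-offs below are built from the \<open>C\<^sup>1\<close> function \<open>max 0 x\<close> squared.\<close>

definition pos_square :: "real \<Rightarrow> real" where "pos_square x = (max 0 x)\<^sup>2"

lemma pos_square_deriv: "(pos_square has_real_derivative 2 * max 0 x) (at x)"
proof -
  consider "x < 0" | "x > 0" | "x = 0" by linarith
  then show ?thesis
  proof cases
    case 1
    have "((\<lambda>_. 0) has_real_derivative 2 * max 0 x) (at x)" using 1 by (auto intro!: derivative_eq_intros)
    moreover have "eventually (\<lambda>y. pos_square y = 0) (nhds x)"
      using 1 eventually_nhds_in_open[of "{..<0}" x] by (auto simp: pos_square_def elim!: eventually_mono)
    ultimately show ?thesis by (subst DERIV_cong_ev[OF refl _ refl]) auto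
  next
    case 2
    have "((\<lambda>x. x\<^sup>2) has_real_derivative 2 * max 0 x) (at x)" using 2 by (auto intro!: derivative_eq_intros)
    moreover have "eventually (\<lambda>y. pos_square y = y\<^sup>2) (nhds x)"
      using 2 eventually_nhds_in_open[of "{0<..}" x] by (auto simp: pos_square_def elim!: eventually_mono)
    ultimately show ?thesis by (subst DERIV_cong_ev[OF refl _ refl]) auto
  next
    case 3
    have "((\<lambda>y. pos_square y / y) \<longlongrightarrow> 0) (at 0)"
    proof (rule tendsto_sandwich[OF _ _ tendsto_const])
      show "((\<lambda>y. \<bar>y\<bar>) \<longlongrightarrow> 0) (at (0::real))" using tendsto_rabs_zero[OF tendsto_ident_at] by simp
      show "eventually (\<lambda>y. 0 \<le> pos_square y / y) (at 0)"
        by (auto simp: pos_square_def max_def)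
      show "eventually (\<lambda>y. pos_square y / y \<le> \<bar>y\<bar>) (at 0)"
        by (auto simp: pos_square_def max_def power2_eq_square)
    qed
    then show ?thesis using 3 by (simp add: has_field_derivative_iff pos_square_def)
  qed
qed

text \<open>A monotone \<open>C\<^sup>1\<close> step: \<open>0\<close> for \<open>x \<le> 0\<close>, \<open>1\<close> for \<open>x \<ge> 1\<close>. The function
  \<open>smooth_step'\<close> is its derivative.\<close>

definition smooth_step :: "real \<Rightarrow> real" where
  "smooth_step x = pos_square x / (pos_square x + pos_square (1 - x))"

definition smooth_step' :: "real \<Rightarrow> real" where
  "smooth_step' x = (2 * max 0 x * pos_square (1 - x) + pos_square x * (2 * max 0 (1 - x))) / (pos_square x + pos_square (1 - x))\<^sup>2"

lemma pos_square_sum_pos: "pos_square x + pos_square (1 - x) > 0"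
  by (cases "x > 0") (auto simp: pos_square_def add_pos_nonneg add_nonneg_pos)

lemma pos_square_nonneg: "pos_square x \<ge> 0" by (simp add: pos_square_def)

lemma smooth_step_deriv: "(smooth_step has_real_derivative smooth_step' x) (at x)"
proof -
  have *: "((\<lambda>x. pos_square (1 - x)) has_real_derivative - (2 * max 0 (1 - x))) (at x)"
    using DERIV_chain2[OF pos_square_deriv, of "\<lambda>x. 1 - x" "-1" x UNIV, OF DERIV_const_minus] by simp
  show ?thesis unfolding smooth_step_def[abs_def] smooth_step'_def
    using pos_square_sum_pos[of x]
    by (auto intro!: derivative_eq_intros pos_square_deriv * simp: power2_eq_square) (simp add: field_simps)
qed

lemma continuous_pos_square: "continuous_on S pos_square"
  unfolding pos_square_def by (intro continuous_intros)

lemma continuous_smooth_step': "continuous_on S smooth_step'"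
  unfolding smooth_step'_def
  using pos_square_sum_pos
  by (intro continuous_intros continuous_on_compose2[OF continuous_pos_square[of UNIV]])
     (auto simp: less_imp_neq[symmetric] dest: less_imp_neq)

lemma smooth_step'_nonneg: "smooth_step' x \<ge> 0"
  unfolding smooth_step'_def by (auto intro!: divide_nonneg_nonneg add_nonneg_nonneg mult_nonneg_nonneg simp: pos_square_nonneg)

lemma smooth_step_mono: "x \<le> y \<Longrightarrow> smooth_step x \<le> smooth_step y"
  by (rule DERIV_nonneg_imp_nondecreasing) (auto intro: smooth_step_deriv smooth_step'_nonneg exI)

lemma smooth_step_0: "x \<le> 0 \<Longrightarrow> smooth_step x = 0" by (simp add: smooth_step_def pos_square_def)
lemma smooth_step_1: "x \<ge> 1 \<Longrightarrow> smooth_step x = 1" by (simp add: smooth_step_def pos_square_def)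

lemma smooth_step_range: "0 \<le> smooth_step x" "smooth_step x \<le> 1"
  using pos_square_sum_pos[of x] pos_square_nonneg[of x] pos_square_nonneg[of "1-x"] by (auto simp: smooth_step_def)

lemma smooth_step'_0: "x \<le> 0 \<Longrightarrow> smooth_step' x = 0" by (simp add: smooth_step'_def pos_square_def)
lemma smooth_step'_1: "x \<ge> 1 \<Longrightarrow> smooth_step' x = 0" by (simp add: smooth_step'_def pos_square_def)

lemma bump_exists:
  fixes a b :: real assumes "a \<le> b"
  obtains \<kappa> \<kappa>' where "\<And>x. (\<kappa> has_real_derivative \<kappa>' x) (at x)" "continuous_on UNIV \<kappa>'"
    "\<And>x. 0 \<le> \<kappa> x \<and> \<kappa> x \<le> 1" "\<And>x. x \<in> {a..b} \<Longrightarrow> \<kappa> x = 1" "\<And>x. x \<in> {a..b} \<Longrightarrow> \<kappa>' x = 0"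
    "\<And>x. x < a - 1 \<or> x > b + 1 \<Longrightarrow> \<kappa> x = 0"
proof
  let ?k = "\<lambda>x. smooth_step (x - (a - 1)) * smooth_step (b + 1 - x)"
  let ?k' = "\<lambda>x. smooth_step' (x - (a - 1)) * smooth_step (b + 1 - x) - smooth_step (x - (a - 1)) * smooth_step' (b + 1 - x)"
  have c: "continuous_on UNIV smooth_step"
    using smooth_step_deriv by (meson DERIV_continuous_on has_field_derivative_at_within)
  show "(?k has_real_derivative ?k' x) (at x)" for x
  proof -
    have "((\<lambda>x. smooth_step (x - (a - 1))) has_real_derivative smooth_step' (x - (a - 1))) (at x)"
      using DERIV_chain2[OF smooth_step_deriv, of "\<lambda>x. x - (a - 1)" "1" x UNIV, OF DERIV_minus_const] by simp
    moreover have "((\<lambda>x. smooth_step (b + 1 - x)) has_real_derivative - smooth_step' (b + 1 - x)) (at x)"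
      using DERIV_chain2[OF smooth_step_deriv, of "\<lambda>x. b + 1 - x" "-1" x UNIV, OF DERIV_const_minus] by simp
    ultimately show ?thesis by (auto intro!: derivative_eq_intros)
  qed
  show "continuous_on UNIV ?k'"
    by (intro continuous_intros continuous_on_compose2[OF c] continuous_on_compose2[OF continuous_smooth_step'[of UNIV]]) auto
  show "0 \<le> ?k x \<and> ?k x \<le> 1" for x
    using smooth_step_range by (auto intro: mult_le_one)
  show "x \<in> {a..b} \<Longrightarrow> ?k x = 1" for x by (simp add: smooth_step_1)
  show "x \<in> {a..b} \<Longrightarrow> ?k' x = 0" for x by (simp add: smooth_step'_1)
  show "x < a - 1 \<or> x > b + 1 \<Longrightarrow> ?k x = 0" for x by (auto simp: smooth_step_0)
qed

section \<open>Integration over strips\<close>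

text \<open>The set of the points at heights in \<open>]l, r[\<close> whose section at
  height \<open>y\<close> is the segment \<open>[-G y, G y]\<close>. All sets in the proof agree with sets of this form up to a null
  set.\<close>

definition strip :: "(real \<Rightarrow> real) \<Rightarrow> real \<Rightarrow> real \<Rightarrow> (real \<times> real) set" where
  "strip G l r = {(x, y). l < y \<and> y < r \<and> \<bar>x\<bar> \<le> G y}"

lemma closed_profile:
  fixes G :: "real \<Rightarrow> real"
  assumes "continuous_on {l..r} G"
  shows "closed {(x, y). l \<le> y \<and> y \<le> r \<and> \<bar>x\<bar> \<le> G y}"
proof -
  have c: "continuous_on (UNIV \<times> {l..r}) (\<lambda>z. G (snd z) - \<bar>fst z\<bar>)"
    by (intro continuous_intros continuous_on_compose2[OF assms]) auto
  have "closed ((UNIV \<times> {l..r}) \<inter> (\<lambda>z. G (snd z) - \<bar>fst z\<bar>) -` {0..})"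
    by (rule continuous_closed_preimage[OF c]) (auto intro: closed_Times)
  also have "((UNIV \<times> {l..r}) \<inter> (\<lambda>z. G (snd z) - \<bar>fst z\<bar>) -` {0..}) = {(x, y). l \<le> y \<and> y \<le> r \<and> \<bar>x\<bar> \<le> G y}"
    by auto
  finally show ?thesis .
qed

lemma strip_borel:
  assumes "continuous_on {l..r} G"
  shows "strip G l r \<in> sets borel"
proof -
  have "open (UNIV \<times> {l<..<r} :: (real \<times> real) set)" by (intro open_Times) auto
  moreover have "strip G l r = {(x, y). l \<le> y \<and> y \<le> r \<and> \<bar>x\<bar> \<le> G y} \<inter> (UNIV \<times> {l<..<r})"
    by (auto simp: strip_def)
  ultimately show ?thesis using closed_profile[OF assms] by auto
qed

lemma strip_subset_cbox:
  assumes "\<And>y. y \<in> {l<..<r} \<Longrightarrow> G y \<le> M"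
  shows "strip G l r \<subseteq> cbox (-M, l) (M, r)"
  using assms by (force simp: strip_def cbox_Pair_eq)

lemma integrable_on_bounded_borel:
  fixes f :: "real \<Rightarrow> real"
  assumes "f \<in> borel_measurable borel" "\<And>x. x \<in> {a..b} \<Longrightarrow> \<bar>f x\<bar> \<le> C"
  shows "set_integrable lborel {a..b} f" "f integrable_on {a..b}"
proof -
  have *: "set_integrable lborel {a..b} (\<lambda>x. C)"
    by (cases "a \<le> b") (auto simp: set_integrable_def intro!: integrable_mult_right integrable_real_indicator)
  show 1: "set_integrable lborel {a..b} f"
    by (rule set_integrable_bound[OF *]) (use assms in \<open>auto simp: set_borel_measurable_def intro!: AE_I2 intro: order_trans[OF _ abs_ge_self]\<close>)
  show "f integrable_on {a..b}"
    by (rule set_borel_integral_eq_integral(1)[OF 1])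
qed

text \<open>Fubini on a strip. Only measurability and boundedness of the integrand are required,
  since \<open>\<bar>x\<bar> powr \<alpha>\<close> is discontinuous at \<open>0\<close> when \<open>\<alpha> = 0\<close>.\<close>

lemma strip_integral:
  fixes f :: "real \<times> real \<Rightarrow> real"
  assumes G: "continuous_on {l..r} G" and f: "f \<in> borel_measurable borel"
    and bd: "\<And>z. z \<in> strip G l r \<Longrightarrow> \<bar>f z\<bar> \<le> C"
  shows "set_integrable lebesgue (strip G l r) f"
    and "(LINT z:strip G l r|lebesgue. f z) = integral {l..r} (\<lambda>y. integral {-G y..G y} (\<lambda>x. f (x, y)))"
proof -
  let ?R = "strip G l r"
  have Rb[measurable]: "?R \<in> sets borel" by (rule strip_borel[OF G])
  note f[measurable]
  obtain M where M: "\<And>y. y \<in> {l..r} \<Longrightarrow> G y \<le> M"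
    using compact_imp_bounded[OF compact_continuous_image[OF G compact_Icc]]
    unfolding bounded_iff by (metis abs_le_D1 image_eqI real_norm_def)
  have fin: "emeasure lborel ?R < \<infinity>"
    using emeasure_mono[OF strip_subset_cbox[of l r G M], of lborel] M emeasure_lborel_cbox_finite[of "(-M,l)" "(M,r)"]
    by (force simp: le_less_trans)
  have "integrable lborel (\<lambda>z. C * indicator ?R z)"
    using fin Rb by (auto intro!: integrable_mult_right integrable_real_indicator)
  then have int: "integrable lborel (\<lambda>z. indicator ?R z *\<^sub>R f z)"
    by (rule Bochner_Integration.integrable_bound) (use bd in \<open>auto simp: indicator_def intro!: AE_I2 order_trans[OF _ abs_ge_self]\<close>)
  then show "set_integrable lebesgue ?R f"
    unfolding set_integrable_def by (simp add: integrable_completion)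
  have int2: "integrable (lborel \<Otimes>\<^sub>M lborel) (\<lambda>z. indicator ?R z *\<^sub>R f z)"
    using int by (simp add: lborel_prod)
  have eq: "(LBINT x. indicator ?R (x, y) *\<^sub>R f (x, y)) = indicator {l<..<r} y *\<^sub>R integral {-G y..G y} (\<lambda>x. f (x, y))" for y
  proof (cases "y \<in> {l<..<r}")
    case True
    have "set_integrable lborel {-G y..G y} (\<lambda>x. f (x, y))"
    proof (rule integrable_on_bounded_borel)
      show "(\<lambda>x. f (x, y)) \<in> borel_measurable borel" by measurable
      show "\<bar>f (x, y)\<bar> \<le> C" if "x \<in> {-G y..G y}" for x
        using that True bd[of "(x, y)"] by (auto simp: strip_def)
    qed
    then have "(LBINT x:{-G y..G y}. f (x, y)) = integral {-G y..G y} (\<lambda>x. f (x, y))"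
      by (rule set_borel_integral_eq_integral(2))
    moreover have "indicator ?R (x, y) = (indicator {-G y..G y} x :: real)" for x
      using True by (auto simp: strip_def indicator_def)
    ultimately show ?thesis using True by (simp add: set_lebesgue_integral_def)
  next
    case False
    then have "indicator ?R (x, y) = (0::real)" for x by (auto simp: strip_def indicator_def)
    then show ?thesis using False by simp
  qed
  have "(LINT z:?R|lebesgue. f z) = (LBINT z. indicator ?R z *\<^sub>R f z)"
    unfolding set_lebesgue_integral_def by (rule integral_completion) measurable
  also have "\<dots> = (\<integral>z. indicator ?R z *\<^sub>R f z \<partial>(lborel \<Otimes>\<^sub>M lborel))"
    by (simp add: lborel_prod)
  also have "\<dots> = (LBINT y. LBINT x. indicator ?R (x, y) *\<^sub>R f (x, y))"
    using lborel_pair.integral_snd[of "\<lambda>x y. indicator ?R (x, y) *\<^sub>R f (x, y)"] int2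
    by (simp add: split_def)
  finally have a: "(LINT z:?R|lebesgue. f z) = (LBINT y:{l<..<r}. integral {-G y..G y} (\<lambda>x. f (x, y)))"
    unfolding eq by (simp only: set_lebesgue_integral_def)
  have "integrable lborel (\<lambda>y. LBINT x. indicator ?R (x, y) *\<^sub>R f (x, y))"
    using lborel_pair.integrable_snd[of "\<lambda>x y. indicator ?R (x, y) *\<^sub>R f (x, y)"] int2 by (simp add: split_def)
  then have si: "set_integrable lborel {l<..<r} (\<lambda>y. integral {-G y..G y} (\<lambda>x. f (x, y)))"
    unfolding eq set_integrable_def .
  show "(LINT z:?R|lebesgue. f z) = integral {l..r} (\<lambda>y. integral {-G y..G y} (\<lambda>x. f (x, y)))"
    unfolding a set_borel_integral_eq_integral(2)[OF si] by (simp add: integral_open_interval_real)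
qed

lemma integral_zero_outside:
  fixes f :: "real \<Rightarrow> real"
  assumes "f integrable_on {l..r}" "l \<le> a" "a \<le> b" "b \<le> r" "\<And>x. x \<in> {l..r} - {a..b} \<Longrightarrow> f x = 0"
  shows "integral {l..r} f = integral {a..b} f"
proof -
  have "integral {l..r} f = integral {l..r} (\<lambda>x. if x \<in> {a..b} then f x else 0)"
    using assms by (intro integral_cong) auto
  also have "\<dots> = integral ({a..b} \<inter> {l..r}) f"
    by (rule integral_restrict_Int)
  also have "{a..b} \<inter> {l..r} = {a..b}" using assms by auto
  finally show ?thesis .
qed

text \<open>As the step at \<open>c\<close> gets steeper its derivative tends to the Dirac mass at \<open>c\<close>, and the step
  itself to the indicator function of \<open>[c, r]\<close>.\<close>

lemma step_limits:
  fixes F :: "real \<Rightarrow> real"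
  assumes F: "continuous_on {l..r} F" and c: "l \<le> c" "c < r"
  shows "((\<lambda>e. integral {l..r} (\<lambda>y. smooth_step' ((y - c) / e) / e * F y)) \<longlongrightarrow> F c) (at_right 0)"
    and "((\<lambda>e. integral {l..r} (\<lambda>y. smooth_step ((y - c) / e) * F y)) \<longlongrightarrow> integral {c..r} F) (at_right 0)"
proof -
  have dst: "((\<lambda>y. smooth_step ((y - c) / e)) has_real_derivative smooth_step' ((y - c) / e) / e) (at y within S)"
    if "e > 0" for e y S
    using DERIV_chain2[OF smooth_step_deriv, of "\<lambda>y. (y - c) / e" "1 / e" y S, OF DERIV_cdivide[OF DERIV_minus_const]] that
    by simp
  have cs: "continuous_on UNIV smooth_step"
    using smooth_step_deriv by (meson DERIV_continuous_on has_field_derivative_at_within)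
  have cont1: "continuous_on S (\<lambda>y. smooth_step ((y - c) / e))" if "e > 0" for e S
    using that by (intro continuous_on_compose2[OF cs] continuous_intros) auto
  have cont2: "continuous_on S (\<lambda>y. smooth_step' ((y - c) / e) / e)" if "e > 0" for e S
    using that by (intro continuous_intros continuous_on_compose2[OF continuous_smooth_step'[of UNIV]]) auto
  have int1: "((\<lambda>y. smooth_step' ((y - c) / e) / e) has_integral 1) {c..c+e}" if "e > 0" for e
    using fundamental_theorem_of_calculus[of c "c+e" "\<lambda>y. smooth_step ((y - c) / e)" "\<lambda>y. smooth_step' ((y - c) / e) / e"] dst[OF that] that
    by (simp add: has_real_derivative_iff_has_vector_derivative smooth_step_0 smooth_step_1)
  have Fc: "(F \<longlongrightarrow> F c) (at c within {l..r})"
    using F c by (auto simp: continuous_on_def)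
  show "((\<lambda>e. integral {l..r} (\<lambda>y. smooth_step' ((y - c) / e) / e * F y)) \<longlongrightarrow> F c) (at_right 0)"
  proof (rule tendstoI)
    fix d :: real assume d: "d > 0"
    then obtain s where s: "s > 0" "\<And>y. y \<in> {l..r} \<Longrightarrow> \<bar>y - c\<bar> < s \<Longrightarrow> \<bar>F y - F c\<bar> < d / 2"
      using F[unfolded continuous_on_iff, rule_format, of c "d/2"] c by (auto simp: dist_real_def)
    have "dist (integral {l..r} (\<lambda>y. smooth_step' ((y - c) / e) / e * F y)) (F c) < d"
      if e: "e > 0" "e < min s (r - c)" for e
    proof -
      let ?w = "\<lambda>y. smooth_step' ((y - c) / e) / e"
      have "integral {l..r} (\<lambda>y. ?w y * F y) = integral {c..c+e} (\<lambda>y. ?w y * F y)"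
      proof (rule integral_zero_outside)
        show "(\<lambda>y. ?w y * F y) integrable_on {l..r}"
          by (rule integrable_continuous_real) (intro continuous_intros cont2 F e)
        show "?w y * F y = 0" if "y \<in> {l..r} - {c..c+e}" for y
        proof -
          have "(y - c) / e \<le> 0 \<or> (y - c) / e \<ge> 1" using that e by (auto simp: field_simps)
          then show ?thesis by (auto simp: smooth_step'_0 smooth_step'_1)
        qed
      qed (use e c in auto)
      also have "\<dots> - F c = integral {c..c+e} (\<lambda>y. ?w y * (F y - F c))"
      proof -
        have "continuous_on {c..c+e} (\<lambda>y. ?w y * F y)"
          using e c by (intro continuous_intros cont2 continuous_on_subset[OF F]) auto
        then have "((\<lambda>y. ?w y * F y - ?w y * F c) has_integral integral {c..c+e} (\<lambda>y. ?w y * F y) - 1 * F c) {c..c+e}"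
          by (intro has_integral_diff has_integral_mult_left int1 e integrable_integral integrable_continuous_real)
        from integral_unique[OF this] show ?thesis by (simp only: right_diff_distrib mult_1)
      qed
      also have "\<bar>\<dots>\<bar> \<le> integral {c..c+e} (\<lambda>y. ?w y * (d / 2))"
        unfolding real_norm_def[symmetric]
      proof (rule integral_norm_bound_integral)
        show "(\<lambda>y. ?w y * (F y - F c)) integrable_on {c..c+e}"
          using e c by (intro integrable_continuous_real continuous_intros cont2 continuous_on_subset[OF F]) auto
        show "(\<lambda>y. ?w y * (d / 2)) integrable_on {c..c+e}"
          using e c by (intro integrable_continuous_real continuous_intros cont2) auto
        show "norm (?w y * (F y - F c)) \<le> ?w y * (d / 2)" if "y \<in> {c..c+e}" for y
        proof -
          have "\<bar>F y - F c\<bar> \<le> d / 2" using s(2)[of y] that e c by auto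
          moreover have w: "?w y \<ge> 0" using e smooth_step'_nonneg by simp
          ultimately have "?w y * \<bar>F y - F c\<bar> \<le> ?w y * (d / 2)" by (intro mult_left_mono)
          then show ?thesis unfolding real_norm_def abs_mult abs_of_nonneg[OF w] .
        qed
      qed
      also have "\<dots> = d / 2"
        using integral_unique[OF has_integral_mult_left[OF int1[OF e(1)], of "d/2"]] by (simp only: mult_1)
      finally show ?thesis using d by (simp add: dist_real_def)
    qed
    then show "eventually (\<lambda>e. dist (integral {l..r} (\<lambda>y. smooth_step' ((y - c) / e) / e * F y)) (F c) < d) (at_right 0)"
      using s c by (intro eventually_at_rightI[of 0 "min s (r - c)"]) auto
  qed
  obtain B where B: "\<And>y. y \<in> {l..r} \<Longrightarrow> \<bar>F y\<bar> \<le> B"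
    using compact_imp_bounded[OF compact_continuous_image[OF F compact_Icc]]
    unfolding bounded_iff by (metis image_eqI real_norm_def)
  show "((\<lambda>e. integral {l..r} (\<lambda>y. smooth_step ((y - c) / e) * F y)) \<longlongrightarrow> integral {c..r} F) (at_right 0)"
  proof (rule tendstoI)
    fix d :: real assume d: "d > 0"
    have B0: "B \<ge> 0" using B[of c] c by force
    have "dist (integral {l..r} (\<lambda>y. smooth_step ((y - c) / e) * F y)) (integral {c..r} F) < d"
      if e: "e > 0" "e < min (d / (B + 1)) (r - c)" for e
    proof -
      let ?w = "\<lambda>y. smooth_step ((y - c) / e)"
      have "integral {l..r} (\<lambda>y. ?w y * F y) = integral {c..r} (\<lambda>y. ?w y * F y)"
      proof (rule integral_zero_outside)
        show "(\<lambda>y. ?w y * F y) integrable_on {l..r}"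
          by (rule integrable_continuous_real) (intro continuous_intros cont1 F e)
        show "?w y * F y = 0" if "y \<in> {l..r} - {c..r}" for y
          using that e by (auto simp: field_simps smooth_step_0)
      qed (use e c in auto)
      also have "\<dots> - integral {c..r} F = integral {c..r} (\<lambda>y. (?w y - 1) * F y)"
      proof -
        have "(\<lambda>y. ?w y * F y) integrable_on {c..r}" "F integrable_on {c..r}"
          using e c by (auto intro!: integrable_continuous_real continuous_intros cont1 continuous_on_subset[OF F])
        from integral_diff[OF this] show ?thesis by (simp add: algebra_simps)
      qed
      also have "\<dots> = integral {c..c+e} (\<lambda>y. (?w y - 1) * F y)"
      proof (rule integral_zero_outside)
        show "(\<lambda>y. (?w y - 1) * F y) integrable_on {c..r}"
          using e c by (intro integrable_continuous_real continuous_intros cont1 continuous_on_subset[OF F]) auto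
        show "(?w y - 1) * F y = 0" if "y \<in> {c..r} - {c..c+e}" for y
          using that e by (auto simp: field_simps smooth_step_1)
      qed (use e c in auto)
      also have "\<bar>\<dots>\<bar> \<le> integral {c..c+e} (\<lambda>y. B)"
        unfolding real_norm_def[symmetric]
      proof (rule integral_norm_bound_integral)
        show "(\<lambda>y. (?w y - 1) * F y) integrable_on {c..c+e}"
          using e c by (intro integrable_continuous_real continuous_intros cont1 continuous_on_subset[OF F]) auto
        show "norm ((?w y - 1) * F y) \<le> B" if "y \<in> {c..c+e}" for y
        proof -
          have "\<bar>?w y - 1\<bar> \<le> 1" using smooth_step_range[of "(y - c) / e"] by auto
          moreover have "\<bar>F y\<bar> \<le> B" using that e c by (intro B) auto
          ultimately have "\<bar>?w y - 1\<bar> * \<bar>F y\<bar> \<le> 1 * B" by (intro mult_mono) auto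
          then show ?thesis by (simp add: abs_mult)
        qed
      qed auto
      also have "\<dots> = B * e" using e by simp
      also have "\<dots> < d"
      proof -
        have "B * e \<le> (B + 1) * e" using e by (intro mult_right_mono) auto
        also have "\<dots> < d" using e B0 by (simp add: field_simps)
        finally show ?thesis .
      qed
      finally show ?thesis by (simp add: dist_real_def)
    qed
    then show "eventually (\<lambda>e. dist (integral {l..r} (\<lambda>y. smooth_step ((y - c) / e) * F y)) (integral {c..r} F) < d) (at_right 0)"
      using d c B0 by (intro eventually_at_rightI[of 0 "min (d / (B + 1)) (r - c)"]) auto
  qed
qed

section \<open>Lower bounds for the perimeter by calibrations\<close>

text \<open>Inner integrals over the section \<open>[-s, s]\<close>: \<open>odd_diff A s\<close> is that of the derivative of \<open>A\<close>,
  and \<open>wint \<alpha> B s\<close> is the weighted integral of \<open>B\<close>, that is, the flux of a field with vertical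
  component \<open>B\<close> through the section.\<close>

definition odd_diff :: "(real \<Rightarrow> real) \<Rightarrow> real \<Rightarrow> real" where
  "odd_diff A s = A s - A (- s)"

definition wint :: "real \<Rightarrow> (real \<Rightarrow> real) \<Rightarrow> real \<Rightarrow> real" where
  "wint \<alpha> B s = integral {-s..s} (\<lambda>x. \<bar>x\<bar> powr \<alpha> * B x)"

lemma weight_integrable:
  assumes "\<alpha> \<ge> 0" "continuous_on UNIV B"
  shows "(\<lambda>x. \<bar>x\<bar> powr \<alpha> * B x) integrable_on {a..b::real}"
proof -
  obtain C where C: "\<And>y. y \<in> {a..b} \<Longrightarrow> \<bar>B y\<bar> \<le> C"
    using compact_imp_bounded[OF compact_continuous_image[OF continuous_on_subset[OF assms(2)] compact_Icc]]
    unfolding bounded_iff by (metis image_eqI real_norm_def subset_UNIV)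
  have [measurable]: "B \<in> borel_measurable borel" using assms(2) by (rule borel_measurable_continuous_onI)
  show ?thesis
  proof (rule integrable_on_bounded_borel)
    show "(\<lambda>x. \<bar>x\<bar> powr \<alpha> * B x) \<in> borel_measurable borel" by measurable
    show "\<bar>\<bar>x\<bar> powr \<alpha> * B x\<bar> \<le> (\<bar>a\<bar> + \<bar>b\<bar>) powr \<alpha> * C" if "x \<in> {a..b}" for x
      using C[OF that] that assms(1) by (auto simp: abs_mult intro!: mult_mono powr_mono2)
  qed
qed

lemma continuous_wint:
  assumes "\<alpha> \<ge> 0" "continuous_on UNIV B"
  shows "continuous_on {0..M} (wint \<alpha> B)"
proof -
  let ?f = "\<lambda>x. \<bar>x\<bar> powr \<alpha> * B x"
  let ?J = "\<lambda>s. integral {-M..s} ?f"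
  have J: "continuous_on {-M..M} ?J"
    by (rule indefinite_integral_continuous_1) (rule weight_integrable[OF assms])
  have *: "wint \<alpha> B s = ?J s - ?J (-s)" if "s \<in> {0..M}" for s :: real
    using Henstock_Kurzweil_Integration.integral_combine[where a="-M" and c="-s" and b=s and f="?f"] weight_integrable[OF assms] that
    by (auto simp: wint_def)
  have "continuous_on {0..M} (\<lambda>s. ?J s - ?J (-s))"
    by (intro continuous_intros continuous_on_compose2[OF J]) auto
  then show ?thesis by (subst continuous_on_cong[OF refl *])
qed

lemma wint_bound:
  assumes "\<alpha> \<ge> 0" "continuous_on UNIV B" "0 \<le> s" "s \<le> M" "\<And>x. x \<in> {-M..M} \<Longrightarrow> \<bar>B x\<bar> \<le> d"
  shows "\<bar>wint \<alpha> B s\<bar> \<le> 2 * M * M powr \<alpha> * d"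
proof -
  have d: "d \<ge> 0" using assms(5)[of 0] assms(3,4) by force
  have "norm (wint \<alpha> B s) \<le> integral {-s..s} (\<lambda>x. M powr \<alpha> * d)"
    unfolding wint_def
  proof (rule integral_norm_bound_integral[OF weight_integrable[OF assms(1,2)]])
    show "norm (\<bar>x\<bar> powr \<alpha> * B x) \<le> M powr \<alpha> * d" if "x \<in> {-s..s}" for x
      using that assms d by (auto simp: abs_mult intro!: mult_mono powr_mono2)
  qed auto
  also have "\<dots> = 2 * s * (M powr \<alpha> * d)" using assms by simp
  also have "\<dots> \<le> 2 * M * (M powr \<alpha> * d)" using assms d by (intro mult_right_mono) auto
  finally show ?thesis by (simp add: mult_ac)
qed

lemma wint_diff:
  assumes "\<alpha> \<ge> 0" "continuous_on UNIV B" "continuous_on UNIV C"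
  shows "wint \<alpha> (\<lambda>x. B x - C x) s = wint \<alpha> B s - wint \<alpha> C s"
  using integral_diff[OF weight_integrable[OF assms(1,2)] weight_integrable[OF assms(1,3)], of "-s" s]
  by (simp add: wint_def algebra_simps)

text \<open>Gluing the fields \<open>X i\<close> with steps \<open>S i\<close> that decrease in \<open>i\<close> gives a convex combination of
  them, hence a field of norm at most \<open>1\<close>. The induction proves the stronger bound
  \<open>1 - t\<close> for the glued field minus \<open>t\<close> times the last \<open>X i\<close>.\<close>

lemma glued_norm:
  fixes X :: "nat \<Rightarrow> 'a::real_normed_vector" and S :: "nat \<Rightarrow> real"
  assumes X: "\<And>i. i \<le> n \<Longrightarrow> norm (X i) \<le> 1"
    and S: "\<And>i. i < n \<Longrightarrow> 0 \<le> S i \<and> S i \<le> 1" "\<And>i. Suc i < n \<Longrightarrow> S (Suc i) \<le> S i"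
  shows "norm (X 0 + (\<Sum>i<n. S i *\<^sub>R (X (Suc i) - X i))) \<le> 1"
proof -
  let ?Z = "\<lambda>m. X 0 + (\<Sum>i<m. S i *\<^sub>R (X (Suc i) - X i))"
  have "m \<le> n \<Longrightarrow> 0 \<le> t \<Longrightarrow> t \<le> 1 \<Longrightarrow> (m > 0 \<Longrightarrow> t \<le> S (m - 1)) \<Longrightarrow> norm (?Z m - t *\<^sub>R X m) \<le> 1 - t" for m t
  proof (induction m arbitrary: t)
    case 0
    have "?Z 0 - t *\<^sub>R X 0 = (1 - t) *\<^sub>R X 0" by (simp add: algebra_simps)
    then have "norm (?Z 0 - t *\<^sub>R X 0) = (1 - t) * norm (X 0)" using 0 by simp
    also have "\<dots> \<le> (1 - t) * 1" using 0 X[of 0] by (intro mult_left_mono) auto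
    finally show ?case by simp
  next
    case (Suc m)
    have t: "t \<le> S m" using Suc.prems by simp
    have "?Z (Suc m) - t *\<^sub>R X (Suc m) = (?Z m - S m *\<^sub>R X m) + (S m - t) *\<^sub>R X (Suc m)"
      by (simp add: algebra_simps)
    also have "norm \<dots> \<le> norm (?Z m - S m *\<^sub>R X m) + norm ((S m - t) *\<^sub>R X (Suc m))"
      by (rule norm_triangle_ineq)
    also have "norm (?Z m - S m *\<^sub>R X m) \<le> 1 - S m"
      using Suc.prems S(1)[of m] S(2)[of "m - 1"] by (intro Suc.IH) auto
    also have "norm ((S m - t) *\<^sub>R X (Suc m)) \<le> (S m - t) * 1"
      using t mult_left_mono[OF X[of "Suc m"], of "S m - t"] Suc.prems by simp
    finally show ?case by simp
  qed
  from this[of n 0] show ?thesis using S(1)[of "n - 1"] by auto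
qed

text \<open>The number that a stack of horizontally varying fields contributes to the perimeter of the
  strip: below height \<open>c 0\<close> the field is \<open>(A 0, B 0)\<close>, and at height \<open>c i\<close> it changes from
  \<open>(A i, B i)\<close> to \<open>(A (Suc i), B (Suc i))\<close>. Every field contributes the integral of its
  horizontal divergence over its own layer, and every change of field the jump of the flux.\<close>

definition calib_value ::
  "real \<Rightarrow> (real \<Rightarrow> real) \<Rightarrow> real \<Rightarrow> real \<Rightarrow> nat \<Rightarrow> (nat \<Rightarrow> real) \<Rightarrow> (nat \<Rightarrow> real \<Rightarrow> real) \<Rightarrow> (nat \<Rightarrow> real \<Rightarrow> real) \<Rightarrow> real" where
  "calib_value \<alpha> G l r n c A B =
     integral {l..r} (\<lambda>y. odd_diff (A 0) (G y)) +
     (\<Sum>i<n. integral {c i..r} (\<lambda>y. odd_diff (A (Suc i)) (G y) - odd_diff (A i) (G y)) +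
            (wint \<alpha> (B (Suc i)) (G (c i)) - wint \<alpha> (B i) (G (c i))))"

text \<open>A stack of \<open>C\<^sup>1\<close> unit fields with compact support in \<open>x\<close>. The test field is the stack glued
  with steps of width \<open>e\<close>, times a cut-off in \<open>y\<close> that equals \<open>1\<close> on the strip; the bound is the
  limit \<open>e \<rightarrow> 0\<close>.\<close>

lemma calibration_C1:
  assumes \<alpha>: "\<alpha> \<ge> 0" and lr: "l < r" and G: "continuous_on {l..r} G"
    and GM: "\<And>y. y \<in> {l..r} \<Longrightarrow> 0 \<le> G y \<and> G y \<le> M"
    and A: "\<And>i x. (A i has_real_derivative A' i x) (at x)" "\<And>i. continuous_on UNIV (A' i)"
      "\<And>i x. \<bar>x\<bar> > N \<Longrightarrow> A i x = 0"
    and B: "\<And>i x. (B i has_real_derivative B' i x) (at x)" "\<And>i. continuous_on UNIV (B' i)"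
      "\<And>i x. \<bar>x\<bar> > N \<Longrightarrow> B i x = 0"
    and unit: "\<And>i x. (A i x)\<^sup>2 + (B i x)\<^sup>2 \<le> 1"
    and c: "\<And>i. i < n \<Longrightarrow> l \<le> c i \<and> c i < r" "\<And>i. Suc i < n \<Longrightarrow> c i \<le> c (Suc i)"
  shows "ereal (calib_value \<alpha> G l r n c A B) \<le> grushin_perimeter \<alpha> (strip G l r)"
proof -
  let ?S = "\<lambda>e i y. smooth_step ((y - c i) / e)"
  let ?S' = "\<lambda>e i y. smooth_step' ((y - c i) / e) / e"
  have dS: "(?S e i has_real_derivative ?S' e i y) (at y)" for e i y
    using DERIV_chain2[OF smooth_step_deriv, of "\<lambda>y. (y - c i) / e" "1 / e" y UNIV, OF DERIV_cdivide[OF DERIV_minus_const]]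
    by simp
  have cS: "continuous_on X (?S e i)" for X e i
    using dS by (meson DERIV_continuous_on has_field_derivative_at_within)
  have cS': "continuous_on X (?S' e i)" for X e i
  proof (cases "e = 0")
    case False then show ?thesis
      by (intro continuous_intros continuous_on_compose2[OF continuous_smooth_step'[of UNIV]]) auto
  qed simp
  have cA: "continuous_on X (A i)" and cB: "continuous_on X (B i)" for X i
    using A(1) B(1) by (meson DERIV_continuous_on has_field_derivative_at_within)+
  have cA': "continuous_on X (A' i)" for X i using A(2) continuous_on_subset by blast
  have comp: "continuous_on X (\<lambda>z. h (fst z))" "continuous_on X (\<lambda>z. h (snd z))"
    if "continuous_on UNIV h" for h :: "real \<Rightarrow> real" and X :: "(real \<times> real) set"
    by (intro continuous_on_compose2[OF that] continuous_intros; simp)+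
  have M: "M \<ge> 0" using GM[of l] lr by force
  define val where "val e = integral {l..r} (\<lambda>y. odd_diff (A 0) (G y)) +
     (\<Sum>i<n. integral {l..r} (\<lambda>y. ?S e i y * (odd_diff (A (Suc i)) (G y) - odd_diff (A i) (G y))) +
           integral {l..r} (\<lambda>y. ?S' e i y * (wint \<alpha> (B (Suc i)) (G y) - wint \<alpha> (B i) (G y))))" for e
  have cG: "continuous_on {l..r} (\<lambda>y. h (G y))" if "continuous_on {0..M} h" for h :: "real \<Rightarrow> real"
    using GM by (intro continuous_on_compose2[OF that] G) auto
  have cw: "continuous_on {l..r} (\<lambda>y. wint \<alpha> (B i) (G y))" for i
    by (rule cG[OF continuous_wint[OF \<alpha> cB]])
  have co: "continuous_on {l..r} (\<lambda>y. odd_diff (A i) (G y))" for i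
    unfolding odd_diff_def
    by (rule cG) (intro continuous_intros cA continuous_on_compose2[OF cA[of UNIV]]; simp)
  have lim: "(val \<longlongrightarrow> calib_value \<alpha> G l r n c A B) (at_right 0)"
    unfolding val_def calib_value_def
    using c(1) by (intro tendsto_intros step_limits continuous_intros co cw) auto
  have "ereal (val e) \<le> grushin_perimeter \<alpha> (strip G l r)" if e: "e > 0" for e
  proof -
    obtain \<kappa> \<kappa>' where \<kappa>: "\<And>x. (\<kappa> has_real_derivative \<kappa>' x) (at x)" "continuous_on UNIV \<kappa>'"
      "\<And>x. 0 \<le> \<kappa> x \<and> \<kappa> x \<le> 1" "\<And>x. x \<in> {l..r} \<Longrightarrow> \<kappa> x = 1" "\<And>x. x \<in> {l..r} \<Longrightarrow> \<kappa>' x = 0"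
      "\<And>x. x < l - 1 \<or> x > r + 1 \<Longrightarrow> \<kappa> x = 0"
      using bump_exists[of l r] lr by auto
    have c\<kappa>: "continuous_on UNIV \<kappa>"
      using \<kappa>(1) by (meson DERIV_continuous_on has_field_derivative_at_within)
    define F where "F (A :: nat \<Rightarrow> real \<Rightarrow> real) z =
      \<kappa> (snd z) * A 0 (fst z) + (\<Sum>i<n. (\<kappa> (snd z) * ?S e i (snd z)) * (A (Suc i) (fst z) - A i (fst z)))" for A z
    have FC1: "C1_compact_support (F A)"
      if A: "\<And>i x. (A i has_real_derivative A' i x) (at x)" "\<And>i. continuous_on UNIV (A' i)"
      "\<And>i x. \<bar>x\<bar> > N \<Longrightarrow> A i x = 0" for A A'
    proof -
      let ?N = "max N (\<bar>l\<bar> + \<bar>r\<bar> + 1)"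
      have out: "\<kappa> x = 0" if "\<bar>x\<bar> > ?N" for x
        by (rule \<kappa>(6)) (use that in auto)
      show ?thesis
        unfolding F_def[abs_def]
      proof (intro C1_compact_support_add C1_compact_support_sum)
        show "C1_compact_support (\<lambda>z. \<kappa> (snd z) * A 0 (fst z))"
          by (rule C1_compact_support_prod[where N="?N" and A'="A' 0" and B'=\<kappa>'])
             (use A \<kappa> out in auto)
        show "C1_compact_support (\<lambda>z. \<kappa> (snd z) * ?S e i (snd z) * (A (Suc i) (fst z) - A i (fst z)))" for i
        proof (rule C1_compact_support_prod[where N="?N" and A'="\<lambda>x. A' (Suc i) x - A' i x" and
                A="\<lambda>x. A (Suc i) x - A i x" and B="\<lambda>y. \<kappa> y * ?S e i y" and B'="\<lambda>y. \<kappa>' y * ?S e i y + ?S' e i y * \<kappa> y"])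
          show "((\<lambda>y. \<kappa> y * ?S e i y) has_real_derivative \<kappa>' x * ?S e i x + ?S' e i x * \<kappa> x) (at x)" for x
            by (rule DERIV_mult[OF \<kappa>(1) dS])
          show "continuous_on UNIV (\<lambda>y. \<kappa>' y * ?S e i y + ?S' e i y * \<kappa> y)"
            by (intro continuous_on_add continuous_on_mult \<kappa>(2) cS cS' c\<kappa>)
        qed (use A out in \<open>auto intro!: DERIV_diff continuous_on_diff\<close>)
      qed
    qed
    have norm: "sqrt ((F A z)\<^sup>2 + (F B z)\<^sup>2) \<le> 1" for z
    proof -
      let ?X = "\<lambda>i. (A i (fst z), B i (fst z))"
      have "(F A z, F B z) = \<kappa> (snd z) *\<^sub>R (?X 0 + (\<Sum>i<n. ?S e i (snd z) *\<^sub>R (?X (Suc i) - ?X i)))"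
        by (simp add: F_def prod_eq_iff fst_sum snd_sum sum_distrib_left algebra_simps)
      then have "norm (F A z, F B z) = \<kappa> (snd z) * norm (?X 0 + (\<Sum>i<n. ?S e i (snd z) *\<^sub>R (?X (Suc i) - ?X i)))"
        using \<kappa>(3)[of "snd z"] by simp
      also have "\<dots> \<le> 1"
      proof -
        have "norm (?X 0 + (\<Sum>i<n. ?S e i (snd z) *\<^sub>R (?X (Suc i) - ?X i))) \<le> 1"
          using c(2) e by (intro glued_norm)
            (auto simp: norm_Pair unit smooth_step_range divide_right_mono intro!: smooth_step_mono)
        then show ?thesis using \<kappa>(3)[of "snd z"] by (auto intro: mult_le_one)
      qed
      finally show ?thesis by (simp add: norm_Pair)
    qed
    define f1 where "f1 z = A' 0 (fst z) + (\<Sum>i<n. ?S e i (snd z) * (A' (Suc i) (fst z) - A' i (fst z)))" for z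
    define f2 where "f2 z = (\<Sum>i<n. ?S' e i (snd z) * (B (Suc i) (fst z) - B i (fst z)))" for z
    have px: "partial_x (F A) z = f1 z" if "z \<in> strip G l r" for z
    proof -
      obtain x y where z: "z = (x, y)" by (cases z)
      have y: "\<kappa> y = 1" using that z by (intro \<kappa>) (auto simp: strip_def)
      have "((\<lambda>s. F A (s, y)) has_real_derivative f1 (x, y)) (at x)"
        unfolding F_def f1_def using y by (auto intro!: derivative_eq_intros A(1) simp: mult.commute)
      then show ?thesis unfolding z partial_x_def by (simp add: DERIV_imp_deriv)
    qed
    have py: "partial_y (F B) z = f2 z" if "z \<in> strip G l r" for z
    proof -
      obtain x y where z: "z = (x, y)" by (cases z)
      have y: "\<kappa> y = 1" "\<kappa>' y = 0" using that z by (auto intro!: \<kappa> simp: strip_def)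
      have "((\<lambda>s. F B (x, s)) has_real_derivative f2 (x, y)) (at y)"
        unfolding F_def f2_def using y by (auto intro!: derivative_eq_intros \<kappa>(1) dS simp: mult.commute)
      then show ?thesis unfolding z partial_y_def by (simp add: DERIV_imp_deriv)
    qed
    let ?f = "\<lambda>z. f1 z + \<bar>fst z\<bar> powr \<alpha> * f2 z"
    have cf1: "continuous_on UNIV f1" unfolding f1_def
      by (intro continuous_intros comp cS cA')
    have cf2: "continuous_on UNIV f2" unfolding f2_def
      by (intro continuous_intros comp cS' cB)
    have bdd: "\<exists>C. \<forall>z\<in>strip G l r. \<bar>h z\<bar> \<le> C" if "continuous_on UNIV h" for h :: "real \<times> real \<Rightarrow> real"
    proof -
      have "compact (h ` cbox (-M, l) (M, r))"
        by (intro compact_continuous_image continuous_on_subset[OF that]) auto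
      then obtain C where "\<And>z. z \<in> cbox (-M, l) (M, r) \<Longrightarrow> \<bar>h z\<bar> \<le> C"
        using compact_imp_bounded[of "h ` cbox (- M, l) (M, r)"] unfolding bounded_iff by (metis image_eqI real_norm_def)
      moreover have "strip G l r \<subseteq> cbox (-M, l) (M, r)" using GM by (intro strip_subset_cbox) auto
      ultimately show ?thesis by blast
    qed
    obtain C1 C2 where C: "\<And>z. z\<in>strip G l r \<Longrightarrow> \<bar>f1 z\<bar> \<le> C1" "\<And>z. z\<in>strip G l r \<Longrightarrow> \<bar>f2 z\<bar> \<le> C2"
      using bdd[OF cf1] bdd[OF cf2] by blast
    have [measurable]: "f1 \<in> borel_measurable borel" "f2 \<in> borel_measurable borel"
      using cf1 cf2 by (auto intro: borel_measurable_continuous_onI)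
    have [measurable]: "(\<lambda>z::real \<times> real. \<bar>fst z\<bar>) \<in> borel_measurable borel"
      by (intro borel_measurable_continuous_onI continuous_intros)
    have fm: "?f \<in> borel_measurable borel" by measurable
    have fb: "\<bar>?f z\<bar> \<le> C1 + M powr \<alpha> * C2" if z: "z \<in> strip G l r" for z
    proof -
      have "\<bar>fst z\<bar> \<le> M" using z GM[of "snd z"] by (auto simp: strip_def)
      then have "\<bar>\<bar>fst z\<bar> powr \<alpha> * f2 z\<bar> \<le> M powr \<alpha> * C2"
        using C(2)[OF z] \<alpha> by (auto simp: abs_mult intro!: mult_mono powr_mono2)
      then show ?thesis using C(1)[OF z] by linarith
    qed
    note SI = strip_integral[OF G fm fb]
    have inner: "integral {- G y..G y} (\<lambda>x. ?f (x, y)) = odd_diff (A 0) (G y) +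
      (\<Sum>i<n. ?S e i y * (odd_diff (A (Suc i)) (G y) - odd_diff (A i) (G y)) +
              ?S' e i y * (wint \<alpha> (B (Suc i)) (G y) - wint \<alpha> (B i) (G y)))" if y: "y \<in> {l..r}" for y
    proof -
      have hA: "(A' i has_integral odd_diff (A i) (G y)) {- G y..G y}" for i
        unfolding odd_diff_def using A(1) GM[OF y]
        by (intro fundamental_theorem_of_calculus)
           (auto simp: has_real_derivative_iff_has_vector_derivative[symmetric] intro: has_field_derivative_at_within)
      have hB: "((\<lambda>x. \<bar>x\<bar> powr \<alpha> * B i x) has_integral wint \<alpha> (B i) (G y)) {- G y..G y}" for i
        unfolding wint_def by (intro integrable_integral weight_integrable \<alpha> cB)
      have "((\<lambda>x. (A' 0 x + (\<Sum>i<n. ?S e i y * (A' (Suc i) x - A' i x))) +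
             (\<Sum>i<n. ?S' e i y * (\<bar>x\<bar> powr \<alpha> * B (Suc i) x - \<bar>x\<bar> powr \<alpha> * B i x))) has_integral
           (odd_diff (A 0) (G y) + (\<Sum>i<n. ?S e i y * (odd_diff (A (Suc i)) (G y) - odd_diff (A i) (G y)))) +
           (\<Sum>i<n. ?S' e i y * (wint \<alpha> (B (Suc i)) (G y) - wint \<alpha> (B i) (G y)))) {- G y..G y}"
        by (intro has_integral_add has_integral_sum has_integral_mult_right has_integral_diff hA hB) auto
      moreover have "\<bar>x\<bar> powr \<alpha> * (\<Sum>i<n. ?S' e i y * (B (Suc i) x - B i x)) =
         (\<Sum>i<n. ?S' e i y * (\<bar>x\<bar> powr \<alpha> * B (Suc i) x - \<bar>x\<bar> powr \<alpha> * B i x))" for x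
        unfolding sum_distrib_left by (rule sum.cong) (simp_all only: right_diff_distrib mult.left_commute)
      ultimately show ?thesis
        by (intro integral_unique) (simp only: f1_def f2_def sum.distrib add.assoc fst_conv snd_conv)
    qed
    have "(LINT z:strip G l r|lebesgue. partial_x (F A) z + \<bar>fst z\<bar> powr \<alpha> * partial_y (F B) z) =
      (LINT z:strip G l r|lebesgue. ?f z)"
      using strip_borel[OF G] by (intro set_lebesgue_integral_cong) (auto simp: px py)
    also have "\<dots> = integral {l..r} (\<lambda>y. integral {- G y..G y} (\<lambda>x. ?f (x, y)))"
      by (rule SI(2))
    also have "\<dots> = integral {l..r} (\<lambda>y. odd_diff (A 0) (G y) +
      (\<Sum>i<n. ?S e i y * (odd_diff (A (Suc i)) (G y) - odd_diff (A i) (G y)) +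
              ?S' e i y * (wint \<alpha> (B (Suc i)) (G y) - wint \<alpha> (B i) (G y))))"
      by (rule integral_cong) (rule inner)
    also have "\<dots> = val e"
    proof (rule integral_unique)
      have "(\<lambda>y. odd_diff (A 0) (G y)) integrable_on {l..r}"
        "(\<lambda>y. ?S e i y * (odd_diff (A (Suc i)) (G y) - odd_diff (A i) (G y))) integrable_on {l..r}"
        "(\<lambda>y. ?S' e i y * (wint \<alpha> (B (Suc i)) (G y) - wint \<alpha> (B i) (G y))) integrable_on {l..r}" for i
        by (intro integrable_continuous_real continuous_on_mult continuous_on_diff co cw cS cS')+
      then show "((\<lambda>y. odd_diff (A 0) (G y) +
      (\<Sum>i<n. ?S e i y * (odd_diff (A (Suc i)) (G y) - odd_diff (A i) (G y)) +
              ?S' e i y * (wint \<alpha> (B (Suc i)) (G y) - wint \<alpha> (B i) (G y)))) has_integral val e) {l..r}"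
        unfolding val_def by (intro has_integral_add has_integral_sum integrable_integral) auto
    qed
    finally show ?thesis
      unfolding grushin_perimeter_def
      using norm FC1[OF A] FC1[OF B]
      by (intro SUP_upper2[where i="(F A, F B)"]) auto
  qed
  then have "eventually (\<lambda>e. ereal (val e) \<le> grushin_perimeter \<alpha> (strip G l r)) (at_right 0)"
    by (intro eventually_at_rightI[of 0 1]) auto
  with lim show ?thesis
    by (intro tendsto_upperbound[of "\<lambda>e. ereal (val e)" _ "at_right (0::real)"]) auto
qed

text \<open>Weierstrass approximation by unit fields: the field is extended beyond \<open>[-M, M]\<close> by its
  boundary values, approximated by polynomials, scaled down and cut off.\<close>

lemma C1_unit_approx:
  fixes A B :: "real \<Rightarrow> real"
  assumes A: "continuous_on UNIV A" and B: "continuous_on UNIV B" and M: "M \<ge> 0"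
    and unit: "\<And>x. x \<in> {-M..M} \<Longrightarrow> (A x)\<^sup>2 + (B x)\<^sup>2 \<le> 1" and d: "d > 0"
  shows "\<exists>P P' Q Q'. (\<forall>x. (P has_real_derivative P' x) (at x)) \<and> continuous_on UNIV P' \<and>
    (\<forall>x. (Q has_real_derivative Q' x) (at x)) \<and> continuous_on UNIV Q' \<and>
    (\<forall>x. \<bar>x\<bar> > M + 1 \<longrightarrow> P x = 0 \<and> Q x = 0) \<and> (\<forall>x. (P x)\<^sup>2 + (Q x)\<^sup>2 \<le> 1) \<and>
    (\<forall>x\<in>{-M..M}. \<bar>P x - A x\<bar> \<le> d \<and> \<bar>Q x - B x\<bar> \<le> d)"
proof -
  define e where "e = d / 3"
  have e: "e > 0" using d by (simp add: e_def)
  define cl where "cl x = max (-M) (min M x)" for x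
  have cl: "continuous_on UNIV cl" "\<And>x. cl x \<in> {-M..M}" "\<And>x. x \<in> {-M..M} \<Longrightarrow> cl x = x"
    using M by (auto simp: cl_def[abs_def] intro!: continuous_intros)
  let ?T = "{-M-1..M+1}"
  have cont: "continuous_on ?T (\<lambda>x. A (cl x))" "continuous_on ?T (\<lambda>x. B (cl x))"
    using continuous_on_compose2[OF A cl(1)] continuous_on_compose2[OF B cl(1)]
    by (auto intro: continuous_on_subset)
  obtain p where p: "real_polynomial_function p" "\<And>x. x \<in> ?T \<Longrightarrow> \<bar>A (cl x) - p x\<bar> < e"
    using Stone_Weierstrass_real_polynomial_function[OF compact_Icc cont(1) e] by blast
  obtain q where q: "real_polynomial_function q" "\<And>x. x \<in> ?T \<Longrightarrow> \<bar>B (cl x) - q x\<bar> < e"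
    using Stone_Weierstrass_real_polynomial_function[OF compact_Icc cont(2) e] by blast
  obtain p' where p': "real_polynomial_function p'" "\<And>x. (p has_real_derivative p' x) (at x)"
    using has_real_derivative_polynomial_function[OF p(1)] by blast
  obtain q' where q': "real_polynomial_function q'" "\<And>x. (q has_real_derivative q' x) (at x)"
    using has_real_derivative_polynomial_function[OF q(1)] by blast
  obtain \<kappa> \<kappa>' where \<kappa>: "\<And>x. (\<kappa> has_real_derivative \<kappa>' x) (at x)" "continuous_on UNIV \<kappa>'"
      "\<And>x. 0 \<le> \<kappa> x \<and> \<kappa> x \<le> 1" "\<And>x. x \<in> {-M..M} \<Longrightarrow> \<kappa> x = 1"
      "\<And>x. x \<in> {-M..M} \<Longrightarrow> \<kappa>' x = 0" "\<And>x. x < -M - 1 \<or> x > M + 1 \<Longrightarrow> \<kappa> x = 0"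
    using bump_exists[of "-M" M] M by auto
  have cp: "continuous_on X p" "continuous_on X q" "continuous_on X p'" "continuous_on X q'" "continuous_on X \<kappa>" for X
    using p(1) q(1) p'(1) q'(1) \<kappa>(1) DERIV_continuous_on[of X \<kappa> \<kappa>']
    by (auto intro: continuous_real_polymonial_function continuous_at_imp_continuous_on has_field_derivative_at_within)
  let ?c = "1 / (1 + 2 * e)"
  have pq: "(\<kappa> x * p x * ?c)\<^sup>2 + (\<kappa> x * q x * ?c)\<^sup>2 \<le> 1" for x
  proof (cases "x \<in> ?T")
    case True
    have "norm (p x, q x) \<le> norm (A (cl x), B (cl x)) + norm (p x - A (cl x), q x - B (cl x))"
      using norm_triangle_ineq[of "(A (cl x), B (cl x))" "(p x - A (cl x), q x - B (cl x))"] by simp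
    also have "norm (A (cl x), B (cl x)) \<le> 1"
      using unit[OF cl(2)] by (simp add: norm_Pair)
    also have "norm (p x - A (cl x), q x - B (cl x)) \<le> e + e"
      using p(2)[OF True] q(2)[OF True] sqrt_sum_squares_le_sum_abs[of "p x - A (cl x)" "q x - B (cl x)"]
      by (simp add: norm_Pair)
    finally have n: "norm (p x, q x) \<le> 1 + 2 * e" by simp
    have "norm (\<kappa> x * p x * ?c, \<kappa> x * q x * ?c) = norm ((\<kappa> x * ?c) *\<^sub>R (p x, q x))"
      by (simp add: mult_ac)
    also have "\<dots> = (\<kappa> x * ?c) * norm (p x, q x)" unfolding norm_scaleR using \<kappa>(3)[of x] e by simp
    also have "\<dots> \<le> (1 * ?c) * (1 + 2 * e)"
      using \<kappa>(3)[of x] e n by (intro mult_mono mult_right_mono) simp_all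
    also have "\<dots> = 1" using e by simp
    finally show ?thesis unfolding norm_Pair real_norm_def power2_abs by simp
  next
    case False then have "\<kappa> x = 0" by (intro \<kappa>) auto
    then show ?thesis by simp
  qed
  \<comment> \<open>scaling by \<open>1 / (1 + 2 * e)\<close> costs another \<open>2 * e\<close>, and \<open>d = 3 * e\<close>\<close>
  have app: "\<bar>w * ?c - a\<bar> \<le> d" if "\<bar>a - w\<bar> < e" "\<bar>a\<bar> \<le> 1" for a w :: real
  proof -
    have "w * ?c - a = ((w - a) - 2 * e * a) / (1 + 2 * e)" using e by (simp add: field_simps)
    also have "\<bar>\<dots>\<bar> = \<bar>(w - a) - 2 * e * a\<bar> / (1 + 2 * e)"
      using e by (simp add: abs_divide)
    also have "\<dots> \<le> \<bar>(w - a) - 2 * e * a\<bar> / 1"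
      using e by (intro divide_left_mono) auto
    also have "\<dots> \<le> \<bar>w - a\<bar> + 2 * e * \<bar>a\<bar>" using e abs_triangle_ineq4[of "w - a" "2 * e * a"] by (simp add: abs_mult)
    also have "\<dots> \<le> e + 2 * e * 1" using that e by (intro add_mono mult_left_mono) auto
    finally show ?thesis by (simp add: e_def)
  qed
  have ab: "\<bar>A x\<bar> \<le> 1" "\<bar>B x\<bar> \<le> 1" if "x \<in> {-M..M}" for x
    using unit[OF that] by (auto simp: abs_square_le_1[symmetric] intro: order_trans[rotated])
  show ?thesis
  proof (intro exI conjI allI ballI impI)
    show "((\<lambda>x. \<kappa> x * p x * ?c) has_real_derivative (\<kappa>' x * p x + p' x * \<kappa> x) * ?c) (at x)" for x
      by (rule DERIV_cmult_right[OF DERIV_mult[OF \<kappa>(1) p'(2)]])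
    show "continuous_on UNIV (\<lambda>x. (\<kappa>' x * p x + p' x * \<kappa> x) * ?c)"
      by (intro continuous_intros cp \<kappa>(2)) (use e in auto)
    show "((\<lambda>x. \<kappa> x * q x * ?c) has_real_derivative (\<kappa>' x * q x + q' x * \<kappa> x) * ?c) (at x)" for x
      by (rule DERIV_cmult_right[OF DERIV_mult[OF \<kappa>(1) q'(2)]])
    show "continuous_on UNIV (\<lambda>x. (\<kappa>' x * q x + q' x * \<kappa> x) * ?c)"
      by (intro continuous_intros cp \<kappa>(2)) (use e in auto)
    show "\<kappa> x * p x * ?c = 0" "\<kappa> x * q x * ?c = 0" if "\<bar>x\<bar> > M + 1" for x
    proof -
      have "x < - M - 1 \<or> x > M + 1" using that by linarith
      then have "\<kappa> x = 0" by (rule \<kappa>(6))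
      then show "\<kappa> x * p x * ?c = 0" "\<kappa> x * q x * ?c = 0" by simp_all
    qed
    show "(\<kappa> x * p x * ?c)\<^sup>2 + (\<kappa> x * q x * ?c)\<^sup>2 \<le> 1" for x by (rule pq)
    show "\<bar>\<kappa> x * p x * ?c - A x\<bar> \<le> d" "\<bar>\<kappa> x * q x * ?c - B x\<bar> \<le> d" if x: "x \<in> {-M..M}" for x
      using app[OF _ ab(1)[OF x], of "p x"] app[OF _ ab(2)[OF x], of "q x"] p(2)[of x] q(2)[of x] x cl(3)[OF x] \<kappa>(4)[OF x]
      by auto
  qed
qed

text \<open>The calibration bound for continuous fields: only their values on \<open>[-M, M]\<close>, where the strip
  lies, matter.\<close>

theorem calibration_lower_bound:
  assumes \<alpha>: "\<alpha> \<ge> 0" and lr: "l < r" and G: "continuous_on {l..r} G"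
    and GM: "\<And>y. y \<in> {l..r} \<Longrightarrow> 0 \<le> G y \<and> G y \<le> M"
    and A: "\<And>i. continuous_on UNIV (A i)" and B: "\<And>i. continuous_on UNIV (B i)"
    and unit: "\<And>i x. x \<in> {-M..M} \<Longrightarrow> (A i x)\<^sup>2 + (B i x)\<^sup>2 \<le> 1"
    and c: "\<And>i. i < n \<Longrightarrow> l \<le> c i \<and> c i < r" "\<And>i. Suc i < n \<Longrightarrow> c i \<le> c (Suc i)"
  shows "ereal (calib_value \<alpha> G l r n c A B) \<le> grushin_perimeter \<alpha> (strip G l r)"
proof -
  have M: "M \<ge> 0" using GM[of l] lr by force
  define K where "K = 2 * (r - l) + real n * (4 * (r - l) + 4 * M * M powr \<alpha>)"
  have K: "K \<ge> 0" using lr M by (auto simp: K_def intro!: add_nonneg_nonneg mult_nonneg_nonneg)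
  have *: "ereal (calib_value \<alpha> G l r n c A B - d * K) \<le> grushin_perimeter \<alpha> (strip G l r)" if d: "d > 0" for d
  proof -
    have "\<forall>i. \<exists>P P' Q Q'. (\<forall>x. (P has_real_derivative P' x) (at x)) \<and> continuous_on UNIV P' \<and>
    (\<forall>x. (Q has_real_derivative Q' x) (at x)) \<and> continuous_on UNIV Q' \<and>
    (\<forall>x. \<bar>x\<bar> > M + 1 \<longrightarrow> P x = 0 \<and> Q x = 0) \<and> (\<forall>x. (P x)\<^sup>2 + (Q x)\<^sup>2 \<le> 1) \<and>
    (\<forall>x\<in>{-M..M}. \<bar>P x - A i x\<bar> \<le> d \<and> \<bar>Q x - B i x\<bar> \<le> d)"
      by (intro allI C1_unit_approx A B M unit d)
    then obtain P P' Q Q' where PQ: "\<And>i x. (P i has_real_derivative P' i x) (at x)" "\<And>i. continuous_on UNIV (P' i)"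
      "\<And>i x. (Q i has_real_derivative Q' i x) (at x)" "\<And>i. continuous_on UNIV (Q' i)"
      "\<And>i x. \<bar>x\<bar> > M + 1 \<Longrightarrow> P i x = 0" "\<And>i x. \<bar>x\<bar> > M + 1 \<Longrightarrow> Q i x = 0" "\<And>i x. (P i x)\<^sup>2 + (Q i x)\<^sup>2 \<le> 1"
      "\<And>i x. x\<in>{-M..M} \<Longrightarrow> \<bar>P i x - A i x\<bar> \<le> d" "\<And>i x. x\<in>{-M..M} \<Longrightarrow> \<bar>Q i x - B i x\<bar> \<le> d"
      by (metis (no_types))
    have le: "ereal (calib_value \<alpha> G l r n c P Q) \<le> grushin_perimeter \<alpha> (strip G l r)"
      by (rule calibration_C1[where c=c and n=n and A=P and B=Q and G=G and M=M and A'=P' and B'=Q' and N="M + 1", OF \<alpha> lr G GM PQ(1,2,5) PQ(3,4,6,7) c])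
    have cPQ: "continuous_on UNIV (P i)" "continuous_on UNIV (Q i)" for i
      using PQ(1,3) by (meson DERIV_continuous_on has_field_derivative_at_within)+
    have odd: "\<bar>odd_diff (P i) (G y) - odd_diff (A i) (G y)\<bar> \<le> 2 * d" if "y \<in> {l..r}" for i y
      using PQ(8)[of "G y" i] PQ(8)[of "- G y" i] GM[OF that] by (simp add: odd_diff_def)
    have w: "\<bar>wint \<alpha> (Q i) (G y) - wint \<alpha> (B i) (G y)\<bar> \<le> 2 * M * M powr \<alpha> * d" if "y \<in> {l..r}" for i y
      unfolding wint_diff[OF \<alpha> cPQ(2) B, symmetric]
      using GM[OF that] PQ(9) by (intro wint_bound \<alpha> continuous_intros cPQ B) auto
    have contA: "continuous_on {a..r} (\<lambda>y. odd_diff h (G y))" if "l \<le> a" "continuous_on UNIV h" for a h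
    proof -
      have "continuous_on {a..r} G" using that by (intro continuous_on_subset[OF G]) auto
      then show ?thesis unfolding odd_diff_def
        by (intro continuous_intros continuous_on_compose2[OF that(2)]) auto
    qed
    have intdiff: "\<bar>integral {a..r} F - integral {a..r} H\<bar> \<le> b * (r - l)"
      if "l \<le> a" "a \<le> r" "continuous_on {a..r} F" "continuous_on {a..r} H" "\<And>y. y \<in> {a..r} \<Longrightarrow> \<bar>F y - H y\<bar> \<le> b" "b \<ge> 0"
      for F H :: "real \<Rightarrow> real" and a b
    proof -
      have "integral {a..r} F - integral {a..r} H = integral {a..r} (\<lambda>y. F y - H y)"
        using that by (intro integral_diff[symmetric] integrable_continuous_real)
      also have "norm \<dots> \<le> b * (r - a)"
        using that by (intro integral_bound continuous_intros) auto
      also have "\<dots> \<le> b * (r - l)" using that by (intro mult_left_mono) auto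
      finally show ?thesis by simp
    qed
    have t0: "\<bar>integral {l..r} (\<lambda>y. odd_diff (P 0) (G y)) - integral {l..r} (\<lambda>y. odd_diff (A 0) (G y))\<bar> \<le> (2 * d) * (r - l)"
      using lr d by (intro intdiff contA cPQ A odd) auto
    have ti: "\<bar>(integral {c i..r} (\<lambda>y. odd_diff (P (Suc i)) (G y) - odd_diff (P i) (G y)) +
            (wint \<alpha> (Q (Suc i)) (G (c i)) - wint \<alpha> (Q i) (G (c i)))) -
           (integral {c i..r} (\<lambda>y. odd_diff (A (Suc i)) (G y) - odd_diff (A i) (G y)) +
            (wint \<alpha> (B (Suc i)) (G (c i)) - wint \<alpha> (B i) (G (c i))))\<bar> \<le> (4 * d) * (r - l) + 4 * M * M powr \<alpha> * d"
      if i: "i < n" for i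
    proof -
      have "\<bar>integral {c i..r} (\<lambda>y. odd_diff (P (Suc i)) (G y) - odd_diff (P i) (G y)) -
            integral {c i..r} (\<lambda>y. odd_diff (A (Suc i)) (G y) - odd_diff (A i) (G y))\<bar> \<le> (4 * d) * (r - l)"
      proof (rule intdiff)
        show "\<bar>odd_diff (P (Suc i)) (G y) - odd_diff (P i) (G y) - (odd_diff (A (Suc i)) (G y) - odd_diff (A i) (G y))\<bar> \<le> 4 * d"
          if "y \<in> {c i..r}" for y
          using odd[of y i] odd[of y "Suc i"] that c(1)[OF i] by auto
      qed (use c(1)[OF i] d in \<open>auto intro!: continuous_intros contA cPQ A\<close>)
      moreover have "c i \<in> {l..r}" using c(1)[OF i] by auto
      note w[OF this, of i] w[OF this, of "Suc i"]
      ultimately show ?thesis by linarith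
    qed
    have "\<bar>calib_value \<alpha> G l r n c P Q - calib_value \<alpha> G l r n c A B\<bar> \<le>
        (2 * d) * (r - l) + (\<Sum>i<n. (4 * d) * (r - l) + 4 * M * M powr \<alpha> * d)"
    proof -
      let ?X = "\<lambda>A B i. (integral {c i..r} (\<lambda>y. odd_diff (A (Suc i)) (G y) - odd_diff (A i) (G y)) +
            (wint \<alpha> (B (Suc i)) (G (c i)) - wint \<alpha> (B i) (G (c i))))"
      have "\<bar>(\<Sum>i<n. ?X P Q i) - (\<Sum>i<n. ?X A B i)\<bar> \<le> (\<Sum>i<n. (4 * d) * (r - l) + 4 * M * M powr \<alpha> * d)"
        unfolding sum_subtractf[symmetric]
        by (rule order_trans[OF sum_abs]) (rule sum_mono, rule ti, simp)
      then show ?thesis using t0 unfolding calib_value_def by linarith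
    qed
    also have "\<dots> = d * K" by (simp add: K_def algebra_simps)
    finally have "calib_value \<alpha> G l r n c A B - d * K \<le> calib_value \<alpha> G l r n c P Q" by simp
    then show ?thesis using le by (meson ereal_less_eq(3) order_trans)
  qed
  have "eventually (\<lambda>d. ereal (calib_value \<alpha> G l r n c A B - d * K) \<le> grushin_perimeter \<alpha> (strip G l r)) (at_right 0)"
    using * by (intro eventually_at_rightI[of 0 1]) auto
  moreover have "((\<lambda>d. calib_value \<alpha> G l r n c A B - d * K) \<longlongrightarrow> calib_value \<alpha> G l r n c A B - 0 * K) (at_right 0)"
    by (intro tendsto_intros)
  ultimately show ?thesis
    by (intro tendsto_upperbound[of "\<lambda>d. ereal (calib_value \<alpha> G l r n c A B - d * K)" _ "at_right (0::real)"]) auto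
qed

section \<open>The divergence theorem on arc regions\<close>

text \<open>The Grushin divergence of a field, as it occurs in the definition of the perimeter.\<close>

abbreviation grushin_div :: "real \<Rightarrow> (real \<times> real \<Rightarrow> real) \<Rightarrow> (real \<times> real \<Rightarrow> real) \<Rightarrow> real \<times> real \<Rightarrow> real" where
  "grushin_div \<alpha> \<phi>1 \<phi>2 \<equiv> \<lambda>z. partial_x \<phi>1 z + \<bar>fst z\<bar> powr \<alpha> * partial_y \<phi>2 z"

lemma C1_partials:
  assumes "C1_compact_support \<phi>"
  shows "continuous_on UNIV \<phi>" "continuous_on UNIV (partial_x \<phi>)" "continuous_on UNIV (partial_y \<phi>)"
    and "\<And>x y. ((\<lambda>s. \<phi> (s, y)) has_real_derivative partial_x \<phi> (x, y)) (at x)"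
    and "\<And>x y. ((\<lambda>s. \<phi> (x, s)) has_real_derivative partial_y \<phi> (x, y)) (at y)"
proof -
  obtain D where D: "continuous_on UNIV D" "\<And>z. (\<phi> has_derivative blinfun_apply (D z)) (at z)"
    using assms unfolding C1_compact_support_def by auto
  have dx: "((\<lambda>s. \<phi> (s, y)) has_real_derivative D (x, y) (1, 0)) (at x)" for x y
  proof -
    have "((\<lambda>s. (s, y)) has_derivative (\<lambda>h. (h, 0))) (at x)" by (auto intro!: derivative_eq_intros)
    from has_derivative_compose[OF this D(2)]
    have "((\<lambda>s. \<phi> (s, y)) has_derivative (\<lambda>h. D (x, y) (h, 0))) (at x)" .
    moreover have "(\<lambda>h. D (x, y) (h, 0)) = (*) (D (x, y) (1, 0))"
    proof (rule ext)
      fix h :: real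
      have "D (x, y) (h *\<^sub>R (1, 0)) = h *\<^sub>R D (x, y) (1, 0)" by (rule blinfun.scaleR_right)
      moreover have "h *\<^sub>R (1, 0) = (h, 0)" by simp
      ultimately show "D (x, y) (h, 0) = D (x, y) (1, 0) * h" by (metis real_scaleR_def mult.commute)
    qed
    ultimately show ?thesis unfolding has_field_derivative_def by (simp only:)
  qed
  have dy: "((\<lambda>s. \<phi> (x, s)) has_real_derivative D (x, y) (0, 1)) (at y)" for x y
  proof -
    have "((\<lambda>s. (x, s)) has_derivative (\<lambda>h. (0, h))) (at y)" by (auto intro!: derivative_eq_intros)
    from has_derivative_compose[OF this D(2)]
    have "((\<lambda>s. \<phi> (x, s)) has_derivative (\<lambda>h. D (x, y) (0, h))) (at y)" .
    moreover have "(\<lambda>h. D (x, y) (0, h)) = (*) (D (x, y) (0, 1))"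
    proof (rule ext)
      fix h :: real
      have "D (x, y) (h *\<^sub>R (0, 1)) = h *\<^sub>R D (x, y) (0, 1)" by (rule blinfun.scaleR_right)
      moreover have "h *\<^sub>R (0, 1) = (0, h)" by simp
      ultimately show "D (x, y) (0, h) = D (x, y) (0, 1) * h" by (metis real_scaleR_def mult.commute)
    qed
    ultimately show ?thesis unfolding has_field_derivative_def by (simp only:)
  qed
  have px: "partial_x \<phi> = (\<lambda>z. D z (1, 0))" and py: "partial_y \<phi> = (\<lambda>z. D z (0, 1))"
    using dx dy by (auto simp: partial_x_def partial_y_def DERIV_imp_deriv)
  show "continuous_on UNIV (partial_x \<phi>)" "continuous_on UNIV (partial_y \<phi>)"
    unfolding px py by (intro continuous_intros D)+
  show "continuous_on UNIV \<phi>"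
    using D(2) by (intro continuous_at_imp_continuous_on) (auto intro: has_derivative_continuous)
  show "((\<lambda>s. \<phi> (s, y)) has_real_derivative partial_x \<phi> (x, y)) (at x)"
    "((\<lambda>s. \<phi> (x, s)) has_real_derivative partial_y \<phi> (x, y)) (at y)" for x y
    using dx dy by (auto simp: px py)
qed

text \<open>A continuous version of \<open>\<bar>x\<bar> powr \<alpha>\<close>: they differ only at \<open>x = 0\<close> and for \<open>\<alpha> = 0\<close>.\<close>

definition weight :: "real \<Rightarrow> real \<Rightarrow> real" where
  "weight \<alpha> x = (if \<alpha> = 0 then 1 else \<bar>x\<bar> powr \<alpha>)"

lemma weight_eq: "x \<noteq> 0 \<Longrightarrow> weight \<alpha> x = \<bar>x\<bar> powr \<alpha>"
  by (simp add: weight_def)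

lemma weight_nonneg: "weight \<alpha> x \<ge> 0" by (simp add: weight_def)

lemma weight_minus: "weight \<alpha> (- x) = weight \<alpha> x" by (simp add: weight_def)

lemma continuous_weight:
  assumes "\<alpha> \<ge> 0" shows "continuous_on S (weight \<alpha>)"
proof (cases "\<alpha> = 0")
  case True then show ?thesis by (simp add: weight_def[abs_def])
next
  case False
  then have "continuous_on S (\<lambda>x. \<bar>x\<bar> powr \<alpha>)"
    using assms by (intro continuous_on_powr' continuous_intros) auto
  then show ?thesis using False by (simp add: weight_def[abs_def])
qed

lemma wint_weight: "wint \<alpha> B s = integral {-s..s} (\<lambda>x. weight \<alpha> x * B x)"
  unfolding wint_def by (rule integral_spike[of "{0}"]) (auto simp: weight_eq)

lemma wint_scaled:
  assumes "s \<ge> 0"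
  shows "wint \<alpha> B s = s * integral {-1..1} (\<lambda>z. weight \<alpha> (s * z) * B (s * z))"
proof (cases "s = 0")
  case True then show ?thesis by (simp add: wint_weight)
next
  case False
  then have s: "s > 0" using assms by simp
  have im: "(\<lambda>x. x / s) ` {-s..s} = {-1..1}"
    using image_divide_atLeastAtMost[of s "-s" s] s by simp
  show ?thesis
    using integral_stretch_real[of s "-s" s "\<lambda>x. weight \<alpha> x * B x"] s unfolding im
    by (simp add: wint_weight)
qed

text \<open>The weighted flux of \<open>\<phi>\<close> through the section \<open>[-s, s]\<close> at height \<open>y\<close>.\<close>

definition flux :: "real \<Rightarrow> (real \<times> real \<Rightarrow> real) \<Rightarrow> real \<Rightarrow> real \<Rightarrow> real" where
  "flux \<alpha> \<phi> s y = wint \<alpha> (\<lambda>x. \<phi> (x, y)) s"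

lemma continuous_flux:
  assumes "\<alpha> \<ge> 0" "continuous_on UNIV \<psi>"
  shows "continuous_on ({0..} \<times> UNIV) (\<lambda>(s, y). flux \<alpha> \<psi> s y)"
proof -
  have "continuous_on (({0..} \<times> UNIV) \<times> cbox (-1) (1::real))
     (\<lambda>(u, z). weight \<alpha> (fst u * z) * \<psi> (fst u * z, snd u :: real))"
    unfolding split_def
    by (intro continuous_intros continuous_on_compose2[OF continuous_weight[OF assms(1), of UNIV]]
         continuous_on_compose2[OF assms(2)]) auto
  from integral_continuous_on_param[OF this]
  have "continuous_on ({0..} \<times> UNIV) (\<lambda>u. fst u * integral {-1..1} (\<lambda>z. weight \<alpha> (fst u * z) * \<psi> (fst u * z, snd u)))"
    by (intro continuous_intros) (simp_all add: cbox_interval)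
  then show ?thesis
    by (rule continuous_on_eq) (auto simp: flux_def wint_scaled)
qed

lemma flux_deriv_y:
  assumes \<alpha>: "\<alpha> \<ge> 0" and C: "C1_compact_support \<phi>"
  shows "((\<lambda>y. flux \<alpha> \<phi> s y) has_real_derivative flux \<alpha> (partial_y \<phi>) s y) (at y)"
proof -
  note [continuous_intros] = continuous_on_compose2[OF C1_partials(1)[OF C]]
    continuous_on_compose2[OF C1_partials(3)[OF C]] continuous_on_compose2[OF continuous_weight[OF \<alpha>, of UNIV]]
  have "((\<lambda>y. integral (cbox (-s) s) (\<lambda>x. weight \<alpha> x * \<phi> (x, y))) has_field_derivative
     integral (cbox (-s) s) (\<lambda>x. weight \<alpha> x * partial_y \<phi> (x, y))) (at y within UNIV)"
  proof (rule leibniz_rule_field_derivative)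
    show "((\<lambda>y. weight \<alpha> x * \<phi> (x, y)) has_real_derivative weight \<alpha> x * partial_y \<phi> (x, y)) (at y within UNIV)" for x y
      by (intro DERIV_cmult C1_partials(5) C)
    show "(\<lambda>x. weight \<alpha> x * \<phi> (x, y)) integrable_on cbox (-s) s" for y
      by (intro integrable_continuous continuous_intros) auto
    show "continuous_on (UNIV \<times> cbox (-s) s) (\<lambda>(y, x). weight \<alpha> x * partial_y \<phi> (x, y))"
      unfolding split_def by (intro continuous_intros) auto
  qed auto
  then show ?thesis by (simp add: flux_def[abs_def] wint_weight cbox_interval)
qed

lemma flux_deriv_s:
  assumes \<alpha>: "\<alpha> \<ge> 0" and c: "continuous_on UNIV \<phi>" and s: "s > 0"
  shows "((\<lambda>s. flux \<alpha> \<phi> s y) has_real_derivative weight \<alpha> s * (\<phi> (s, y) + \<phi> (- s, y))) (at s)"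
proof -
  note [continuous_intros] = continuous_on_compose2[OF c] continuous_on_compose2[OF continuous_weight[OF \<alpha>, of UNIV]]
  let ?M = "s + 1"
  let ?f = "\<lambda>x. weight \<alpha> x * \<phi> (x, y)"
  let ?J = "\<lambda>u. integral {-?M..u} ?f"
  have cf: "continuous_on {-?M..?M} ?f" by (intro continuous_intros) auto
  have J: "(?J has_real_derivative ?f t) (at t)" if "t \<in> {-?M<..<?M}" for t
    using integral_has_real_derivative[OF cf, of t] that at_within_interior[of t "{-?M..?M}"] by auto
  have J2: "((\<lambda>u. ?J (-u)) has_real_derivative - ?f (- s)) (at s)"
  proof -
    have "((\<lambda>u. - u) has_real_derivative -1) (at s)" by (auto intro!: derivative_eq_intros)
    moreover have "(?J has_real_derivative ?f (- s)) (at (- s))" using s by (intro J) auto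
    ultimately have "((\<lambda>u. ?J (- u)) has_real_derivative ?f (- s) * -1) (at s)" by (rule DERIV_chain2[rotated])
    then show ?thesis by simp
  qed
  have "((\<lambda>u. ?J u - ?J (-u)) has_real_derivative ?f s - (- ?f (- s))) (at s)"
    using s by (intro DERIV_diff J J2) auto
  moreover have "eventually (\<lambda>u. ?J u - ?J (-u) = flux \<alpha> \<phi> u y) (nhds s)"
  proof -
    have "eventually (\<lambda>u. u \<in> {0<..<?M}) (nhds s)" using s by (intro eventually_nhds_in_open) auto
    then show ?thesis
    proof eventually_elim
      case (elim u)
      have "?f integrable_on {-?M..u}"
        using elim by (intro integrable_continuous_real continuous_on_subset[OF cf]) auto
      then show ?case
        using Henstock_Kurzweil_Integration.integral_combine[where a="-?M" and c="-u" and b=u and f="?f"] elim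
        by (simp add: flux_def wint_weight)
    qed
  qed
  ultimately show ?thesis
    using weight_minus[of \<alpha> s] by (subst DERIV_cong_ev[OF refl _ refl, symmetric]) (auto simp: algebra_simps)
qed

text \<open>Along a curve \<open>(X t, Y t)\<close> the flux through \<open>[-X t, X t]\<close> changes by the boundary values of
  \<open>\<phi>\<close> and by the divergence of \<open>\<phi>\<close> in the section. This is the divergence theorem in
  infinitesimal form.\<close>

lemma flux_deriv_curve:
  assumes \<alpha>: "\<alpha> \<ge> 0" and C: "C1_compact_support \<phi>"
    and X: "(X has_real_derivative X') (at t)" and Y: "(Y has_real_derivative Y') (at t)" and pos: "X t > 0"
  shows "((\<lambda>t. flux \<alpha> \<phi> (X t) (Y t)) has_real_derivative
     weight \<alpha> (X t) * (\<phi> (X t, Y t) + \<phi> (- X t, Y t)) * X' + flux \<alpha> (partial_y \<phi>) (X t) (Y t) * Y') (at t)"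
proof -
  let ?Q = "{0<..} :: real set"
  have "((\<lambda>(s, y). flux \<alpha> \<phi> s y) has_derivative
     (\<lambda>(ds, dy). (weight \<alpha> (X t) * (\<phi> (X t, Y t) + \<phi> (- X t, Y t))) * ds +
        blinfun_apply (blinfun_mult_right (flux \<alpha> (partial_y \<phi>) (X t) (Y t))) dy)) (at (X t, Y t) within ?Q \<times> UNIV)"
  proof (rule has_derivative_partialsI)
    show "((\<lambda>s. flux \<alpha> \<phi> s (Y t)) has_derivative (\<lambda>ds. weight \<alpha> (X t) * (\<phi> (X t, Y t) + \<phi> (- X t, Y t)) * ds)) (at (X t) within ?Q)"
      using flux_deriv_s[OF \<alpha> C1_partials(1)[OF C] pos, of "Y t"]
      by (auto simp: has_field_derivative_def intro: has_derivative_at_withinI)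
    show "((\<lambda>y. flux \<alpha> \<phi> s y) has_derivative blinfun_apply (blinfun_mult_right (flux \<alpha> (partial_y \<phi>) s y))) (at y within UNIV)" for s y
      using flux_deriv_y[OF \<alpha> C, of s y] by (simp add: has_field_derivative_def)
    have "continuous_on (?Q \<times> UNIV) (\<lambda>z. blinfun_mult_right (case z of (s, y) \<Rightarrow> flux \<alpha> (partial_y \<phi>) s y))"
      by (intro continuous_intros continuous_on_subset[OF continuous_flux[OF \<alpha> C1_partials(3)[OF C]]]) auto
    then show "continuous (at (X t, Y t) within ?Q \<times> UNIV) (\<lambda>(s, y). blinfun_mult_right (flux \<alpha> (partial_y \<phi>) s y))"
      using pos by (auto simp: continuous_on_eq_continuous_within split_def)
  qed auto
  moreover have "at (X t, Y t) within ?Q \<times> UNIV = at (X t, Y t)"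
    using pos by (intro at_within_open) (auto intro: open_Times)
  ultimately have D: "((\<lambda>(s, y). flux \<alpha> \<phi> s y) has_derivative
     (\<lambda>(ds, dy). (weight \<alpha> (X t) * (\<phi> (X t, Y t) + \<phi> (- X t, Y t))) * ds +
        flux \<alpha> (partial_y \<phi>) (X t) (Y t) * dy)) (at (X t, Y t))" by simp
  have "((\<lambda>t. (X t, Y t)) has_derivative (\<lambda>h. (X' * h, Y' * h))) (at t)"
    using X Y by (auto simp: has_field_derivative_def intro!: has_derivative_Pair)
  from has_derivative_compose[OF this D] show ?thesis
    unfolding has_field_derivative_def split_conv
    by (rule has_derivative_eq_rhs) (auto simp: algebra_simps fun_eq_iff)
qed

lemma flux_bound:
  assumes \<alpha>: "\<alpha> \<ge> 0" and c: "continuous_on UNIV \<phi>" and b: "\<And>z. \<bar>\<phi> z\<bar> \<le> 1" and s: "s \<ge> 0"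
  shows "\<bar>flux \<alpha> \<phi> s y\<bar> \<le> wint \<alpha> (\<lambda>_. 1) s"
proof -
  have "norm (flux \<alpha> \<phi> s y) \<le> wint \<alpha> (\<lambda>_. 1) s"
    unfolding flux_def wint_def
  proof (rule integral_norm_bound_integral)
    show "(\<lambda>x. \<bar>x\<bar> powr \<alpha> * \<phi> (x, y)) integrable_on {-s..s}"
      by (intro weight_integrable \<alpha> continuous_on_compose2[OF c] continuous_intros) auto
    show "(\<lambda>x. \<bar>x\<bar> powr \<alpha> * 1) integrable_on {-s..s}"
      by (intro weight_integrable \<alpha> continuous_intros)
    show "norm (\<bar>x\<bar> powr \<alpha> * \<phi> (x, y)) \<le> \<bar>x\<bar> powr \<alpha> * 1" for x
      using b[of "(x, y)"] by (auto simp: abs_mult mult_left_le)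
  qed
  then show ?thesis by simp
qed

text \<open>The height reached by the boundary curve of the isoperimetric set at the parameter \<open>t\<close>, measured
  from its lowest point. The curve is \<open>x = sin t\<close>, with \<open>t\<close> from \<open>0\<close> to \<open>pi\<close>.\<close>

definition sine_int :: "real \<Rightarrow> real \<Rightarrow> real" where
  "sine_int \<alpha> t = integral {0..t} (\<lambda>s. sin s powr (\<alpha> + 1))"

lemma sine_powr_continuous: "p > 0 \<Longrightarrow> continuous_on {0..pi} (\<lambda>s. sin s powr p)"
  by (intro continuous_on_powr' continuous_intros) (auto simp: sin_ge_zero)

lemma sine_int_deriv:
  assumes "\<alpha> \<ge> 0" "t \<in> {0..pi}"
  shows "(sine_int \<alpha> has_real_derivative sin t powr (\<alpha> + 1)) (at t within {0..pi})"
  unfolding sine_int_def[abs_def]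
  using assms by (intro integral_has_real_derivative sine_powr_continuous) auto

lemma sine_int_strict_mono:
  assumes "\<alpha> \<ge> 0" "0 \<le> s" "s < t" "t \<le> pi"
  shows "sine_int \<alpha> s < sine_int \<alpha> t"
proof (rule DERIV_pos_imp_increasing_open[OF assms(3)])
  show "\<exists>y. (sine_int \<alpha> has_real_derivative y) (at x) \<and> 0 < y" if "s < x" "x < t" for x
    using sine_int_deriv[of \<alpha> x] at_within_interior[of x "{0..pi}"] assms that sin_gt_zero[of x]
    by (intro exI[of _ "sin x powr (\<alpha> + 1)"]) auto
  have "continuous_on {0..pi} (sine_int \<alpha>)" using sine_int_deriv assms(1) by (intro DERIV_continuous_on)
  then show "continuous_on {s..t} (sine_int \<alpha>)" using assms by (auto intro: continuous_on_subset)
qed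

text \<open>The divergence theorem on the region between the curve \<open>(X, Y)\<close>, a dilated arc of the
  isoperimetric profile, and its mirror image. Along the curve the integrand is at most the length
  element \<open>sin t powr \<alpha>\<close> (up to the dilation) for each of the two sides. The fluxes through the
  bottom and the top are kept, because they cancel when two regions are stacked.\<close>

theorem arc_divergence_bound:
  fixes \<alpha> h \<kappa> a b :: real and G :: "real \<Rightarrow> real"
  defines "X \<equiv> \<lambda>t. sin t / h" and "Y \<equiv> \<lambda>t. (sine_int \<alpha> t - \<kappa>) / h powr (\<alpha> + 1)"
  assumes \<alpha>: "\<alpha> \<ge> 0" and h: "h > 0" and ab: "0 \<le> a" "a < b" "b \<le> pi"
    and G: "continuous_on {Y a..Y b} G" "\<And>t. t \<in> {a..b} \<Longrightarrow> G (Y t) = X t"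
    and C: "C1_compact_support \<phi>1" "C1_compact_support \<phi>2" and unit: "\<And>z. sqrt ((\<phi>1 z)\<^sup>2 + (\<phi>2 z)\<^sup>2) \<le> 1"
  shows "set_integrable lebesgue (strip G (Y a) (Y b)) (grushin_div \<alpha> \<phi>1 \<phi>2)"
    and "(LINT z:strip G (Y a) (Y b)|lebesgue. grushin_div \<alpha> \<phi>1 \<phi>2 z)
      \<le> 2 / h powr (\<alpha> + 1) * integral {a..b} (\<lambda>t. sin t powr \<alpha>) + flux \<alpha> \<phi>2 (X b) (Y b) - flux \<alpha> \<phi>2 (X a) (Y a)"
proof -
  let ?H = "h powr (\<alpha> + 1)"
  let ?f = "\<lambda>z. partial_x \<phi>1 z + \<bar>fst z\<bar> powr \<alpha> * partial_y \<phi>2 z"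
  have H: "?H > 0" using h by simp
  have sub: "{a..b} \<subseteq> {0..pi}" using ab by auto
  have dY: "(Y has_real_derivative sin t powr (\<alpha> + 1) / ?H) (at t within {a..b})" if "t \<in> {a..b}" for t
  proof -
    have "(sine_int \<alpha> has_real_derivative sin t powr (\<alpha> + 1)) (at t within {a..b})"
      using that sub by (intro DERIV_subset[OF sine_int_deriv[OF \<alpha>]]) auto
    from DERIV_cdivide[OF DERIV_diff[OF this DERIV_const], of \<kappa> ?H] show ?thesis
      by (simp add: Y_def)
  qed
  have dX: "(X has_real_derivative cos t / h) (at t within T)" for t T
    unfolding X_def by (intro DERIV_cdivide has_field_derivative_at_within[OF DERIV_sin])
  have Ymono: "Y s \<le> Y t" if "s \<in> {a..b}" "t \<in> {a..b}" "s \<le> t" for s t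
    using sine_int_strict_mono[OF \<alpha>, of s t] that ab H
    by (cases "s = t") (auto simp: Y_def divide_right_mono)
  have X0: "X t \<ge> 0" if "t \<in> {a..b}" for t
    using sin_ge_zero[of t] h that ab by (simp add: X_def)
  have cX: "continuous_on {a..b} X" using dX by (intro DERIV_continuous_on)
  have cY: "continuous_on {a..b} Y" using dY by (rule DERIV_continuous_on)
  have surj: "\<exists>t\<in>{a..b}. y = Y t" if "y \<in> {Y a..Y b}" for y
    using IVT'[of Y a y b] that ab cY by auto
  have GX: "0 \<le> G y" "G y \<le> 1 / h" if y: "y \<in> {Y a..Y b}" for y
  proof -
    from surj[OF y] obtain t where "t \<in> {a..b}" "y = Y t" by auto
    then show "0 \<le> G y" "G y \<le> 1 / h" using G(2) X0 h by (auto simp: X_def divide_right_mono)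
  qed
  note c1 = C1_partials[OF C(1)] and c2 = C1_partials[OF C(2)]
  have cpt: "compact ((\<lambda>z. \<bar>partial_x \<phi>1 z\<bar> + \<bar>1 / h\<bar> powr \<alpha> * \<bar>partial_y \<phi>2 z\<bar>) ` cbox (-(1/h), Y a) (1/h, Y b))"
    by (intro compact_continuous_image continuous_intros continuous_on_subset[OF c1(2)] continuous_on_subset[OF c2(3)]) auto
  obtain K where K: "\<And>z. z \<in> cbox (-(1/h), Y a) (1/h, Y b) \<Longrightarrow> \<bar>\<bar>partial_x \<phi>1 z\<bar> + \<bar>1 / h\<bar> powr \<alpha> * \<bar>partial_y \<phi>2 z\<bar>\<bar> \<le> K"
    using compact_imp_bounded[OF cpt] unfolding bounded_iff by auto
  have fb: "\<bar>?f z\<bar> \<le> K" if z: "z \<in> strip G (Y a) (Y b)" for z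
  proof -
    have zb: "z \<in> cbox (-(1/h), Y a) (1/h, Y b)"
      using subsetD[OF strip_subset_cbox z] GX by auto
    then have "\<bar>fst z\<bar> \<le> \<bar>1 / h\<bar>" using h by (cases z) (auto simp: cbox_Pair_eq abs_le_iff)
    then have "\<bar>\<bar>fst z\<bar> powr \<alpha> * partial_y \<phi>2 z\<bar> \<le> \<bar>1 / h\<bar> powr \<alpha> * \<bar>partial_y \<phi>2 z\<bar>"
      using \<alpha> unfolding abs_mult by (intro mult_mono) (auto intro: powr_mono2)
    then show ?thesis using K[OF zb] by linarith
  qed
  have [measurable]: "(\<lambda>z::real \<times> real. \<bar>fst z\<bar>) \<in> borel_measurable borel"
    "partial_x \<phi>1 \<in> borel_measurable borel" "partial_y \<phi>2 \<in> borel_measurable borel"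
    by (intro borel_measurable_continuous_onI continuous_intros c1(2) c2(3))+
  have fm: "?f \<in> borel_measurable borel" by measurable
  note SI = strip_integral[OF G(1) fm fb]
  show "set_integrable lebesgue (strip G (Y a) (Y b)) ?f" by (rule SI(1))
  define R where "R y = \<phi>1 (G y, y) - \<phi>1 (- G y, y) + flux \<alpha> (partial_y \<phi>2) (G y) y" for y
  have inner: "integral {- G y..G y} (\<lambda>x. ?f (x, y)) = R y" if y: "y \<in> {Y a..Y b}" for y
  proof (rule integral_unique)
    have "((\<lambda>x. partial_x \<phi>1 (x, y)) has_integral \<phi>1 (G y, y) - \<phi>1 (- G y, y)) {- G y..G y}"
      using GX[OF y] c1(4)
      by (intro fundamental_theorem_of_calculus)
         (auto simp: has_real_derivative_iff_has_vector_derivative[symmetric] intro: has_field_derivative_at_within)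
    moreover have "((\<lambda>x. \<bar>x\<bar> powr \<alpha> * partial_y \<phi>2 (x, y)) has_integral flux \<alpha> (partial_y \<phi>2) (G y) y) {- G y..G y}"
      unfolding flux_def wint_def
      by (intro integrable_integral weight_integrable \<alpha> continuous_on_compose2[OF c2(3)] continuous_intros) auto
    ultimately show "((\<lambda>x. ?f (x, y)) has_integral R y) {- G y..G y}"
      unfolding R_def by (simp add: has_integral_add)
  qed
  have cflux: "continuous_on S (\<lambda>t. flux \<alpha> \<psi> (u t) (w t))"
    if "continuous_on UNIV \<psi>" "continuous_on S u" "continuous_on S w" "\<And>t. t \<in> S \<Longrightarrow> u t \<ge> 0"
    for \<psi> and u w :: "real \<Rightarrow> real" and S
    using continuous_on_compose2[OF continuous_flux[OF \<alpha> that(1)], of S "\<lambda>t. (u t, w t)"] that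
    by (auto intro!: continuous_intros)
  have cR: "continuous_on {Y a..Y b} R"
    unfolding R_def
    by (intro continuous_intros cflux continuous_on_compose2[OF c1(1)] c2(3) G(1) GX) auto
  have "((\<lambda>t. (sin t powr (\<alpha> + 1) / ?H) *\<^sub>R R (Y t)) has_integral integral {Y a..Y b} R) {a..b}"
    using Ymono ab by (intro has_integral_substitution[OF _ _ _ cR dY]) auto
  then have sub1: "((\<lambda>t. sin t powr (\<alpha> + 1) / ?H * (\<phi>1 (X t, Y t) - \<phi>1 (- X t, Y t) + flux \<alpha> (partial_y \<phi>2) (X t) (Y t)))
      has_integral integral {Y a..Y b} R) {a..b}"
    by (rule has_integral_eq[rotated]) (simp add: R_def G(2))
  have K: "((\<lambda>t. weight \<alpha> (X t) * (\<phi>2 (X t, Y t) + \<phi>2 (- X t, Y t)) * (cos t / h)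
        + flux \<alpha> (partial_y \<phi>2) (X t) (Y t) * (sin t powr (\<alpha> + 1) / ?H)) has_integral
     flux \<alpha> \<phi>2 (X b) (Y b) - flux \<alpha> \<phi>2 (X a) (Y a)) {a..b}"
  proof (rule fundamental_theorem_of_calculus_interior)
    show "continuous_on {a..b} (\<lambda>t. flux \<alpha> \<phi>2 (X t) (Y t))"
      by (intro cflux c2(1) cX cY X0)
    show "((\<lambda>t. flux \<alpha> \<phi>2 (X t) (Y t)) has_vector_derivative weight \<alpha> (X t) * (\<phi>2 (X t, Y t) + \<phi>2 (- X t, Y t)) * (cos t / h)
        + flux \<alpha> (partial_y \<phi>2) (X t) (Y t) * (sin t powr (\<alpha> + 1) / ?H)) (at t)" if t: "t \<in> {a<..<b}" for t
      unfolding has_real_derivative_iff_has_vector_derivative[symmetric]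
    proof (rule flux_deriv_curve[OF \<alpha> C(2) dX])
      show "(Y has_real_derivative sin t powr (\<alpha> + 1) / ?H) (at t)"
        using dY[of t] t at_within_interior[of t "{a..b}"] by auto
      show "X t > 0" using t ab h sin_gt_zero[of t] by (auto simp: X_def)
    qed
  qed (use ab in auto)
  \<comment> \<open>the flux terms are eliminated between \<open>sub1\<close> and \<open>K\<close>; what remains lives on the curve\<close>
  let ?g = "\<lambda>t. sin t powr (\<alpha> + 1) / ?H * (\<phi>1 (X t, Y t) - \<phi>1 (- X t, Y t)) - weight \<alpha> (X t) * (\<phi>2 (X t, Y t) + \<phi>2 (- X t, Y t)) * (cos t / h)"
  have g: "(?g has_integral integral {Y a..Y b} R - (flux \<alpha> \<phi>2 (X b) (Y b) - flux \<alpha> \<phi>2 (X a) (Y a))) {a..b}"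
    by (rule has_integral_eq[OF _ has_integral_diff[OF sub1 K]]) (simp add: algebra_simps)
  have lim_int: "(\<lambda>t. 2 / ?H * weight \<alpha> (sin t)) integrable_on {a..b}"
    by (intro integrable_continuous_real continuous_intros continuous_on_compose2[OF continuous_weight[OF \<alpha>, of UNIV]]) auto
  have gb: "?g t \<le> 2 / ?H * weight \<alpha> (sin t)" if t: "t \<in> {a<..<b}" for t
  proof -
    have s: "sin t > 0" using t ab by (intro sin_gt_zero) auto
    have w: "weight \<alpha> (X t) * (cos t / h) = weight \<alpha> (sin t) / ?H * cos t"
      using s h by (simp add: weight_eq X_def powr_divide powr_add field_simps)
    have v: "sin t powr (\<alpha> + 1) / ?H = weight \<alpha> (sin t) / ?H * sin t"
      using s by (simp add: weight_eq powr_add)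
    \<comment> \<open>the inequality of Cauchy and Schwarz with the unit normal \<open>(sin t, - cos t)\<close>\<close>
    have cs: "p * sin t - q * cos t \<le> 1" "- p * sin t - q * cos t \<le> 1" if "sqrt (p\<^sup>2 + q\<^sup>2) \<le> 1" for p q
    proof -
      have 1: "p\<^sup>2 + q\<^sup>2 \<le> 1" using that by (simp add: real_sqrt_le_1_iff)
      have 2: "(sin t)\<^sup>2 + (cos t)\<^sup>2 = 1" by simp
      have "0 \<le> (p - sin t)\<^sup>2 + (q + cos t)\<^sup>2" "0 \<le> (p + sin t)\<^sup>2 + (q + cos t)\<^sup>2" by auto
      then show "p * sin t - q * cos t \<le> 1" "- p * sin t - q * cos t \<le> 1"
        using 1 2 unfolding power2_sum power2_diff by linarith+
    qed
    have "?g t = weight \<alpha> (sin t) / ?H * ((\<phi>1 (X t, Y t) * sin t - \<phi>2 (X t, Y t) * cos t) + (- \<phi>1 (- X t, Y t) * sin t - \<phi>2 (- X t, Y t) * cos t))"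
    proof -
      have e: "weight \<alpha> (X t) * (\<phi>2 (X t, Y t) + \<phi>2 (- X t, Y t)) * (cos t / h) = (weight \<alpha> (X t) * (cos t / h)) * (\<phi>2 (X t, Y t) + \<phi>2 (- X t, Y t))"
        by (simp only: mult_ac)
      show ?thesis unfolding v e w by (simp add: algebra_simps)
    qed
    also have "\<dots> \<le> weight \<alpha> (sin t) / ?H * (1 + 1)"
      using H by (intro mult_left_mono add_mono cs unit divide_nonneg_nonneg weight_nonneg) auto
    also have "\<dots> = 2 / ?H * weight \<alpha> (sin t)" by simp
    finally show ?thesis .
  qed
  have g': "(?g has_integral integral {Y a..Y b} R - (flux \<alpha> \<phi>2 (X b) (Y b) - flux \<alpha> \<phi>2 (X a) (Y a))) {a<..<b}"
    using g by (simp add: has_integral_Icc_iff_Ioo)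
  have l': "((\<lambda>t. 2 / ?H * weight \<alpha> (sin t)) has_integral integral {a..b} (\<lambda>t. 2 / ?H * weight \<alpha> (sin t))) {a<..<b}"
    using integrable_integral[OF lim_int] by (simp add: has_integral_Icc_iff_Ioo)
  have "integral {Y a..Y b} R - (flux \<alpha> \<phi>2 (X b) (Y b) - flux \<alpha> \<phi>2 (X a) (Y a)) \<le> integral {a..b} (\<lambda>t. 2 / ?H * weight \<alpha> (sin t))"
    by (rule has_integral_le[OF g' l' gb])
  also have "\<dots> = 2 / ?H * integral {a..b} (\<lambda>t. weight \<alpha> (sin t))" by simp
  also have "integral {a..b} (\<lambda>t. weight \<alpha> (sin t)) = integral {a..b} (\<lambda>t. sin t powr \<alpha>)"
  proof (rule integral_spike[of "{0, pi}"])
    show "sin t powr \<alpha> = weight \<alpha> (sin t)" if "t \<in> {a..b} - {0, pi}" for t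
      using that ab sin_gt_zero[of t] by (auto simp: weight_eq)
  qed auto
  finally have fin: "integral {Y a..Y b} R \<le> 2 / ?H * integral {a..b} (\<lambda>t. sin t powr \<alpha>) + flux \<alpha> \<phi>2 (X b) (Y b) - flux \<alpha> \<phi>2 (X a) (Y a)"
    by simp
  have "(LINT z:strip G (Y a) (Y b)|lebesgue. ?f z) = integral {Y a..Y b} (\<lambda>y. integral {- G y..G y} (\<lambda>x. ?f (x, y)))"
    by (rule SI(2))
  also have "\<dots> = integral {Y a..Y b} R" by (rule integral_cong) (rule inner)
  finally show "(LINT z:strip G (Y a) (Y b)|lebesgue. ?f z)
      \<le> 2 / ?H * integral {a..b} (\<lambda>t. sin t powr \<alpha>) + flux \<alpha> \<phi>2 (X b) (Y b) - flux \<alpha> \<phi>2 (X a) (Y a)"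
    using fin by simp
qed

section \<open>The isoperimetric profile and its angle\<close>

lemma sine_int_continuous: "\<alpha> \<ge> 0 \<Longrightarrow> continuous_on {0..pi} (sine_int \<alpha>)"
  using sine_int_deriv by (rule DERIV_continuous_on)

lemma sine_int_reflect:
  assumes "\<alpha> \<ge> 0" "t \<in> {0..pi}"
  shows "sine_int \<alpha> (pi - t) + sine_int \<alpha> t = 2 * sine_int \<alpha> (pi / 2)"
proof -
  have "\<exists>c. \<forall>t\<in>{0..pi}. sine_int \<alpha> (pi - t) + sine_int \<alpha> t = c"
  proof (rule has_field_derivative_zero_constant)
    fix t assume t: "t \<in> {0..pi}"
    have "((sine_int \<alpha>) has_real_derivative sin (pi - t) powr (\<alpha> + 1)) (at (pi - t) within {0..pi})"
      using t by (intro sine_int_deriv assms) auto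
    then have "((sine_int \<alpha>) has_real_derivative sin t powr (\<alpha> + 1)) (at (pi - t) within (\<lambda>t. pi - t) ` {0..pi})"
      by simp
    moreover have "((\<lambda>t. pi - t) has_real_derivative -1) (at t within {0..pi})" by (rule DERIV_const_minus)
    ultimately have "((sine_int \<alpha> \<circ> (\<lambda>t. pi - t)) has_real_derivative sin t powr (\<alpha> + 1) * -1) (at t within {0..pi})"
      by (rule DERIV_image_chain)
    from DERIV_add[OF this sine_int_deriv[OF assms(1) t]]
    show "((\<lambda>t. sine_int \<alpha> (pi - t) + sine_int \<alpha> t) has_real_derivative 0) (at t within {0..pi})"
      by (simp add: o_def)
  qed simp
  then obtain c where c: "\<And>t. t\<in>{0..pi} \<Longrightarrow> sine_int \<alpha> (pi - t) + sine_int \<alpha> t = c" by auto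
  from c[OF assms(2)] c[of "pi/2"] show ?thesis by simp
qed

lemma iso_profile_eq:
  assumes "\<alpha> \<ge> 0" "x \<in> {0..1}"
  shows "iso_profile \<alpha> x = sine_int \<alpha> (pi / 2) - sine_int \<alpha> (arcsin x)"
proof -
  have "(\<lambda>s. sin s powr (\<alpha> + 1)) integrable_on {0..pi/2}"
    using assms(1) by (intro integrable_continuous_real continuous_on_subset[OF sine_powr_continuous]) auto
  from Henstock_Kurzweil_Integration.integral_combine[OF _ _ this, of "arcsin x"] show ?thesis
    using arcsin_le_arcsin[of 0 x] arcsin_bounded[of x] assms
    by (simp add: iso_profile_def sine_int_def)
qed

text \<open>The height of the boundary curve of the isoperimetric set above the axis \<open>y = 0\<close>.\<close>

definition arc_height :: "real \<Rightarrow> real \<Rightarrow> real" where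
  "arc_height \<alpha> t = sine_int \<alpha> t - sine_int \<alpha> (pi / 2)"

lemma arc_height_reflect: "\<alpha> \<ge> 0 \<Longrightarrow> t \<in> {0..pi} \<Longrightarrow> arc_height \<alpha> (pi - t) = - arc_height \<alpha> t"
  using sine_int_reflect[of \<alpha> t] by (simp add: arc_height_def)

lemma arc_height_strict_mono: "\<alpha> \<ge> 0 \<Longrightarrow> 0 \<le> s \<Longrightarrow> s < t \<Longrightarrow> t \<le> pi \<Longrightarrow> arc_height \<alpha> s < arc_height \<alpha> t"
  using sine_int_strict_mono[of \<alpha> s t] by (simp add: arc_height_def)

lemma arc_height_mono: "\<alpha> \<ge> 0 \<Longrightarrow> 0 \<le> s \<Longrightarrow> s \<le> t \<Longrightarrow> t \<le> pi \<Longrightarrow> arc_height \<alpha> s \<le> arc_height \<alpha> t"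
  using arc_height_strict_mono[of \<alpha> s t] by (cases "s = t") auto

lemma arc_height_half: "arc_height \<alpha> (pi / 2) = 0" by (simp add: arc_height_def)

lemma arc_height_continuous: "\<alpha> \<ge> 0 \<Longrightarrow> continuous_on {0..pi} (arc_height \<alpha>)"
  unfolding arc_height_def[abs_def] by (intro continuous_intros sine_int_continuous)

lemma arc_height_deriv:
  assumes "\<alpha> \<ge> 0" "t \<in> {0<..<pi}"
  shows "(arc_height \<alpha> has_real_derivative sin t powr (\<alpha> + 1)) (at t)"
proof -
  have "(sine_int \<alpha> has_real_derivative sin t powr (\<alpha> + 1)) (at t)"
    using sine_int_deriv[of \<alpha> t] at_within_interior[of t "{0..pi}"] assms by auto
  from DERIV_diff[OF this DERIV_const] show ?thesis by (simp add: arc_height_def[abs_def])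
qed

lemma iso_profile_sin:
  assumes "\<alpha> \<ge> 0" "t \<in> {0..pi}"
  shows "iso_profile \<alpha> (sin t) = \<bar>arc_height \<alpha> t\<bar>"
proof -
  have 1: "iso_profile \<alpha> (sin t) = - arc_height \<alpha> t \<and> arc_height \<alpha> t \<le> 0" if "t \<in> {0..pi/2}" for t
    using iso_profile_eq[OF assms(1), of "sin t"] that arc_height_mono[OF assms(1), of t "pi/2"] sin_ge_zero[of t]
    by (simp add: arcsin_sin arc_height_def)
  show ?thesis
  proof (cases "t \<le> pi / 2")
    case True then show ?thesis using 1[of t] assms by auto
  next
    case False
    have "pi - t \<in> {0..pi/2}" using False assms by auto
    from 1[OF this] show ?thesis using arc_height_reflect[OF assms] by simp
  qed
qed

text \<open>The height \<open>r\<^sub>\<alpha>\<close> of the isoperimetric set above the axis.\<close>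

definition half_height :: "real \<Rightarrow> real" where "half_height \<alpha> = iso_profile \<alpha> 0"

lemma half_height_arc_height: "\<alpha> \<ge> 0 \<Longrightarrow> arc_height \<alpha> pi = half_height \<alpha>" "\<alpha> \<ge> 0 \<Longrightarrow> arc_height \<alpha> 0 = - half_height \<alpha>"
proof -
  assume a: "\<alpha> \<ge> 0"
  have "arc_height \<alpha> 0 < 0" using arc_height_strict_mono[OF a, of 0 "pi/2"] by (simp add: arc_height_half)
  then show 2: "arc_height \<alpha> 0 = - half_height \<alpha>" using iso_profile_sin[OF a, of 0] by (simp add: half_height_def)
  show "arc_height \<alpha> pi = half_height \<alpha>" using arc_height_reflect[OF a, of 0] 2 by simp
qed

lemma half_height_pos: "\<alpha> \<ge> 0 \<Longrightarrow> half_height \<alpha> > 0"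
  using arc_height_strict_mono[of \<alpha> "pi/2" pi] by (simp add: arc_height_half half_height_arc_height)

lemma iso_profile_strict:
  assumes "\<alpha> \<ge> 0" "0 \<le> x" "x < y" "y \<le> 1"
  shows "iso_profile \<alpha> y < iso_profile \<alpha> x"
proof -
  have "arcsin x < arcsin y" "0 \<le> arcsin x" "arcsin y \<le> pi"
    using assms arcsin_less_arcsin[of x y] arcsin_le_arcsin[of 0 x] arcsin_bounded[of y] pi_gt_zero by auto
  then show ?thesis using assms by (simp add: iso_profile_eq sine_int_strict_mono)
qed

lemma iso_profile_inj: "\<alpha> \<ge> 0 \<Longrightarrow> inj_on (iso_profile \<alpha>) {0..1}"
  using iso_profile_strict by (intro linorder_inj_onI) (force+)

lemma iso_profile_inv_arc_height:
  assumes "\<alpha> \<ge> 0" "t \<in> {0..pi}"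
  shows "iso_profile_inv \<alpha> \<bar>arc_height \<alpha> t\<bar> = sin t"
  unfolding iso_profile_sin[OF assms, symmetric] iso_profile_inv_def
  using assms by (intro the_inv_into_f_f iso_profile_inj) (auto simp: sin_ge_zero)

lemma iso_profile_inv_iso:
  assumes "\<alpha> \<ge> 0" "x \<in> {0..1}"
  shows "iso_profile_inv \<alpha> (iso_profile \<alpha> x) = x"
  unfolding iso_profile_inv_def by (intro the_inv_into_f_f iso_profile_inj assms)

lemma arc_height_image: assumes "\<alpha> \<ge> 0" shows "arc_height \<alpha> ` {0..pi} = {- half_height \<alpha>..half_height \<alpha>}"
proof
  show "arc_height \<alpha> ` {0..pi} \<subseteq> {- half_height \<alpha>..half_height \<alpha>}"
    using arc_height_mono[OF assms, of 0] arc_height_mono[OF assms, of _ pi] half_height_arc_height[OF assms] by fastforce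
  show "{- half_height \<alpha>..half_height \<alpha>} \<subseteq> arc_height \<alpha> ` {0..pi}"
    using IVT'[of "arc_height \<alpha>" 0 _ pi] arc_height_continuous[OF assms] half_height_arc_height[OF assms] by fastforce
qed

text \<open>The inverse of \<open>arc_height\<close> on \<open>[0, pi]\<close>; unlike the inverse of the profile it is smooth at height \<open>0\<close>,
  where the isoperimetric set is widest.\<close>

definition angle :: "real \<Rightarrow> real \<Rightarrow> real" where
  "angle \<alpha> = the_inv_into {0..pi} (arc_height \<alpha>)"

lemma arc_height_inj: "\<alpha> \<ge> 0 \<Longrightarrow> inj_on (arc_height \<alpha>) {0..pi}"
  using arc_height_strict_mono by (intro linorder_inj_onI) (force+)

lemma angle_arc_height: "\<alpha> \<ge> 0 \<Longrightarrow> t \<in> {0..pi} \<Longrightarrow> angle \<alpha> (arc_height \<alpha> t) = t"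
  unfolding angle_def by (intro the_inv_into_f_f arc_height_inj)

lemma arc_height_angle:
  assumes "\<alpha> \<ge> 0" "s \<in> {- half_height \<alpha>..half_height \<alpha>}"
  shows "angle \<alpha> s \<in> {0..pi}" "arc_height \<alpha> (angle \<alpha> s) = s"
proof -
  obtain t where t: "t \<in> {0..pi}" "s = arc_height \<alpha> t"
    using assms(2) unfolding arc_height_image[OF assms(1), symmetric] by blast
  then show "angle \<alpha> s \<in> {0..pi}" "arc_height \<alpha> (angle \<alpha> s) = s"
    using angle_arc_height[OF assms(1)] by auto
qed

lemma angle_continuous:
  assumes "\<alpha> \<ge> 0" shows "continuous_on {- half_height \<alpha>..half_height \<alpha>} (angle \<alpha>)"
  using continuous_on_inv_into[OF arc_height_continuous compact_Icc arc_height_inj, OF assms assms]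
  unfolding angle_def arc_height_image[OF assms] .

lemma angle_interior:
  assumes "\<alpha> \<ge> 0" "s \<in> {- half_height \<alpha><..<half_height \<alpha>}"
  shows "angle \<alpha> s \<in> {0<..<pi}"
proof -
  have s: "s \<in> {- half_height \<alpha>..half_height \<alpha>}" using assms by auto
  have "angle \<alpha> s \<noteq> 0" "angle \<alpha> s \<noteq> pi"
    using arc_height_angle(2)[OF assms(1) s] assms half_height_arc_height[OF assms(1)] by auto
  then show ?thesis using arc_height_angle(1)[OF assms(1) s] by auto
qed

lemma angle_deriv:
  assumes \<alpha>: "\<alpha> \<ge> 0" and s: "s \<in> {- half_height \<alpha><..<half_height \<alpha>}"
  shows "(angle \<alpha> has_real_derivative inverse (sin (angle \<alpha> s) powr (\<alpha> + 1))) (at s)"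
proof (rule DERIV_inverse_function[where f="arc_height \<alpha>" and a="- half_height \<alpha>" and b="half_height \<alpha>"])
  show "(arc_height \<alpha> has_real_derivative sin (angle \<alpha> s) powr (\<alpha> + 1)) (at (angle \<alpha> s))"
    by (rule arc_height_deriv[OF \<alpha> angle_interior[OF \<alpha> s]])
  show "sin (angle \<alpha> s) powr (\<alpha> + 1) \<noteq> 0"
    using angle_interior[OF \<alpha> s] sin_gt_zero[of "angle \<alpha> s"] by auto
  show "isCont (angle \<alpha>) s"
    using continuous_on_interior[OF angle_continuous[OF \<alpha>], of s] s by auto
qed (use s arc_height_angle[OF \<alpha>] in auto)

text \<open>The half-width of the isoperimetric set at height \<open>s\<close>, meaningful for
  \<open>\<bar>s\<bar> \<le> half_height \<alpha>\<close>.\<close>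

definition profile :: "real \<Rightarrow> real \<Rightarrow> real" where
  "profile \<alpha> s = iso_profile_inv \<alpha> \<bar>s\<bar>"

lemma profile_arc_height: "\<alpha> \<ge> 0 \<Longrightarrow> t \<in> {0..pi} \<Longrightarrow> profile \<alpha> (arc_height \<alpha> t) = sin t"
  by (simp add: profile_def iso_profile_inv_arc_height)

lemma profile_angle:
  assumes "\<alpha> \<ge> 0" "s \<in> {- half_height \<alpha>..half_height \<alpha>}"
  shows "profile \<alpha> s = sin (angle \<alpha> s)"
  using profile_arc_height[OF assms(1) arc_height_angle(1)[OF assms]] arc_height_angle(2)[OF assms] by simp

lemma profile_continuous:
  assumes "\<alpha> \<ge> 0" shows "continuous_on {- half_height \<alpha>..half_height \<alpha>} (profile \<alpha>)"
  by (subst continuous_on_cong[OF refl profile_angle[OF assms]])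
     (auto intro!: continuous_intros angle_continuous assms)

lemma profile_range:
  assumes "\<alpha> \<ge> 0" "s \<in> {- half_height \<alpha>..half_height \<alpha>}"
  shows "0 \<le> profile \<alpha> s" "profile \<alpha> s \<le> 1"
  using profile_angle[OF assms] arc_height_angle(1)[OF assms] by (auto simp: sin_ge_zero)

lemma profile_iso: "\<alpha> \<ge> 0 \<Longrightarrow> s \<in> {- half_height \<alpha>..half_height \<alpha>} \<Longrightarrow> iso_profile \<alpha> (profile \<alpha> s) = \<bar>s\<bar>"
  using iso_profile_sin[of \<alpha> "angle \<alpha> s"] arc_height_angle[of \<alpha> s] by (simp add: profile_angle)

text \<open>The isoperimetric set, defined as a region between two graphs over \<open>x\<close>, is the set with
  half-width \<open>profile \<alpha>\<close>.\<close>

lemma le_profile_iff: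
  assumes "\<alpha> \<ge> 0" "0 \<le> x"
  shows "\<bar>s\<bar> \<le> iso_profile \<alpha> x \<and> x \<le> 1 \<longleftrightarrow> \<bar>s\<bar> \<le> half_height \<alpha> \<and> x \<le> profile \<alpha> s"
proof -
  have *: "iso_profile \<alpha> y \<le> iso_profile \<alpha> x \<longleftrightarrow> x \<le> y" if "x \<in> {0..1}" "y \<in> {0..1}" for x y
    using iso_profile_strict[OF assms(1), of x y] iso_profile_strict[OF assms(1), of y x] that
    by (cases x y rule: linorder_cases) auto
  show ?thesis
  proof (cases "x \<le> 1")
    case True
    have "iso_profile \<alpha> x \<le> half_height \<alpha>" unfolding half_height_def using * True assms by auto
    moreover have "\<bar>s\<bar> \<le> iso_profile \<alpha> x \<longleftrightarrow> x \<le> profile \<alpha> s" if "\<bar>s\<bar> \<le> half_height \<alpha>"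
    proof -
      have s: "s \<in> {- half_height \<alpha>..half_height \<alpha>}" using that by auto
      show ?thesis using *[of x "profile \<alpha> s"] profile_range[OF assms(1) s] True assms
        unfolding profile_iso[OF assms(1) s] by auto
    qed
    ultimately show ?thesis using True by auto
  next
    case False
    then show ?thesis using profile_range(2)[OF assms(1), of s] by (auto simp: abs_le_iff)
  qed
qed

section \<open>Perimeter and area of profile sets\<close>

lemma div_measurable:
  assumes "C1_compact_support \<phi>1" "C1_compact_support \<phi>2"
  shows "(grushin_div \<alpha> \<phi>1 \<phi>2) \<in> borel_measurable borel"
proof -
  have [measurable]: "(\<lambda>z::real \<times> real. \<bar>fst z\<bar>) \<in> borel_measurable borel"
    "partial_x \<phi>1 \<in> borel_measurable borel" "partial_y \<phi>2 \<in> borel_measurable borel"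
    by (intro borel_measurable_continuous_onI continuous_intros C1_partials(2)[OF assms(1)] C1_partials(3)[OF assms(2)])+
  show ?thesis by measurable
qed

lemma grushin_perimeter_cong:
  assumes "ae_eq E F" "E \<in> sets lebesgue" "F \<in> sets lebesgue"
  shows "grushin_perimeter \<alpha> E = grushin_perimeter \<alpha> F"
proof -
  have ae: "AE z in lebesgue. (z \<in> E) = (z \<in> F)"
    using assms(1) unfolding ae_eq_def by (auto intro: AE_I'[of "sym_diff E F"])
  have "(LINT z:E|lebesgue. grushin_div \<alpha> \<phi>1 \<phi>2 z) =
        (LINT z:F|lebesgue. grushin_div \<alpha> \<phi>1 \<phi>2 z)"
    if C: "C1_compact_support \<phi>1" "C1_compact_support \<phi>2" for \<phi>1 \<phi>2
  proof -
    have m: "(grushin_div \<alpha> \<phi>1 \<phi>2) \<in> borel_measurable lebesgue"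
      using div_measurable[OF C] by (simp add: measurable_completion)
    show ?thesis unfolding set_lebesgue_integral_def
    proof (rule integral_cong_AE)
      show "AE z in lebesgue. indicator E z *\<^sub>R grushin_div \<alpha> \<phi>1 \<phi>2 z =
        indicator F z *\<^sub>R grushin_div \<alpha> \<phi>1 \<phi>2 z"
        using ae by eventually_elim (simp add: indicator_def)
    qed (intro borel_measurable_scaleR borel_measurable_indicator assms m)+
  qed
  then show ?thesis unfolding grushin_perimeter_def by (intro SUP_cong) auto
qed

lemma null_horizontal_line: "{z :: real \<times> real. snd z = c} \<in> null_sets lebesgue"
proof -
  have "negligible {z :: real \<times> real. z \<bullet> (0, 1) = c}"
    by (rule negligible_standard_hyperplane) (auto simp: Basis_prod_def)
  moreover have "{z :: real \<times> real. z \<bullet> (0, 1) = c} = {z. snd z = c}" by (auto simp: inner_prod_def)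
  ultimately show ?thesis by (simp add: negligible_iff_null_sets)
qed

lemma ae_eq_off_lines:
  assumes "sym_diff E F \<subseteq> (\<Union>c\<in>C. {z. snd z = c})" "finite C" "E \<in> sets lebesgue" "F \<in> sets lebesgue"
  shows "ae_eq E F"
proof -
  have "(\<Union>c\<in>C. {z :: real \<times> real. snd z = c}) \<in> null_sets lebesgue"
    using null_horizontal_line by (intro null_sets.finite_UN assms(2)) auto
  then show ?thesis unfolding ae_eq_def
    by (rule null_sets_subset[OF _ _ assms(1)]) (intro sets.Un sets.Diff assms(3,4))
qed

lemma strip_measure:
  assumes G: "continuous_on {l..r} G" "\<And>y. y \<in> {l..r} \<Longrightarrow> 0 \<le> G y"
  shows "emeasure lebesgue (strip G l r) = ennreal (integral {l..r} (\<lambda>y. 2 * G y))"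
proof -
  have R: "strip G l r \<in> sets lebesgue" using strip_borel[OF G(1)] by simp
  have "\<bar>(\<lambda>_. 1::real) z\<bar> \<le> 1" for z :: "real \<times> real" by simp
  note SI = strip_integral[OF G(1) borel_measurable_const this]
  have "set_integrable lebesgue (strip G l r) (\<lambda>_. 1::real)" by (rule SI(1))
  then have fin: "emeasure lebesgue (strip G l r) < \<infinity>"
    using R by (simp add: set_integrable_def integrable_indicator_iff)
  have "measure lebesgue (strip G l r) = (LINT z:strip G l r|lebesgue. 1)"
    using R fin by (simp add: set_lebesgue_integral_def)
  also have "\<dots> = integral {l..r} (\<lambda>y. integral {- G y..G y} (\<lambda>x. 1))" by (rule SI(2))
  also have "\<dots> = integral {l..r} (\<lambda>y. 2 * G y)" using G(2) by (intro integral_cong) auto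
  finally show ?thesis using fin by (simp add: emeasure_eq_ennreal_measure)
qed

lemma sym_profile_continuous:
  fixes g :: "real \<Rightarrow> real"
  assumes "continuous_on {0..r} g" shows "continuous_on {-r..r} (\<lambda>y. g \<bar>y\<bar>)"
  by (intro continuous_on_compose2[OF assms] continuous_intros) auto

lemma parts_measurable:
  assumes "E \<in> sets lebesgue"
  shows "upper_part E \<in> sets lebesgue" "lower_part E \<in> sets lebesgue"
proof -
  have "open {z :: real \<times> real. snd z > 0}" "open {z :: real \<times> real. snd z < 0}"
    by (intro open_Collect_less continuous_intros)+
  from this[THEN borel_open] have "{z :: real \<times> real. snd z > 0} \<in> sets lebesgue" "{z :: real \<times> real. snd z < 0} \<in> sets lebesgue"
    by simp_all
  then show "upper_part E \<in> sets lebesgue" "lower_part E \<in> sets lebesgue"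
    unfolding upper_part_def lower_part_def using assms by (auto intro: sets.Int)
qed

lemma profile_set_parts:
  fixes g :: "real \<Rightarrow> real"
  assumes r: "0 < r" and g: "continuous_on {0..r} g"
  shows "y_profile_set g r \<in> sets lebesgue" "upper_part (y_profile_set g r) \<in> sets lebesgue" "lower_part (y_profile_set g r) \<in> sets lebesgue"
    and "ae_eq (y_profile_set g r) (strip (\<lambda>y. g \<bar>y\<bar>) (-r) r)"
    and "ae_eq (upper_part (y_profile_set g r)) (strip g 0 r)"
    and "ae_eq (lower_part (y_profile_set g r)) (strip (\<lambda>y. g (-y)) (-r) 0)"
proof -
  have "y_profile_set g r = {(x, y). -r \<le> y \<and> y \<le> r \<and> \<bar>x\<bar> \<le> g \<bar>y\<bar>}"
    by (auto simp: y_profile_set_def)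
  then have "closed (y_profile_set g r)" using closed_profile[OF sym_profile_continuous[OF g]] by simp
  then show 1: "y_profile_set g r \<in> sets lebesgue" by (simp add: lborelD)
  show 2: "upper_part (y_profile_set g r) \<in> sets lebesgue" and 3: "lower_part (y_profile_set g r) \<in> sets lebesgue"
    by (intro parts_measurable 1)+
  have cm: "continuous_on {-r..0} (\<lambda>y. g (-y))" by (intro continuous_on_compose2[OF g] continuous_intros) auto
  note sb = strip_borel[OF sym_profile_continuous[OF g]] strip_borel[OF g] strip_borel[OF cm]
  show "ae_eq (y_profile_set g r) (strip (\<lambda>y. g \<bar>y\<bar>) (-r) r)"
    by (rule ae_eq_off_lines[where C="{r, -r}"]) (use 1 sb in \<open>auto simp: y_profile_set_def strip_def abs_le_iff[of _ r]\<close>)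
  show "ae_eq (upper_part (y_profile_set g r)) (strip g 0 r)"
    by (rule ae_eq_off_lines[where C="{r}"]) (use 2 sb in \<open>auto simp: y_profile_set_def strip_def upper_part_def\<close>)
  show "ae_eq (lower_part (y_profile_set g r)) (strip (\<lambda>y. g (-y)) (-r) 0)"
    by (rule ae_eq_off_lines[where C="{-r}"]) (use 3 sb in \<open>auto simp: y_profile_set_def strip_def lower_part_def\<close>)
qed

lemma double_perimeter_profile_set:
  fixes g :: "real \<Rightarrow> real"
  assumes r: "0 < r" and g: "continuous_on {0..r} g"
  shows "double_perimeter \<alpha> (y_profile_set g r) = ereal (1 / 2) *
    (grushin_perimeter \<alpha> (strip g 0 r) + grushin_perimeter \<alpha> (strip (\<lambda>y. g (-y)) (-r) 0)
     + grushin_perimeter \<alpha> (strip (\<lambda>y. g \<bar>y\<bar>) (-r) r))"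
proof -
  have cm: "continuous_on {-r..0} (\<lambda>y. g (-y))" by (intro continuous_on_compose2[OF g] continuous_intros) auto
  note P = profile_set_parts[OF r g]
  have S: "strip g 0 r \<in> sets lebesgue" "strip (\<lambda>y. g (-y)) (-r) 0 \<in> sets lebesgue" "strip (\<lambda>y. g \<bar>y\<bar>) (-r) r \<in> sets lebesgue"
    using strip_borel[OF sym_profile_continuous[OF g]] strip_borel[OF g] strip_borel[OF cm] by auto
  show ?thesis unfolding double_perimeter_def
    using grushin_perimeter_cong[OF P(5) P(2) S(1)] grushin_perimeter_cong[OF P(6) P(3) S(2)] grushin_perimeter_cong[OF P(4) P(1) S(3)]
    by simp
qed

section \<open>The candidate and its double perimeter\<close>

text \<open>The isoperimetric set, dilated by \<open>1 / h\<close> and shifted upwards by \<open>k\<close> before dilation: its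
  half-width at height \<open>y\<close>, and the height of its boundary curve at the parameter \<open>t\<close>.\<close>

definition arc_profile :: "real \<Rightarrow> real \<Rightarrow> real \<Rightarrow> real \<Rightarrow> real" where
  "arc_profile \<alpha> h k y = profile \<alpha> (h powr (\<alpha> + 1) * y - k) / h"

definition arc_y :: "real \<Rightarrow> real \<Rightarrow> real \<Rightarrow> real \<Rightarrow> real" where
  "arc_y \<alpha> h k t = (arc_height \<alpha> t + k) / h powr (\<alpha> + 1)"

lemma arc_profile_arc_y: "\<alpha> \<ge> 0 \<Longrightarrow> h > 0 \<Longrightarrow> t \<in> {0..pi} \<Longrightarrow> arc_profile \<alpha> h k (arc_y \<alpha> h k t) = sin t / h"
  by (simp add: arc_profile_def arc_y_def profile_arc_height)

lemma arc_y_mono: "\<alpha> \<ge> 0 \<Longrightarrow> h > 0 \<Longrightarrow> 0 \<le> s \<Longrightarrow> s < t \<Longrightarrow> t \<le> pi \<Longrightarrow> arc_y \<alpha> h k s < arc_y \<alpha> h k t"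
  unfolding arc_y_def using arc_height_strict_mono[of \<alpha> s t] by (auto intro!: divide_strict_right_mono)

lemma arc_profile_continuous:
  assumes "\<alpha> \<ge> 0" "h > 0" "0 \<le> a" "a \<le> b" "b \<le> pi"
  shows "continuous_on {arc_y \<alpha> h k a..arc_y \<alpha> h k b} (arc_profile \<alpha> h k)"
proof -
  have "h powr (\<alpha> + 1) * y - k \<in> {- half_height \<alpha>..half_height \<alpha>}" if y: "y \<in> {arc_y \<alpha> h k a..arc_y \<alpha> h k b}" for y
  proof -
    have "arc_height \<alpha> a \<le> h powr (\<alpha> + 1) * y - k" "h powr (\<alpha> + 1) * y - k \<le> arc_height \<alpha> b"
      using y assms(2) by (auto simp: arc_y_def field_simps)
    then show ?thesis using arc_height_mono[OF assms(1), of 0 a] arc_height_mono[OF assms(1), of b pi] half_height_arc_height[OF assms(1)] assms by auto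
  qed
  then show ?thesis unfolding arc_profile_def
    using assms by (intro continuous_intros continuous_on_compose2[OF profile_continuous[OF assms(1)]]) auto
qed

lemma arc_test_bound:
  assumes \<alpha>: "\<alpha> \<ge> 0" and h: "h > 0" and ab: "0 \<le> a" "a < b" "b \<le> pi"
    and C: "C1_compact_support \<phi>1" "C1_compact_support \<phi>2" and unit: "\<And>z. sqrt ((\<phi>1 z)\<^sup>2 + (\<phi>2 z)\<^sup>2) \<le> 1"
  shows "set_integrable lebesgue (strip (arc_profile \<alpha> h k) (arc_y \<alpha> h k a) (arc_y \<alpha> h k b)) (grushin_div \<alpha> \<phi>1 \<phi>2)"
    and "(LINT z:strip (arc_profile \<alpha> h k) (arc_y \<alpha> h k a) (arc_y \<alpha> h k b)|lebesgue. grushin_div \<alpha> \<phi>1 \<phi>2 z)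
      \<le> 2 / h powr (\<alpha> + 1) * integral {a..b} (\<lambda>t. sin t powr \<alpha>) + flux \<alpha> \<phi>2 (sin b / h) (arc_y \<alpha> h k b) - flux \<alpha> \<phi>2 (sin a / h) (arc_y \<alpha> h k a)"
proof -
  have e: "arc_y \<alpha> h k t = (sine_int \<alpha> t - (sine_int \<alpha> (pi / 2) - k)) / h powr (\<alpha> + 1)" for t
    by (simp add: arc_y_def arc_height_def)
  have c: "continuous_on {arc_y \<alpha> h k a..arc_y \<alpha> h k b} (arc_profile \<alpha> h k)"
    using ab by (intro arc_profile_continuous \<alpha> h) auto
  have v: "arc_profile \<alpha> h k (arc_y \<alpha> h k t) = sin t / h" if "t \<in> {a..b}" for t
    using that ab by (intro arc_profile_arc_y \<alpha> h) auto
  show "set_integrable lebesgue (strip (arc_profile \<alpha> h k) (arc_y \<alpha> h k a) (arc_y \<alpha> h k b)) (grushin_div \<alpha> \<phi>1 \<phi>2)"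
    unfolding e by (rule arc_divergence_bound(1)[OF \<alpha> h ab c[unfolded e] v[unfolded e] C unit])
  show "(LINT z:strip (arc_profile \<alpha> h k) (arc_y \<alpha> h k a) (arc_y \<alpha> h k b)|lebesgue. grushin_div \<alpha> \<phi>1 \<phi>2 z)
      \<le> 2 / h powr (\<alpha> + 1) * integral {a..b} (\<lambda>t. sin t powr \<alpha>) + flux \<alpha> \<phi>2 (sin b / h) (arc_y \<alpha> h k b) - flux \<alpha> \<phi>2 (sin a / h) (arc_y \<alpha> h k a)"
    unfolding e by (rule arc_divergence_bound(2)[OF \<alpha> h ab c[unfolded e] v[unfolded e] C unit])
qed

lemma component_le_1:
  assumes "sqrt (p\<^sup>2 + q\<^sup>2) \<le> (1::real)" shows "\<bar>q\<bar> \<le> 1"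
proof -
  have "q\<^sup>2 \<le> p\<^sup>2 + q\<^sup>2" by simp
  also have "\<dots> \<le> 1" using assms by simp
  finally show ?thesis by (simp add: abs_square_le_1)
qed

lemma arc_perimeter_bound:
  assumes \<alpha>: "\<alpha> \<ge> 0" and h: "h > 0" and ab: "0 \<le> a" "a < b" "b \<le> pi"
  shows "grushin_perimeter \<alpha> (strip (arc_profile \<alpha> h k) (arc_y \<alpha> h k a) (arc_y \<alpha> h k b)) \<le>
    ereal (2 / h powr (\<alpha> + 1) * integral {a..b} (\<lambda>t. sin t powr \<alpha>) + wint \<alpha> (\<lambda>_. 1) (sin b / h) + wint \<alpha> (\<lambda>_. 1) (sin a / h))"
  unfolding grushin_perimeter_def
proof (rule SUP_least, clarify)
  fix \<phi>1 \<phi>2 assume C: "C1_compact_support \<phi>1" "C1_compact_support \<phi>2" and unit: "\<forall>z. sqrt ((\<phi>1 z)\<^sup>2 + (\<phi>2 z)\<^sup>2) \<le> 1"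
  have s: "sin t / h \<ge> 0" if "t \<in> {a..b}" for t using that ab h sin_ge_zero[of t] by simp
  have "\<bar>flux \<alpha> \<phi>2 (sin t / h) y\<bar> \<le> wint \<alpha> (\<lambda>_. 1) (sin t / h)" if "t \<in> {a..b}" for t y
    using unit by (intro flux_bound \<alpha> C1_partials(1)[OF C(2)] s that component_le_1) auto
  from this[of a "arc_y \<alpha> h k a"] this[of b "arc_y \<alpha> h k b"]
  show "ereal (LINT z:strip (arc_profile \<alpha> h k) (arc_y \<alpha> h k a) (arc_y \<alpha> h k b)|lebesgue. grushin_div \<alpha> \<phi>1 \<phi>2 z)
    \<le> ereal (2 / h powr (\<alpha> + 1) * integral {a..b} (\<lambda>t. sin t powr \<alpha>) + wint \<alpha> (\<lambda>_. 1) (sin b / h) + wint \<alpha> (\<lambda>_. 1) (sin a / h))"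
    using arc_test_bound(2)[OF \<alpha> h ab C, of k] unit ab unfolding ereal_less_eq(3) by (smt (verit) atLeastAtMost_iff)
qed

lemma profile_minus: "profile \<alpha> (- s) = profile \<alpha> s" by (simp add: profile_def)

lemma arc_profile_minus: "arc_profile \<alpha> h k (- y) = arc_profile \<alpha> h (- k) y"
  using profile_minus[of \<alpha> "h powr (\<alpha> + 1) * y + k"] by (simp add: arc_profile_def)

lemma sin_powr_integrable:
  assumes "\<alpha> \<ge> 0" "0 \<le> a" "b \<le> pi"
  shows "(\<lambda>t. sin t powr \<alpha>) integrable_on {a..b}"
proof (rule integrable_on_bounded_borel(2))
  show "\<bar>sin t powr \<alpha>\<bar> \<le> 1" if "t \<in> {a..b}" for t
    using powr_le1[of \<alpha> "sin t"] sin_ge_zero[of t] that assms by auto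
qed measurable

lemma sin_powr_integral_reflect:
  assumes "\<alpha> \<ge> 0" "0 \<le> a" "b \<le> pi"
  shows "integral {pi - b..pi - a} (\<lambda>t. sin t powr \<alpha>) = integral {a..b} (\<lambda>t. sin t powr \<alpha>)"
proof -
  have "((\<lambda>t. sin t powr \<alpha>) has_integral integral {a..b} (\<lambda>t. sin t powr \<alpha>)) (cbox a b)"
    using sin_powr_integrable[OF assms] by (simp add: integrable_integral cbox_interval)
  from has_integral_affinity[OF this, of "-1" pi]
  have "((\<lambda>t. sin (pi - t) powr \<alpha>) has_integral integral {a..b} (\<lambda>t. sin t powr \<alpha>)) ((\<lambda>t. pi - t) ` {a..b})"
    by (simp add: cbox_interval add.commute[of _ pi] del: sin_pi_minus)
  then show ?thesis by (simp add: integral_unique)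
qed

lemma sin_third_values:
  "sin (pi / 3) = sqrt 3 / 2" "sin (2 * pi / 3) = sqrt 3 / 2"
proof -
  show "sin (pi / 3) = sqrt 3 / 2" by (rule sin_60)
  have "2 * pi / 3 = pi - pi / 3" by simp
  then show "sin (2 * pi / 3) = sqrt 3 / 2" by (simp only: sin_pi_minus sin_60)
qed

text \<open>The vertical shift of the optimal sets. With it the parameters \<open>pi / 3\<close> for the upper half and
  \<open>2 * pi / 3\<close> for the lower half correspond to the height \<open>y = 0\<close>.\<close>

definition offset :: "real \<Rightarrow> real" where "offset \<alpha> = iso_profile \<alpha> (sqrt 3 / 2)"

lemma arc_height_offset:
  assumes "\<alpha> \<ge> 0"
  shows "arc_height \<alpha> (pi / 3) = - offset \<alpha>" "arc_height \<alpha> (2 * pi / 3) = offset \<alpha>" "offset \<alpha> > 0" "offset \<alpha> < half_height \<alpha>"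
proof -
  have "arc_height \<alpha> (pi / 3) < 0" using arc_height_strict_mono[OF assms, of "pi/3" "pi/2"] by (simp add: arc_height_half)
  moreover have "iso_profile \<alpha> (sqrt 3 / 2) = \<bar>arc_height \<alpha> (pi / 3)\<bar>"
    using iso_profile_sin[OF assms, of "pi/3"] by (simp add: sin_third_values)
  ultimately show 1: "arc_height \<alpha> (pi / 3) = - offset \<alpha>" and "offset \<alpha> > 0" by (auto simp: offset_def)
  have "pi - pi / 3 = 2 * pi / 3" by simp
  then show "arc_height \<alpha> (2 * pi / 3) = offset \<alpha>" using arc_height_reflect[OF assms, of "pi/3"] 1 by simp
  have "arc_height \<alpha> 0 < arc_height \<alpha> (pi / 3)" by (rule arc_height_strict_mono[OF assms]) auto
  then show "offset \<alpha> < half_height \<alpha>" using 1 half_height_arc_height[OF assms] by simp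
qed

text \<open>Half-width and height of the upper half of the candidate.\<close>

definition cand_profile :: "real \<Rightarrow> real \<Rightarrow> real \<Rightarrow> real" where
  "cand_profile \<alpha> h = arc_profile \<alpha> h (offset \<alpha>)"

definition cand_height :: "real \<Rightarrow> real \<Rightarrow> real" where
  "cand_height \<alpha> h = (half_height \<alpha> + offset \<alpha>) / h powr (\<alpha> + 1)"

lemma cand_arc_y:
  assumes "\<alpha> \<ge> 0"
  shows "arc_y \<alpha> h (offset \<alpha>) (pi / 3) = 0" "arc_y \<alpha> h (offset \<alpha>) pi = cand_height \<alpha> h"
    "arc_y \<alpha> h (- offset \<alpha>) (2 * pi / 3) = 0" "arc_y \<alpha> h (- offset \<alpha>) 0 = - cand_height \<alpha> h"
  using assms minus_divide_left[of "half_height \<alpha> + offset \<alpha>" "h powr (\<alpha> + 1)"]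
  by (simp_all add: arc_y_def arc_height_offset half_height_arc_height cand_height_def)

lemma cand_height_pos: "\<alpha> \<ge> 0 \<Longrightarrow> h > 0 \<Longrightarrow> cand_height \<alpha> h > 0"
  using half_height_pos[of \<alpha>] arc_height_offset(3)[of \<alpha>] by (simp add: cand_height_def)

lemma cand_continuous:
  assumes "\<alpha> \<ge> 0" "h > 0"
  shows "continuous_on {0..cand_height \<alpha> h} (cand_profile \<alpha> h)"
  using arc_profile_continuous[OF assms, of "pi/3" pi "offset \<alpha>"] assms
  by (simp add: cand_arc_y cand_profile_def)

text \<open>The upper half and the lower half are one arc region each, and the whole candidate is the
  union of both. In the bound for the whole set the two fluxes at \<open>y = 0\<close> cancel.\<close>

lemma cand_double_perimeter:
  assumes \<alpha>: "\<alpha> \<ge> 0" and h: "h > 0"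
  shows "double_perimeter \<alpha> (y_profile_set (cand_profile \<alpha> h) (cand_height \<alpha> h)) \<le>
    ereal (4 / h powr (\<alpha> + 1) * integral {pi/3..pi} (\<lambda>t. sin t powr \<alpha>) + wint \<alpha> (\<lambda>_. 1) (sqrt 3 / 2 / h))"
proof -
  let ?H = "h powr (\<alpha> + 1)"
  let ?g = "cand_profile \<alpha> h" let ?r = "cand_height \<alpha> h"
  let ?I = "integral {pi/3..pi} (\<lambda>t. sin t powr \<alpha>)" let ?V = "wint \<alpha> (\<lambda>_. 1) (sqrt 3 / 2 / h)"
  let ?u = "arc_profile \<alpha> h (offset \<alpha>)" let ?d = "arc_profile \<alpha> h (- offset \<alpha>)"
  have r: "?r > 0" by (rule cand_height_pos[OF \<alpha> h])
  have V0: "wint \<alpha> (\<lambda>_. 1) 0 = 0" by (simp add: wint_def)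
  have gm: "(\<lambda>y. ?g (- y)) = ?d" by (simp add: cand_profile_def arc_profile_minus)
  have I: "integral {0..2 * pi / 3} (\<lambda>t. sin t powr \<alpha>) = ?I"
    using sin_powr_integral_reflect[OF \<alpha>, of "pi/3" pi] by simp
  have c23: "0 \<le> 2 * pi / 3" "2 * pi / 3 < pi" "0 < 2 * pi / 3" "2 * pi / 3 \<le> pi" by auto
  have P1: "grushin_perimeter \<alpha> (strip ?g 0 ?r) \<le> ereal (2 / ?H * ?I + ?V)"
    using arc_perimeter_bound[OF \<alpha> h, of "pi/3" pi "offset \<alpha>"] \<alpha>
    by (simp add: cand_arc_y cand_profile_def V0 sin_third_values)
  have P2: "grushin_perimeter \<alpha> (strip (\<lambda>y. ?g (- y)) (- ?r) 0) \<le> ereal (2 / ?H * ?I + ?V)"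
    using arc_perimeter_bound[OF \<alpha> h order_refl c23(3,4), of "- offset \<alpha>"] I
    unfolding gm by (simp only: cand_arc_y[OF \<alpha>] V0 sin_third_values sin_zero div_0 add_0_right)
  have P3: "grushin_perimeter \<alpha> (strip (\<lambda>y. ?g \<bar>y\<bar>) (- ?r) ?r) \<le> ereal (4 / ?H * ?I)"
    unfolding grushin_perimeter_def
  proof (rule SUP_least, clarify)
    fix \<phi>1 \<phi>2 assume C: "C1_compact_support \<phi>1" "C1_compact_support \<phi>2" and unit: "\<forall>z. sqrt ((\<phi>1 z)\<^sup>2 + (\<phi>2 z)\<^sup>2) \<le> 1"
    let ?f = "\<lambda>z. partial_x \<phi>1 z + \<bar>fst z\<bar> powr \<alpha> * partial_y \<phi>2 z"
    have unit': "sqrt ((\<phi>1 z)\<^sup>2 + (\<phi>2 z)\<^sup>2) \<le> 1" for z using unit by (rule spec)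
    let ?S1 = "strip ?u 0 ?r" and ?S2 = "strip ?d (- ?r) 0"
    have B1: "set_integrable lebesgue ?S1 ?f" "(LINT z:?S1|lebesgue. ?f z) \<le> 2 / ?H * ?I + flux \<alpha> \<phi>2 0 ?r - flux \<alpha> \<phi>2 (sqrt 3 / 2 / h) 0"
      using arc_test_bound[OF \<alpha> h _ _ _ C unit', of "pi/3" pi "offset \<alpha>"] \<alpha>
      by (simp_all add: cand_arc_y sin_third_values)
    have B2: "set_integrable lebesgue ?S2 ?f" "(LINT z:?S2|lebesgue. ?f z) \<le> 2 / ?H * ?I + flux \<alpha> \<phi>2 (sqrt 3 / 2 / h) 0 - flux \<alpha> \<phi>2 0 (- ?r)"
      using arc_test_bound[OF \<alpha> h order_refl c23(3,4) C unit', of "- offset \<alpha>"] I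
      by (simp_all only: cand_arc_y[OF \<alpha>] sin_third_values sin_zero div_0)
    have F0: "flux \<alpha> \<phi>2 0 y = 0" for y by (simp add: flux_def wint_def)
    have cg: "continuous_on {0..?r} ?g" by (rule cand_continuous[OF \<alpha> h])
    have cd: "continuous_on {-?r..0} ?d" unfolding gm[symmetric]
      by (intro continuous_on_compose2[OF cg] continuous_intros) auto
    have S: "?S1 \<in> sets lebesgue" "?S2 \<in> sets lebesgue" "strip (\<lambda>y. ?g \<bar>y\<bar>) (- ?r) ?r \<in> sets lebesgue"
      using strip_borel[OF cg] strip_borel[OF cd] strip_borel[OF sym_profile_continuous[OF cg]]
      by (auto simp: cand_profile_def)
    have "(LINT z:strip (\<lambda>y. ?g \<bar>y\<bar>) (- ?r) ?r|lebesgue. ?f z) = (LINT z:?S1 \<union> ?S2|lebesgue. ?f z)"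
      unfolding set_lebesgue_integral_def
    proof (rule integral_cong_AE)
      have m: "?f \<in> borel_measurable lebesgue"
        using div_measurable[OF C] by (simp add: measurable_completion)
      show "(\<lambda>z. indicat_real (strip (\<lambda>y. ?g \<bar>y\<bar>) (- ?r) ?r) z *\<^sub>R ?f z) \<in> borel_measurable lebesgue"
        "(\<lambda>z. indicat_real (?S1 \<union> ?S2) z *\<^sub>R ?f z) \<in> borel_measurable lebesgue"
        by (intro borel_measurable_scaleR borel_measurable_indicator sets.Un S m)+
      show "AE z in lebesgue. indicat_real (strip (\<lambda>y. ?g \<bar>y\<bar>) (- ?r) ?r) z *\<^sub>R ?f z = indicat_real (?S1 \<union> ?S2) z *\<^sub>R ?f z"
      proof (rule AE_I'[OF null_horizontal_line[of 0]], clarsimp)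
        fix x y assume ne: "indicat_real (strip (\<lambda>y. ?g \<bar>y\<bar>) (- ?r) ?r) (x, y) \<noteq> indicat_real (?S1 \<union> ?S2) (x, y)"
        show "y = 0"
        proof (rule ccontr)
          assume "y \<noteq> 0"
          then have "(x, y) \<in> strip (\<lambda>y. ?g \<bar>y\<bar>) (- ?r) ?r \<longleftrightarrow> (x, y) \<in> ?S1 \<union> ?S2"
            using r arc_profile_minus[of \<alpha> h "offset \<alpha>" y]
            by (cases "y > 0") (auto simp: strip_def cand_profile_def)
          then show False using ne by (simp add: indicator_def)
        qed
      qed
    qed
    also have "\<dots> = (LINT z:?S1|lebesgue. ?f z) + (LINT z:?S2|lebesgue. ?f z)"
      by (rule set_integral_Un[OF _ B1(1) B2(1)]) (auto simp: strip_def)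
    also have "\<dots> \<le> 4 / ?H * ?I" using B1(2) B2(2) by (simp add: F0)
    finally show "ereal (LINT z:strip (\<lambda>y. ?g \<bar>y\<bar>) (- ?r) ?r|lebesgue. ?f z) \<le> ereal (4 / ?H * ?I)" by simp
  qed
  have "double_perimeter \<alpha> (y_profile_set ?g ?r) \<le> ereal (1 / 2) * (ereal (2 / ?H * ?I + ?V) + ereal (2 / ?H * ?I + ?V) + ereal (4 / ?H * ?I))"
    unfolding double_perimeter_profile_set[OF r cand_continuous[OF \<alpha> h]]
    by (intro ereal_mult_left_mono add_mono P1 P2 P3) auto
  also have "\<dots> = ereal (4 / ?H * ?I + ?V)" by (simp add: field_simps)
  finally show ?thesis .
qed

section \<open>The calibrating fields\<close>

text \<open>The calibration bound when fields may also change at the top \<open>r\<close> of the strip, by continuity in the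
  heights \<open>c i\<close>.\<close>

theorem calibration_lower_bound_closed:
  assumes \<alpha>: "\<alpha> \<ge> 0" and lr: "l < r" and G: "continuous_on {l..r} G"
    and GM: "\<And>y. y \<in> {l..r} \<Longrightarrow> 0 \<le> G y \<and> G y \<le> M"
    and A: "\<And>i. continuous_on UNIV (A i)" and B: "\<And>i. continuous_on UNIV (B i)"
    and unit: "\<And>i x. x \<in> {-M..M} \<Longrightarrow> (A i x)\<^sup>2 + (B i x)\<^sup>2 \<le> 1"
    and c: "\<And>i. i < n \<Longrightarrow> l \<le> c i \<and> c i \<le> r" "\<And>i. Suc i < n \<Longrightarrow> c i \<le> c (Suc i)"
  shows "ereal (calib_value \<alpha> G l r n c A B) \<le> grushin_perimeter \<alpha> (strip G l r)"
proof -
  have ev: "eventually (\<lambda>q. ereal (calib_value \<alpha> G l r n (\<lambda>i. min (c i) q) A B) \<le> grushin_perimeter \<alpha> (strip G l r)) (at_left r)"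
  proof (rule eventually_at_leftI[OF _ lr])
    fix q assume q: "q \<in> {l<..<r}"
    show "ereal (calib_value \<alpha> G l r n (\<lambda>i. min (c i) q) A B) \<le> grushin_perimeter \<alpha> (strip G l r)"
      using q c by (intro calibration_lower_bound[OF \<alpha> lr G GM A B unit])
        (auto simp: min_le_iff_disj min.coboundedI1 min.coboundedI2)
  qed
  have cmp: "continuous_on {l..r} (\<lambda>y. odd_diff (A i) (G y))" for i
    unfolding odd_diff_def by (intro continuous_intros continuous_on_compose2[OF A] G) auto
  have cw: "continuous_on {l..r} (\<lambda>y. wint \<alpha> (B i) (G y))" for i
    using GM by (intro continuous_on_compose2[OF continuous_wint[OF \<alpha> B, of M]] G) auto
  have mn: "((\<lambda>q. min (c i) q) \<longlongrightarrow> c i) (at_left r)" if "i < n" for i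
  proof -
    have "((\<lambda>q. min (c i) q) \<longlongrightarrow> min (c i) r) (at_left r)" by (intro tendsto_intros)
    then show ?thesis using c(1)[OF that] by (simp add: min_def)
  qed
  have comp: "((\<lambda>q. H (min (c i) q)) \<longlongrightarrow> H (c i)) (at_left r)" if i: "i < n" and H: "continuous_on {l..r} H" for H :: "real \<Rightarrow> real" and i
  proof (rule continuous_on_tendsto_compose[OF H mn[OF i]])
    show "c i \<in> {l..r}" using c(1)[OF i] by auto
    show "eventually (\<lambda>q. min (c i) q \<in> {l..r}) (at_left r)"
      by (rule eventually_at_leftI[OF _ lr]) (use c(1)[OF i] in auto)
  qed
  have ci: "continuous_on {l..r} (\<lambda>a. integral {a..r} F)" if "continuous_on {l..r} F" for F :: "real \<Rightarrow> real"
    using integrable_continuous_real[OF that] by (rule indefinite_integral_continuous_1')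
  have "((\<lambda>q. calib_value \<alpha> G l r n (\<lambda>i. min (c i) q) A B) \<longlongrightarrow> calib_value \<alpha> G l r n c A B) (at_left r)"
    unfolding calib_value_def
  proof (intro tendsto_intros)
    fix i assume "i \<in> {..<n}"
    then have i: "i < n" by simp
    show "((\<lambda>q. integral {min (c i) q..r} (\<lambda>y. odd_diff (A (Suc i)) (G y) - odd_diff (A i) (G y))) \<longlongrightarrow>
          integral {c i..r} (\<lambda>y. odd_diff (A (Suc i)) (G y) - odd_diff (A i) (G y))) (at_left r)"
      by (rule comp[OF i]) (intro ci continuous_intros cmp)
    show "((\<lambda>q. wint \<alpha> (B (Suc i)) (G (min (c i) q))) \<longlongrightarrow> wint \<alpha> (B (Suc i)) (G (c i))) (at_left r)"
      "((\<lambda>q. wint \<alpha> (B i) (G (min (c i) q))) \<longlongrightarrow> wint \<alpha> (B i) (G (c i))) (at_left r)"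
      by (rule comp[OF i cw])+
  qed
  then show ?thesis using ev
    by (intro tendsto_upperbound[of "\<lambda>q. ereal (calib_value \<alpha> G l r n (\<lambda>i. min (c i) q) A B)" _ "at_left r"]) auto
qed

text \<open>The vertical component of the unit field \<open>(k x, calib_cos k x)\<close>; it is extended by \<open>0\<close> to
  \<open>\<bar>k x\<bar> > 1\<close>.\<close>

definition calib_cos :: "real \<Rightarrow> real \<Rightarrow> real" where
  "calib_cos k x = sqrt (max 0 (1 - (k * x)\<^sup>2))"

lemma continuous_calib_cos: "continuous_on S (calib_cos k)"
  unfolding calib_cos_def by (intro continuous_intros)

lemma calib_cos_sq: "\<bar>k * x\<bar> \<le> 1 \<Longrightarrow> (calib_cos k x)\<^sup>2 = 1 - (k * x)\<^sup>2"
  by (simp add: calib_cos_def abs_square_le_1)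

lemma calib_cos_minus: "calib_cos k (- x) = calib_cos k x" by (simp add: calib_cos_def)

lemma wint_minus: "wint \<alpha> (\<lambda>x. - B x) s = - wint \<alpha> B s"
  by (simp add: wint_def)

text \<open>The weighted fluxes of the vertical unit field and of the field
  \<open>(k x, calib_cos k x)\<close> through the section \<open>[-s, s]\<close>.\<close>

abbreviation vint :: "real \<Rightarrow> real \<Rightarrow> real" where "vint \<alpha> \<equiv> wint \<alpha> (\<lambda>_. 1)"
abbreviation qint :: "real \<Rightarrow> real \<Rightarrow> real \<Rightarrow> real" where "qint \<alpha> k \<equiv> wint \<alpha> (calib_cos k)"

lemma wint_neg1: "wint \<alpha> (\<lambda>_. - 1) s = - vint \<alpha> s"
  using wint_minus[of \<alpha> "\<lambda>_. 1"] by simp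

text \<open>The change of the calibration bound when the field \<open>(k x, \<tau> * calib_cos k x)\<close> is replaced by
  \<open>(P, R)\<close> on the layer \<open>a < y < b\<close>.\<close>

definition layer_gain ::
  "real \<Rightarrow> real \<Rightarrow> real \<Rightarrow> (real \<Rightarrow> real) \<Rightarrow> (real \<Rightarrow> real) \<Rightarrow> (real \<Rightarrow> real) \<Rightarrow> real \<Rightarrow> real \<Rightarrow> real" where
  "layer_gain \<alpha> k \<tau> G P R a b =
     integral {a..b} (\<lambda>y. odd_diff P (G y) - 2 * k * G y)
     + (wint \<alpha> R (G a) - \<tau> * qint \<alpha> k (G a)) - (wint \<alpha> R (G b) - \<tau> * qint \<alpha> k (G b))"

text \<open>The calibration from the bottom to the top of a strip: \<open>(0, -1)\<close>, then
  \<open>(k x, - calib_cos k x)\<close> up to the height \<open>m\<close>, then \<open>(k x, calib_cos k x)\<close>, and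
  \<open>(0, 1)\<close> at the top. In addition the field may be replaced by \<open>(P1, R1)\<close> on the layer
  \<open>[y1, y2]\<close> below \<open>m\<close> and by \<open>(P2, R2)\<close> on the layer \<open>[y3, y4]\<close> above \<open>m\<close>.\<close>

lemma strip_lower_bound:
  fixes P1 P2 R1 R2 :: "real \<Rightarrow> real"
  assumes \<alpha>: "\<alpha> \<ge> 0" and lr: "l < r" and G: "continuous_on {l..r} G" and k: "k > 0"
    and GM: "\<And>y. y \<in> {l..r} \<Longrightarrow> 0 \<le> G y \<and> G y \<le> 1 / k"
    and P: "continuous_on UNIV P1" "continuous_on UNIV R1" "\<And>x. \<bar>k * x\<bar> \<le> 1 \<Longrightarrow> (P1 x)\<^sup>2 + (R1 x)\<^sup>2 \<le> 1"
     "continuous_on UNIV P2" "continuous_on UNIV R2" "\<And>x. \<bar>k * x\<bar> \<le> 1 \<Longrightarrow> (P2 x)\<^sup>2 + (R2 x)\<^sup>2 \<le> 1"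
    and y: "l \<le> y1" "y1 \<le> y2" "y2 \<le> m" "m \<le> y3" "y3 \<le> y4" "y4 \<le> r"
  shows "ereal (integral {l..r} (\<lambda>y. 2 * k * G y) + (vint \<alpha> (G l) - qint \<alpha> k (G l)) + 2 * qint \<alpha> k (G m)
      + (vint \<alpha> (G r) - qint \<alpha> k (G r))
      + layer_gain \<alpha> k (-1) G P1 R1 y1 y2
      + layer_gain \<alpha> k 1 G P2 R2 y3 y4)
    \<le> grushin_perimeter \<alpha> (strip G l r)"
proof -
  define A where "A = (\<lambda>i::nat. if i = 0 then (\<lambda>_. 0) else if i = 2 then P1 else if i = 5 then P2 else if i \<ge> 7 then (\<lambda>_. 0) else (\<lambda>x. k * x))"
  define B where "B = (\<lambda>i::nat. if i = 0 then (\<lambda>_. -1) else if i = 1 \<or> i = 3 then (\<lambda>x. - calib_cos k x) else if i = 2 then R1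
     else if i = 5 then R2 else if i \<ge> 7 then (\<lambda>_. 1) else calib_cos k)"
  define c where "c = (\<lambda>i::nat. if i = 0 then l else if i = 1 then y1 else if i = 2 then y2 else if i = 3 then m
     else if i = 4 then y3 else if i = 5 then y4 else r)"
  have "ereal (calib_value \<alpha> G l r 7 c A B) \<le> grushin_perimeter \<alpha> (strip G l r)"
  proof (rule calibration_lower_bound_closed[OF \<alpha> lr G GM])
    show "continuous_on UNIV (A i)" "continuous_on UNIV (B i)" for i
      using P by (auto simp: A_def B_def continuous_calib_cos intro!: continuous_intros)
    show "(A i x)\<^sup>2 + (B i x)\<^sup>2 \<le> 1" if "x \<in> {- (1 / k)..1 / k}" for i x
    proof -
      have "\<bar>x\<bar> \<le> 1 / k" using that by auto
      then have "\<bar>k * x\<bar> \<le> 1" using k by (simp add: abs_mult field_simps)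
      then show ?thesis using P(3,6) calib_cos_sq[of k x] by (simp add: A_def B_def)
    qed
    show "l \<le> c i \<and> c i \<le> r" for i using y lr by (auto simp: c_def)
    show "c i \<le> c (Suc i)" if "Suc i < 7" for i using y lr that by (auto simp: c_def)
  qed
  also have "calib_value \<alpha> G l r 7 c A B =
      (integral {l..r} (\<lambda>y. 2 * k * G y) + (vint \<alpha> (G l) - qint \<alpha> k (G l)) + 2 * qint \<alpha> k (G m)
      + (vint \<alpha> (G r) - qint \<alpha> k (G r))
      + layer_gain \<alpha> k (-1) G P1 R1 y1 y2
      + layer_gain \<alpha> k 1 G P2 R2 y3 y4)"
  proof -
    have o: "odd_diff (\<lambda>_. 0) s = 0" "odd_diff (\<lambda>x. k * x) s = 2 * k * s" for s
      by (simp_all add: odd_diff_def)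
    have cI: "continuous_on {a..r} (\<lambda>y. odd_diff h (G y) - 2 * k * G y)" if "l \<le> a" "continuous_on UNIV h" for a h
    proof -
      have "continuous_on {a..r} G" using that by (intro continuous_on_subset[OF G]) auto
      then show ?thesis unfolding odd_diff_def
        by (intro continuous_intros continuous_on_compose2[OF that(2)]) auto
    qed
    have sp: "integral {a..r} (\<lambda>y. odd_diff h (G y) - 2 * k * G y) + integral {b..r} (\<lambda>y. 2 * k * G y - odd_diff h (G y))
       = integral {a..b} (\<lambda>y. odd_diff h (G y) - 2 * k * G y)" if "l \<le> a" "a \<le> b" "b \<le> r" "continuous_on UNIV h" for a b h
    proof -
      have "integral {b..r} (\<lambda>y. 2 * k * G y - odd_diff h (G y)) = - integral {b..r} (\<lambda>y. odd_diff h (G y) - 2 * k * G y)"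
        by (subst integral_neg[symmetric]) simp
      then show ?thesis
        using Henstock_Kurzweil_Integration.integral_combine[OF that(2,3) integrable_continuous_real[OF cI[OF that(1,4)]]]
        by simp
    qed
    show ?thesis
      unfolding calib_value_def
      using sp[of y1 y2 P1] sp[of y3 y4 P2] P y
      by (simp add: A_def B_def c_def eval_nat_numeral lessThan_Suc o wint_minus wint_neg1 layer_gain_def)
  qed
  finally show ?thesis .
qed

text \<open>For the whole set the calibration of the upper half is reflected, so that the field turns
  at the height \<open>0\<close> too.\<close>

lemma sym_strip_lower_bound:
  assumes \<alpha>: "\<alpha> \<ge> 0" and r: "0 < r" and g: "continuous_on {0..r} g" and k: "k > 0"
    and gM: "\<And>y. y \<in> {0..r} \<Longrightarrow> 0 \<le> g y \<and> g y \<le> 1 / k" and m: "m \<in> {0..r}"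
  shows "ereal (integral {-r..r} (\<lambda>y. 2 * k * g \<bar>y\<bar>) + 2 * (vint \<alpha> (g r) - qint \<alpha> k (g r)) + 4 * qint \<alpha> k (g m) - 2 * qint \<alpha> k (g 0))
    \<le> grushin_perimeter \<alpha> (strip (\<lambda>y. g \<bar>y\<bar>) (-r) r)"
proof -
  let ?G = "\<lambda>y. g \<bar>y\<bar>"
  define A where "A = (\<lambda>i::nat. if i = 0 \<or> i \<ge> 5 then (\<lambda>_. 0) else (\<lambda>x. k * x))"
  define B where "B = (\<lambda>i::nat. if i = 0 then (\<lambda>_. -1) else if i = 1 \<or> i = 3 then (\<lambda>x. - calib_cos k x) else if i \<ge> 5 then (\<lambda>_. 1) else calib_cos k)"
  define c where "c = (\<lambda>i::nat. if i = 0 then -r else if i = 1 then -m else if i = 2 then 0 else if i = 3 then m else r)"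
  have "ereal (calib_value \<alpha> ?G (-r) r 5 c A B) \<le> grushin_perimeter \<alpha> (strip ?G (-r) r)"
  proof (rule calibration_lower_bound_closed[OF \<alpha> _ sym_profile_continuous[OF g]])
    show "0 \<le> g \<bar>y\<bar> \<and> g \<bar>y\<bar> \<le> 1 / k" if "y \<in> {-r..r}" for y using that by (intro gM) auto
    show "continuous_on UNIV (A i)" "continuous_on UNIV (B i)" for i
      by (auto simp: A_def B_def continuous_calib_cos intro!: continuous_intros)
    show "(A i x)\<^sup>2 + (B i x)\<^sup>2 \<le> 1" if "x \<in> {- (1 / k)..1 / k}" for i x
    proof -
      have "\<bar>x\<bar> \<le> 1 / k" using that by auto
      then have "\<bar>k * x\<bar> \<le> 1" using k by (simp add: abs_mult field_simps)
      then show ?thesis using calib_cos_sq[of k x] by (simp add: A_def B_def)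
    qed
    show "- r \<le> c i \<and> c i \<le> r" for i using m r by (auto simp: c_def)
    show "c i \<le> c (Suc i)" if "Suc i < 5" for i using m r that by (auto simp: c_def)
  qed (use r in auto)
  also have "calib_value \<alpha> ?G (-r) r 5 c A B =
    (integral {-r..r} (\<lambda>y. 2 * k * g \<bar>y\<bar>) + 2 * (vint \<alpha> (g r) - qint \<alpha> k (g r)) + 4 * qint \<alpha> k (g m) - 2 * qint \<alpha> k (g 0))"
  proof -
    have o: "odd_diff (\<lambda>_. 0) s = 0" "odd_diff (\<lambda>x. k * x) s = 2 * k * s" for s
      by (simp_all add: odd_diff_def)
    show ?thesis unfolding calib_value_def using m r
      by (simp add: A_def B_def c_def eval_nat_numeral lessThan_Suc o wint_minus wint_neg1)
  qed
  finally show ?thesis .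
qed

text \<open>On the layer \<open>[a, b]\<close> the field \<open>(k x, \<tau> calib_cos k x)\<close> is rotated by the angle \<open>e x\<close>. If no
  \<open>e\<close> gains anything over \<open>e = 0\<close>, the derivative at \<open>e = 0\<close> vanishes; this is the
  Euler-Lagrange equation of the profile, integrated over the layer.\<close>

lemma rotation_gain_deriv:
  fixes \<tau> a b :: real
  assumes \<alpha>: "\<alpha> \<ge> 0" and G: "continuous_on {a..b} G" and G0: "\<And>y. y \<in> {a..b} \<Longrightarrow> 0 \<le> G y" and ab: "a \<le> b"
    and max: "\<And>e. layer_gain \<alpha> k \<tau> G (\<lambda>x. k * x * cos (e * x) - \<tau> * calib_cos k x * sin (e * x))
       (\<lambda>x. \<tau> * calib_cos k x * cos (e * x) + k * x * sin (e * x)) a b \<le> 0"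
  shows "wint \<alpha> (\<lambda>x. k * x\<^sup>2) (G b) - wint \<alpha> (\<lambda>x. k * x\<^sup>2) (G a) = - 2 * \<tau> * integral {a..b} (\<lambda>y. G y * calib_cos k (G y))"
proof -
  let ?A = "\<lambda>e x. k * x * cos (e * x) - \<tau> * calib_cos k x * sin (e * x)"
  let ?B = "\<lambda>e x. \<tau> * calib_cos k x * cos (e * x) + k * x * sin (e * x)"
  note [continuous_intros] = continuous_on_compose2[OF continuous_calib_cos[of UNIV]]
    continuous_on_compose2[OF continuous_weight[OF \<alpha>, of UNIV]]
  have odd: "odd_diff (?A e) s = 2 * ?A e s" for e s by (simp add: odd_diff_def calib_cos_minus)
  have W: "((\<lambda>e. wint \<alpha> (?B e) s) has_real_derivative wint \<alpha> (\<lambda>x. k * x\<^sup>2) s) (at 0)" for s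
  proof -
    have "((\<lambda>e. integral (cbox (-s) s) (\<lambda>x. weight \<alpha> x * ?B e x)) has_real_derivative
       integral (cbox (-s) s) (\<lambda>x. weight \<alpha> x * (- (\<tau> * calib_cos k x * x * sin (0 * x)) + k * x * x * cos (0 * x)))) (at 0 within UNIV)"
    proof (rule leibniz_rule_field_derivative)
      show "((\<lambda>e. weight \<alpha> x * ?B e x) has_real_derivative weight \<alpha> x * (- (\<tau> * calib_cos k x * x * sin (e * x)) + k * x * x * cos (e * x))) (at e within UNIV)" for e x
        by (auto intro!: derivative_eq_intros simp: algebra_simps)
      show "(\<lambda>x. weight \<alpha> x * ?B e x) integrable_on cbox (-s) s" for e
        by (intro integrable_continuous continuous_intros) auto
      show "continuous_on (UNIV \<times> cbox (- s) s) (\<lambda>(e, x). weight \<alpha> x * (- (\<tau> * calib_cos k x * x * sin (e * x)) + k * x * x * cos (e * x)))"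
        unfolding split_def by (intro continuous_intros) auto
    qed auto
    then show ?thesis by (simp add: wint_weight cbox_interval power2_eq_square mult.assoc)
  qed
  have I: "((\<lambda>e. integral {a..b} (\<lambda>y. odd_diff (?A e) (G y) - 2 * k * G y)) has_real_derivative
      - 2 * \<tau> * integral {a..b} (\<lambda>y. G y * calib_cos k (G y))) (at 0)"
  proof -
    have "((\<lambda>e. integral (cbox a b) (\<lambda>y. 2 * ?A e (G y) - 2 * k * G y)) has_real_derivative
       integral (cbox a b) (\<lambda>y. 2 * (- (k * G y * G y * sin (0 * G y)) - \<tau> * calib_cos k (G y) * G y * cos (0 * G y)))) (at 0 within UNIV)"
    proof (rule leibniz_rule_field_derivative)
      show "((\<lambda>e. 2 * ?A e (G y) - 2 * k * G y) has_real_derivative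
         2 * (- (k * G y * G y * sin (e * G y)) - \<tau> * calib_cos k (G y) * G y * cos (e * G y))) (at e within UNIV)" for e y
        by (auto intro!: derivative_eq_intros simp: algebra_simps)
      show "(\<lambda>y. 2 * ?A e (G y) - 2 * k * G y) integrable_on cbox a b" for e
        unfolding box_real(2) by (intro integrable_continuous_real continuous_intros G) auto
      show "continuous_on (UNIV \<times> cbox a b) (\<lambda>(e, y). 2 * (- (k * G y * G y * sin (e * G y)) - \<tau> * calib_cos k (G y) * G y * cos (e * G y)))"
        unfolding split_def by (intro continuous_intros continuous_on_compose2[OF G]) auto
    qed auto
    moreover have "integral {a..b} (\<lambda>y. 2 * (- (k * G y * G y * sin (0 * G y)) - \<tau> * calib_cos k (G y) * G y * cos (0 * G y)))
       = - 2 * \<tau> * integral {a..b} (\<lambda>y. G y * calib_cos k (G y))"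
      unfolding integral_mult_right[symmetric] by (rule integral_cong) simp
    ultimately show ?thesis unfolding odd by (simp only: box_real(2))
  qed
  let ?F = "\<lambda>e. integral {a..b} (\<lambda>y. odd_diff (?A e) (G y) - 2 * k * G y)
          + (wint \<alpha> (?B e) (G a) - \<tau> * qint \<alpha> k (G a)) - (wint \<alpha> (?B e) (G b) - \<tau> * qint \<alpha> k (G b))"
  have F: "(?F has_real_derivative (- 2 * \<tau> * integral {a..b} (\<lambda>y. G y * calib_cos k (G y))
      + (wint \<alpha> (\<lambda>x. k * x\<^sup>2) (G a) - 0) - (wint \<alpha> (\<lambda>x. k * x\<^sup>2) (G b) - 0))) (at 0)"
    by (intro DERIV_add DERIV_diff I W DERIV_const)
  have "wint \<alpha> (\<lambda>x. \<tau> * calib_cos k x) s = \<tau> * qint \<alpha> k s" for s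
    by (simp add: wint_def mult.left_commute)
  then have F0: "?F 0 = 0" by (simp add: odd_diff_def)
  have "- 2 * \<tau> * integral {a..b} (\<lambda>y. G y * calib_cos k (G y))
      + (wint \<alpha> (\<lambda>x. k * x\<^sup>2) (G a) - 0) - (wint \<alpha> (\<lambda>x. k * x\<^sup>2) (G b) - 0) = 0"
    by (rule DERIV_local_max[OF F, of 1]) (use max F0 in \<open>auto simp: layer_gain_def\<close>)
  then show ?thesis by linarith
qed

lemma rotated_unit:
  assumes "\<bar>k * x\<bar> \<le> 1" "\<tau>\<^sup>2 = (1::real)"
  shows "(k * x * cos t - \<tau> * calib_cos k x * sin t)\<^sup>2 + (\<tau> * calib_cos k x * cos t + k * x * sin t)\<^sup>2 \<le> 1"
proof -
  have "(k * x * cos t - \<tau> * calib_cos k x * sin t)\<^sup>2 + (\<tau> * calib_cos k x * cos t + k * x * sin t)\<^sup>2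
     = ((k * x)\<^sup>2 + \<tau>\<^sup>2 * (calib_cos k x)\<^sup>2) * ((sin t)\<^sup>2 + (cos t)\<^sup>2)"
    by algebra
  also have "\<dots> = 1" using assms by (simp add: calib_cos_sq)
  finally show ?thesis by simp
qed

section \<open>The constants of the calibration\<close>

lemma wint_deriv:
  assumes "\<alpha> \<ge> 0" "continuous_on UNIV B" "s > 0"
  shows "(wint \<alpha> B has_real_derivative weight \<alpha> s * (B s + B (- s))) (at s)"
proof -
  have "continuous_on UNIV (\<lambda>z :: real \<times> real. B (fst z))"
    by (intro continuous_on_compose2[OF assms(2)] continuous_intros) auto
  from flux_deriv_s[OF assms(1) this assms(3), of 0] show ?thesis by (simp add: flux_def)
qed

lemma weight_pos: "x \<noteq> 0 \<Longrightarrow> weight \<alpha> x > 0" by (simp add: weight_def)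

lemma weight_scale: "k > 0 \<Longrightarrow> weight \<alpha> (k * x) = k powr \<alpha> * weight \<alpha> x"
  by (simp add: weight_def abs_mult powr_mult)

lemma wint_scale:
  assumes "k > 0" "s \<ge> 0"
  shows "wint \<alpha> (\<lambda>x. B (k * x)) s = wint \<alpha> B (k * s) / k powr (\<alpha> + 1)"
proof -
  have "wint \<alpha> B (k * s) = k * s * integral {-1..1} (\<lambda>z. k powr \<alpha> * (weight \<alpha> (s * z) * B (k * (s * z))))"
    using assms by (simp add: wint_scaled weight_scale mult.assoc)
  also have "\<dots> = k powr (\<alpha> + 1) * (s * integral {-1..1} (\<lambda>z. weight \<alpha> (s * z) * B (k * (s * z))))"
    using assms(1) by (simp add: powr_add mult_ac)
  also have "s * integral {-1..1} (\<lambda>z. weight \<alpha> (s * z) * B (k * (s * z))) = wint \<alpha> (\<lambda>x. B (k * x)) s"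
    by (simp add: wint_scaled[OF assms(2)])
  finally show ?thesis using assms(1) by simp
qed

lemma qint_scale: "k > 0 \<Longrightarrow> s \<ge> 0 \<Longrightarrow> qint \<alpha> k s = qint \<alpha> 1 (k * s) / k powr (\<alpha> + 1)"
  using wint_scale[of k s \<alpha> "calib_cos 1"] by (simp add: calib_cos_def[abs_def])

lemma vint_scale: "k > 0 \<Longrightarrow> s \<ge> 0 \<Longrightarrow> vint \<alpha> s = vint \<alpha> (k * s) / k powr (\<alpha> + 1)"
  using wint_scale[of k s \<alpha> "\<lambda>_. 1"] by simp

lemma wint_0: "wint \<alpha> B 0 = 0" by (simp add: wint_def)

lemma vint_value:
  assumes "\<alpha> \<ge> 0" "s \<ge> 0" shows "vint \<alpha> s = 2 * s powr (\<alpha> + 1) / (\<alpha> + 1)"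
proof (cases "s = 0")
  case True then show ?thesis by (simp add: wint_0)
next
  case False
  have "((\<lambda>x. 2 * weight \<alpha> x) has_integral vint \<alpha> s - vint \<alpha> 0) {0..s}"
    using assms(2) by (intro fundamental_theorem_of_calculus_interior continuous_wint assms(1) continuous_intros)
      (use wint_deriv[OF assms(1), of "\<lambda>_. 1"] in \<open>auto simp: has_real_derivative_iff_has_vector_derivative mult.commute\<close>)
  moreover have "((\<lambda>x. 2 * weight \<alpha> x) has_integral 2 * (s powr (\<alpha> + 1) / (\<alpha> + 1))) {0..s}"
  proof (rule has_integral_mult_right)
    have "((\<lambda>x. x powr \<alpha>) has_integral s powr (\<alpha> + 1) / (\<alpha> + 1)) {0..s}"
      using has_integral_powr_from_0[of \<alpha> s] assms by simp
    then show "(weight \<alpha> has_integral s powr (\<alpha> + 1) / (\<alpha> + 1)) {0..s}"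
      by (rule has_integral_spike_finite[of "{0}", rotated -1]) (auto simp: weight_eq)
  qed
  ultimately show ?thesis by (auto simp: wint_0 dest: has_integral_unique)
qed

lemma calib_cos_1_sin: "calib_cos 1 (sin t) = \<bar>cos t\<bar>"
proof -
  have "1 - (sin t)\<^sup>2 = (cos t)\<^sup>2" by (simp add: cos_squared_eq)
  then show ?thesis by (simp add: calib_cos_def)
qed

lemma continuous_wint1: "\<alpha> \<ge> 0 \<Longrightarrow> continuous_on UNIV B \<Longrightarrow> continuous_on S u \<Longrightarrow> (\<And>t. t \<in> S \<Longrightarrow> 0 \<le> u t \<and> u t \<le> 1) \<Longrightarrow> continuous_on S (\<lambda>t. wint \<alpha> B (u t))"
  by (rule continuous_on_compose2[OF continuous_wint[of \<alpha> B 1]]) auto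

text \<open>The flux of the calibrating field, expressed in the parameter \<open>t\<close>. The sign \<open>\<sigma>\<close> is that of the
  cosine on the interval.\<close>

lemma qint_sin_integral:
  assumes \<alpha>: "\<alpha> \<ge> 0" and ab: "0 \<le> a" "a \<le> b" "b \<le> pi" and \<sigma>: "\<And>t. t \<in> {a<..<b} \<Longrightarrow> \<bar>cos t\<bar> = \<sigma> * cos t" "\<sigma>\<^sup>2 = 1"
  shows "((\<lambda>t. weight \<alpha> (sin t) * (cos t)\<^sup>2) has_integral \<sigma> * (qint \<alpha> 1 (sin b) - qint \<alpha> 1 (sin a)) / 2) {a..b}"
proof -
  have "((\<lambda>t. weight \<alpha> (sin t) * (cos t)\<^sup>2) has_integral \<sigma> / 2 * qint \<alpha> 1 (sin b) - \<sigma> / 2 * qint \<alpha> 1 (sin a)) {a..b}"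
  proof (rule fundamental_theorem_of_calculus_interior[OF ab(2)])
    show "continuous_on {a..b} (\<lambda>t. \<sigma> / 2 * qint \<alpha> 1 (sin t))"
      using ab by (intro continuous_intros continuous_wint1 \<alpha> continuous_calib_cos) (auto intro: sin_ge_zero)
    show "((\<lambda>t. \<sigma> / 2 * qint \<alpha> 1 (sin t)) has_vector_derivative weight \<alpha> (sin t) * (cos t)\<^sup>2) (at t)" if t: "t \<in> {a<..<b}" for t
    proof -
      have "sin t > 0" using t ab by (intro sin_gt_zero) auto
      from DERIV_chain2[OF wint_deriv[OF \<alpha> continuous_calib_cos this] DERIV_sin]
      have "((\<lambda>t. qint \<alpha> 1 (sin t)) has_real_derivative weight \<alpha> (sin t) * (calib_cos 1 (sin t) + calib_cos 1 (- sin t)) * cos t) (at t)" .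
      from DERIV_cmult[OF this, of "\<sigma> / 2"]
      have "((\<lambda>t. \<sigma> / 2 * qint \<alpha> 1 (sin t)) has_real_derivative \<sigma> / 2 * (weight \<alpha> (sin t) * (calib_cos 1 (sin t) + calib_cos 1 (- sin t)) * cos t)) (at t)" .
      also have "\<sigma> / 2 * (weight \<alpha> (sin t) * (calib_cos 1 (sin t) + calib_cos 1 (- sin t)) * cos t) = weight \<alpha> (sin t) * (\<sigma>\<^sup>2 * (cos t)\<^sup>2)"
        unfolding calib_cos_minus calib_cos_1_sin \<sigma>(1)[OF t] by (simp add: power2_eq_square)
      finally show ?thesis by (simp add: \<sigma> has_real_derivative_iff_has_vector_derivative)
    qed
  qed
  then show ?thesis by (simp add: algebra_simps diff_divide_distrib)
qed

text \<open>Integration by parts for \<open>sin t powr (\<alpha> + 1) * cos t\<close>.\<close>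

lemma sin_power_parts:
  assumes \<alpha>: "\<alpha> \<ge> 0" and ab: "0 \<le> a" "a \<le> b" "b \<le> pi"
    and I: "((\<lambda>t. weight \<alpha> (sin t) * (cos t)\<^sup>2) has_integral I) {a..b}"
  shows "((\<lambda>t. sin t powr (\<alpha> + 2)) has_integral (\<alpha> + 1) * I + sin a powr (\<alpha> + 1) * cos a - sin b powr (\<alpha> + 1) * cos b) {a..b}"
proof -
  have "((\<lambda>t. sin t powr (\<alpha> + 2) - (\<alpha> + 1) * (weight \<alpha> (sin t) * (cos t)\<^sup>2)) has_integral
     - (sin b powr (\<alpha> + 1) * cos b) - - (sin a powr (\<alpha> + 1) * cos a)) {a..b}"
  proof (rule fundamental_theorem_of_calculus_interior[OF ab(2)])
    show "continuous_on {a..b} (\<lambda>t. - (sin t powr (\<alpha> + 1) * cos t))"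
      using ab \<alpha> by (intro continuous_intros continuous_on_subset[OF sine_powr_continuous]) auto
    show "((\<lambda>t. - (sin t powr (\<alpha> + 1) * cos t)) has_vector_derivative sin t powr (\<alpha> + 2) - (\<alpha> + 1) * (weight \<alpha> (sin t) * (cos t)\<^sup>2)) (at t)" if t: "t \<in> {a<..<b}" for t
    proof -
      have s: "sin t > 0" using t ab by (intro sin_gt_zero) auto
      have "((\<lambda>t. sin t powr (\<alpha> + 1)) has_real_derivative (\<alpha> + 1) * sin t powr (\<alpha> + 1 - 1) * cos t) (at t)"
        using DERIV_fun_powr[OF DERIV_sin s, of "\<alpha> + 1"] by simp
      from DERIV_minus[OF DERIV_mult[OF this DERIV_cos]]
      have "((\<lambda>t. - (sin t powr (\<alpha> + 1) * cos t)) has_real_derivative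
         - ((\<alpha> + 1) * sin t powr (\<alpha> + 1 - 1) * cos t * cos t + - sin t * sin t powr (\<alpha> + 1))) (at t)" .
      also have "- ((\<alpha> + 1) * sin t powr (\<alpha> + 1 - 1) * cos t * cos t + - sin t * sin t powr (\<alpha> + 1)) =
         sin t powr (\<alpha> + 2) - (\<alpha> + 1) * (weight \<alpha> (sin t) * (cos t)\<^sup>2)"
        using s powr_add[of "sin t" "\<alpha> + 1" 1] by (simp add: weight_eq power2_eq_square algebra_simps)
      finally show ?thesis by (simp add: has_real_derivative_iff_has_vector_derivative)
    qed
  qed
  from has_integral_add[OF this has_integral_mult_right[OF I, of "\<alpha> + 1"]]
  show ?thesis by (simp add: algebra_simps)
qed

lemma sin_power_split:
  assumes \<alpha>: "\<alpha> \<ge> 0" and ab: "0 \<le> a" "b \<le> pi"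
    and I: "((\<lambda>t. weight \<alpha> (sin t) * (cos t)\<^sup>2) has_integral I) {a..b}"
    and J: "((\<lambda>t. sin t powr (\<alpha> + 2)) has_integral J) {a..b}"
  shows "integral {a..b} (\<lambda>t. sin t powr \<alpha>) = I + J"
proof (rule integral_unique)
  show "((\<lambda>t. sin t powr \<alpha>) has_integral I + J) {a..b}"
  proof (rule has_integral_spike_finite[OF _ _ has_integral_add[OF I J], of "{0, pi}"])
    fix t assume "t \<in> {a..b} - {0, pi}"
    then have s: "sin t > 0" using ab by (intro sin_gt_zero) auto
    have "weight \<alpha> (sin t) * (cos t)\<^sup>2 + sin t powr (\<alpha> + 2) = sin t powr \<alpha> * ((cos t)\<^sup>2 + (sin t)\<^sup>2)"
      unfolding distrib_left using s by (simp add: weight_eq powr_add)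
    then show "sin t powr \<alpha> = weight \<alpha> (sin t) * (cos t)\<^sup>2 + sin t powr (\<alpha> + 2)" by simp
  qed auto
qed

text \<open>The integral of \<open>sin t powr \<alpha> * (cos t)\<^sup>2\<close> over \<open>[pi / 3, pi]\<close>; see \<open>cos_integrals\<close>.\<close>

definition upper_cos_int :: "real \<Rightarrow> real" where
  "upper_cos_int \<alpha> = qint \<alpha> 1 1 - qint \<alpha> 1 (sqrt 3 / 2) / 2"

text \<open>Half of the area of the upper half of the undilated candidate.\<close>

definition upper_area :: "real \<Rightarrow> real" where
  "upper_area \<alpha> = integral {pi/3..pi} (\<lambda>t. sin t powr (\<alpha> + 2))"

lemma cos_integrals:
  assumes \<alpha>: "\<alpha> \<ge> 0"
  shows "((\<lambda>t. weight \<alpha> (sin t) * (cos t)\<^sup>2) has_integral upper_cos_int \<alpha>) {pi/3..pi}"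
    and "((\<lambda>t. weight \<alpha> (sin t) * (cos t)\<^sup>2) has_integral qint \<alpha> 1 1) {0..pi}"
proof -
  have c: "\<bar>cos t\<bar> = 1 * cos t" if "t \<in> {0<..<pi/2}" for t
    using that cos_gt_zero[of t] by auto
  have d: "\<bar>cos t\<bar> = -1 * cos t" if "t \<in> {pi/2<..<pi}" for t
    using that cos_lt_zero_pi[of t] by auto
  have r: "((\<lambda>t. weight \<alpha> (sin t) * (cos t)\<^sup>2) has_integral qint \<alpha> 1 1 / 2) {pi/2..pi}"
    using qint_sin_integral[OF \<alpha>, of "pi/2" pi "-1"] d by (simp add: wint_0)
  have l: "((\<lambda>t. weight \<alpha> (sin t) * (cos t)\<^sup>2) has_integral (qint \<alpha> 1 1 - qint \<alpha> 1 (sqrt 3 / 2)) / 2) {pi/3..pi/2}"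
    using qint_sin_integral[OF \<alpha>, of "pi/3" "pi/2" 1] c by (simp add: sin_third_values)
  have l0: "((\<lambda>t. weight \<alpha> (sin t) * (cos t)\<^sup>2) has_integral qint \<alpha> 1 1 / 2) {0..pi/2}"
    using qint_sin_integral[OF \<alpha>, of 0 "pi/2" 1] c by (simp add: wint_0)
  show "((\<lambda>t. weight \<alpha> (sin t) * (cos t)\<^sup>2) has_integral upper_cos_int \<alpha>) {pi/3..pi}"
    using has_integral_combine[OF _ _ l r] by (simp add: upper_cos_int_def field_simps)
  show "((\<lambda>t. weight \<alpha> (sin t) * (cos t)\<^sup>2) has_integral qint \<alpha> 1 1) {0..pi}"
    using has_integral_combine[OF _ _ l0 r] by simp
qed

lemma upper_area_eq:
  assumes \<alpha>: "\<alpha> \<ge> 0"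
  shows "upper_area \<alpha> = (\<alpha> + 1) * upper_cos_int \<alpha> + (sqrt 3 / 2) powr (\<alpha> + 1) / 2"
    and "integral {pi/3..pi} (\<lambda>t. sin t powr \<alpha>) = upper_cos_int \<alpha> + upper_area \<alpha>"
    and "integral {0..pi} (\<lambda>t. sin t powr \<alpha>) = qint \<alpha> 1 1 + integral {0..pi} (\<lambda>t. sin t powr (\<alpha> + 2))"
proof -
  have c: "cos (pi / 3) = 1 / 2" by (rule cos_60)
  have W: "((\<lambda>t. sin t powr (\<alpha> + 2)) has_integral (\<alpha> + 1) * upper_cos_int \<alpha> + (sqrt 3 / 2) powr (\<alpha> + 1) / 2) {pi/3..pi}"
    using sin_power_parts[OF \<alpha> _ _ _ cos_integrals(1)[OF \<alpha>]] by (simp add: sin_third_values c)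
  then show 1: "upper_area \<alpha> = (\<alpha> + 1) * upper_cos_int \<alpha> + (sqrt 3 / 2) powr (\<alpha> + 1) / 2"
    by (simp add: upper_area_def integral_unique)
  show "integral {pi/3..pi} (\<lambda>t. sin t powr \<alpha>) = upper_cos_int \<alpha> + upper_area \<alpha>"
    using sin_power_split[OF \<alpha> _ _ cos_integrals(1)[OF \<alpha>] W] by (simp add: 1)
  have W0: "((\<lambda>t. sin t powr (\<alpha> + 2)) has_integral (\<alpha> + 1) * qint \<alpha> 1 1) {0..pi}"
    using sin_power_parts[OF \<alpha> _ _ _ cos_integrals(2)[OF \<alpha>]] \<alpha> by simp
  show "integral {0..pi} (\<lambda>t. sin t powr \<alpha>) = qint \<alpha> 1 1 + integral {0..pi} (\<lambda>t. sin t powr (\<alpha> + 2))"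
    using sin_power_split[OF \<alpha> _ _ cos_integrals(2)[OF \<alpha>] W0] W0 by (simp add: integral_unique)
qed

lemma upper_area_pos:
  assumes \<alpha>: "\<alpha> \<ge> 0" shows "upper_area \<alpha> > 0"
proof -
  have "upper_cos_int \<alpha> \<ge> 0"
    by (rule has_integral_nonneg[OF cos_integrals(1)[OF \<alpha>]]) (simp add: weight_nonneg)
  then show ?thesis unfolding upper_area_eq(1)[OF \<alpha>] using \<alpha> by (intro add_nonneg_pos) auto
qed

text \<open>The part of the bound that depends on \<open>g 0\<close> is smallest exactly at \<open>k * g 0 = sqrt 3 / 2\<close>: its
  derivative is proportional to \<open>1 - 2 * sqrt (1 - t\<^sup>2)\<close>.\<close>

lemma bottom_cost_min:
  assumes \<alpha>: "\<alpha> \<ge> 0" and t: "t \<in> {0..1}" "t \<noteq> sqrt 3 / 2"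
  shows "vint \<alpha> (sqrt 3 / 2) - 2 * qint \<alpha> 1 (sqrt 3 / 2) < vint \<alpha> t - 2 * qint \<alpha> 1 t"
proof -
  let ?m = "\<lambda>t. vint \<alpha> t - 2 * qint \<alpha> 1 t"
  have a: "sqrt 3 / 2 < 1" "sqrt 3 / 2 > 0" using real_sqrt_less_mono[of 3 4] by auto
  have a2: "(sqrt 3 / 2)\<^sup>2 = 3 / 4" by (simp add: power_divide)
  have d: "(?m has_real_derivative 2 * weight \<alpha> s * (1 - 2 * calib_cos 1 s)) (at s)" if "s > 0" for s
    using DERIV_diff[OF wint_deriv[OF \<alpha> _ that, of "\<lambda>_. 1"] DERIV_cmult[OF wint_deriv[OF \<alpha> continuous_calib_cos that], of 2]]
    by (simp add: calib_cos_minus algebra_simps)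
  have cont: "continuous_on S ?m" if "S \<subseteq> {0..1}" for S
    using that by (intro continuous_intros continuous_wint1 \<alpha> continuous_calib_cos) auto
  have h: "1/2 = sqrt (1/4)" by (simp add: real_sqrt_divide)
  have half: "calib_cos 1 s > 1/2" if "0 < s" "s < sqrt 3 / 2" for s
  proof -
    have "s\<^sup>2 < (sqrt 3 / 2)\<^sup>2" using that by (intro power_strict_mono) auto
    then show ?thesis unfolding a2 calib_cos_def h by simp
  qed
  have half': "calib_cos 1 s < 1/2" if "s > sqrt 3 / 2" for s
  proof -
    have "s\<^sup>2 > (sqrt 3 / 2)\<^sup>2" using that a by (intro power_strict_mono) auto
    then show ?thesis unfolding a2 calib_cos_def h by (auto simp: max_def)
  qed
  show ?thesis
  proof (cases "t < sqrt 3 / 2")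
    case True
    show ?thesis
    proof (rule DERIV_neg_imp_decreasing_open[OF True])
      fix s assume s: "t < s" "s < sqrt 3 / 2"
      then have "s > 0" using t by auto
      moreover have "2 * weight \<alpha> s * (1 - 2 * calib_cos 1 s) < 0"
        using half[of s] s \<open>s > 0\<close> weight_pos[of s \<alpha>] by (intro mult_pos_neg) auto
      ultimately show "\<exists>y. (?m has_real_derivative y) (at s) \<and> y < 0" using d by blast
    qed (use t a in \<open>auto intro!: cont\<close>)
  next
    case False
    then have lt: "sqrt 3 / 2 < t" using t by auto
    show ?thesis
    proof (rule DERIV_pos_imp_increasing_open[OF lt])
      fix s assume s: "sqrt 3 / 2 < s" "s < t"
      then have "s > 0" using a by linarith
      moreover have "2 * weight \<alpha> s * (1 - 2 * calib_cos 1 s) > 0"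
        using half'[of s] s \<open>s > 0\<close> weight_pos[of s \<alpha>] by (intro mult_pos_pos) auto
      ultimately show "\<exists>y. (?m has_real_derivative y) (at s) \<and> y > 0" using d by blast
    next
      show "continuous_on {sqrt 3 / 2..t} ?m"
      proof (rule cont, rule subsetI)
        fix x assume "x \<in> {sqrt 3 / 2..t}"
        then have "sqrt 3 / 2 \<le> x" "x \<le> t" by auto
        then show "x \<in> {0..1}" using a(2) t(1) unfolding atLeastAtMost_iff by linarith
      qed
    qed
  qed
qed

text \<open>The part of the bound that depends on \<open>g r\<close> vanishes only for \<open>g r = 0\<close>.\<close>

lemma top_cost_pos:
  assumes \<alpha>: "\<alpha> \<ge> 0" and t: "t \<in> {0<..1}"
  shows "qint \<alpha> 1 t < vint \<alpha> t"
proof -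
  let ?m = "\<lambda>t. vint \<alpha> t - qint \<alpha> 1 t"
  have d: "(?m has_real_derivative 2 * weight \<alpha> s * (1 - calib_cos 1 s)) (at s)" if "s > 0" for s
    using DERIV_diff[OF wint_deriv[OF \<alpha> _ that, of "\<lambda>_. 1"] wint_deriv[OF \<alpha> continuous_calib_cos that]]
    by (simp add: calib_cos_minus algebra_simps)
  have "?m 0 < ?m t"
  proof (rule DERIV_pos_imp_increasing_open[where f="?m"])
    fix s assume s: "0 < s" "s < t"
    have "calib_cos 1 s < 1" using s by (simp add: calib_cos_def)
    then have "2 * weight \<alpha> s * (1 - calib_cos 1 s) > 0"
      using s weight_pos[of s \<alpha>] by (intro mult_pos_pos) auto
    then show "\<exists>y. (?m has_real_derivative y) (at s) \<and> y > 0" using d s by blast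
  next
    show "continuous_on {0..t} ?m"
      using t by (intro continuous_intros continuous_wint1 \<alpha> continuous_calib_cos) auto
  qed (use t in auto)
  then show ?thesis by (simp add: wint_0)
qed

lemma scale_min:
  fixes x b :: real
  assumes "x > 0" "b > 0" "x \<noteq> 1"
  shows "1 + 1 / b < x + x powr (- b) / b"
proof -
  have "ln x < x - 1" using ln_le_minus_one[OF assms(1)] ln_eq_minus_one[OF assms(1)] assms(3) by fastforce
  then have "1 - b * (x - 1) < 1 - b * ln x" using assms(2) by simp
  also have "\<dots> \<le> x powr (- b)"
    using exp_ge_add_one_self[of "- b * ln x"] assms(1) by (simp add: powr_def)
  finally have "(1 - b * (x - 1)) / b < x powr (- b) / b" using assms(2) by (rule divide_strict_right_mono)
  moreover have "(1 - b * (x - 1)) / b = 1 / b - (x - 1)" using assms(2) by (simp add: field_simps)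
  ultimately show ?thesis by linarith
qed

section \<open>Comparison with the candidate\<close>

lemma arc_area:
  assumes \<alpha>: "\<alpha> \<ge> 0" and h: "h > 0" and ab: "0 \<le> a" "a < b" "b \<le> pi"
  shows "integral {arc_y \<alpha> h k a..arc_y \<alpha> h k b} (\<lambda>y. 2 * arc_profile \<alpha> h k y) = 2 / h powr (\<alpha> + 2) * integral {a..b} (\<lambda>t. sin t powr (\<alpha> + 2))"
proof -
  have sub: "{a..b} \<subseteq> {0..pi}" using ab by auto
  have dY: "(arc_y \<alpha> h k has_real_derivative sin t powr (\<alpha> + 1) / h powr (\<alpha> + 1)) (at t within {a..b})" if "t \<in> {a..b}" for t
  proof -
    have "(sine_int \<alpha> has_real_derivative sin t powr (\<alpha> + 1)) (at t within {a..b})"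
      using that sub by (intro DERIV_subset[OF sine_int_deriv[OF \<alpha>]]) auto
    from DERIV_cdivide[OF DERIV_add[OF DERIV_diff[OF this DERIV_const] DERIV_const], of "sine_int \<alpha> (pi/2)" k "h powr (\<alpha> + 1)"] show ?thesis
      by (simp add: arc_y_def[abs_def] arc_height_def)
  qed
  have mono: "arc_y \<alpha> h k s \<le> arc_y \<alpha> h k t" if "s \<in> {a..b}" "t \<in> {a..b}" "s \<le> t" for s t
    using arc_y_mono[OF \<alpha> h, of s t k] that ab by (cases "s = t") auto
  have "((\<lambda>t. (sin t powr (\<alpha> + 1) / h powr (\<alpha> + 1)) *\<^sub>R (2 * arc_profile \<alpha> h k (arc_y \<alpha> h k t))) has_integral
     integral {arc_y \<alpha> h k a..arc_y \<alpha> h k b} (\<lambda>y. 2 * arc_profile \<alpha> h k y)) {a..b}"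
  proof (rule has_integral_substitution[OF _ _ _ _ dY])
    show "continuous_on {arc_y \<alpha> h k a..arc_y \<alpha> h k b} (\<lambda>y. 2 * arc_profile \<alpha> h k y)"
      using ab by (intro continuous_intros arc_profile_continuous \<alpha> h) auto
  qed (use ab mono in auto)
  then have "((\<lambda>t. 2 / h powr (\<alpha> + 2) * sin t powr (\<alpha> + 2)) has_integral
     integral {arc_y \<alpha> h k a..arc_y \<alpha> h k b} (\<lambda>y. 2 * arc_profile \<alpha> h k y)) {a..b}"
  proof (rule has_integral_eq[rotated])
    fix t assume t: "t \<in> {a..b}"
    have s: "sin t \<ge> 0" using t ab by (intro sin_ge_zero) auto
    have "sin t powr (\<alpha> + 2) = sin t powr (\<alpha> + 1) * sin t"
      using s \<alpha> by (cases "sin t = 0") (auto simp: powr_add power2_eq_square)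
    moreover have "h powr (\<alpha> + 2) = h powr (\<alpha> + 1) * h" using h by (simp add: powr_add power2_eq_square)
    ultimately show "(sin t powr (\<alpha> + 1) / h powr (\<alpha> + 1)) *\<^sub>R (2 * arc_profile \<alpha> h k (arc_y \<alpha> h k t)) = 2 / h powr (\<alpha> + 2) * sin t powr (\<alpha> + 2)"
      using t ab arc_profile_arc_y[OF \<alpha> h, of t k] by simp
  qed
  from integral_unique[OF this] show ?thesis unfolding integral_mult_right by simp
qed

lemma cand_area:
  assumes \<alpha>: "\<alpha> \<ge> 0" and h: "h > 0"
  shows "integral {0..cand_height \<alpha> h} (\<lambda>y. 2 * cand_profile \<alpha> h y) = 2 * upper_area \<alpha> / h powr (\<alpha> + 2)"
  using arc_area[OF \<alpha> h, of "pi/3" pi "offset \<alpha>"]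
  by (simp add: cand_arc_y[OF \<alpha>] cand_profile_def upper_area_def)

text \<open>The double perimeter of the candidate.\<close>

definition cand_value :: "real \<Rightarrow> real \<Rightarrow> real" where
  "cand_value \<alpha> h = (4 * (upper_cos_int \<alpha> + upper_area \<alpha>) + vint \<alpha> (sqrt 3 / 2)) / h powr (\<alpha> + 1)"

lemma cand_upper:
  assumes \<alpha>: "\<alpha> \<ge> 0" and h: "h > 0"
  shows "double_perimeter \<alpha> (y_profile_set (cand_profile \<alpha> h) (cand_height \<alpha> h)) \<le> ereal (cand_value \<alpha> h)"
proof -
  have "vint \<alpha> (sqrt 3 / 2 / h) = vint \<alpha> (sqrt 3 / 2) / h powr (\<alpha> + 1)"
    using vint_scale[OF h, of "sqrt 3 / 2 / h" \<alpha>] h by simp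
  then show ?thesis using cand_double_perimeter[OF \<alpha> h]
    by (simp add: cand_value_def upper_area_eq[OF \<alpha>] add_divide_distrib)
qed

lemma ereal_half_le:
  assumes "ereal a \<le> x" "ereal b \<le> y" "ereal c \<le> z" "ereal (1 / 2) * (x + y + z) \<le> ereal d"
  shows "(a + b + c) / 2 \<le> d"
proof -
  have "ereal (a + b + c) \<le> x + y + z"
    unfolding plus_ereal.simps(1)[symmetric] by (intro add_mono assms)
  then have "ereal (1 / 2) * ereal (a + b + c) \<le> ereal (1 / 2) * (x + y + z)"
    by (intro ereal_mult_left_mono) auto
  also have "\<dots> \<le> ereal d" by (rule assms)
  finally show ?thesis by simp
qed

text \<open>Sum of the calibrations of the upper half, the lower half and the whole set, with \<open>k\<close> the
  reciprocal of the largest half-width. Only the calibration of the upper half is perturbed. The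
  fluxes outside the perturbed layers are rescaled to \<open>k = 1\<close>.\<close>

lemma perturbed_lower_bound:
  fixes P1 P2 R1 R2 :: "real \<Rightarrow> real"
  assumes \<alpha>: "\<alpha> \<ge> 0" and r: "0 < r" and g: "continuous_on {0..r} g" and k: "k > 0"
    and gM: "\<And>y. y \<in> {0..r} \<Longrightarrow> 0 \<le> g y \<and> g y \<le> 1 / k" and m: "m \<in> {0..r}" "g m = 1 / k"
    and v: "integral {0..r} (\<lambda>y. 2 * g y) = v"
    and J: "double_perimeter \<alpha> (y_profile_set g r) \<le> ereal J"
    and P: "continuous_on UNIV P1" "continuous_on UNIV R1" "\<And>x. \<bar>k * x\<bar> \<le> 1 \<Longrightarrow> (P1 x)\<^sup>2 + (R1 x)\<^sup>2 \<le> 1"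
     "continuous_on UNIV P2" "continuous_on UNIV R2" "\<And>x. \<bar>k * x\<bar> \<le> 1 \<Longrightarrow> (P2 x)\<^sup>2 + (R2 x)\<^sup>2 \<le> 1"
    and y: "0 \<le> y1" "y1 \<le> y2" "y2 \<le> m" "m \<le> y3" "y3 \<le> y4" "y4 \<le> r"
  shows "2 * k * v + (4 * qint \<alpha> 1 1 + (vint \<alpha> (k * g 0) - 2 * qint \<alpha> 1 (k * g 0))
       + 2 * (vint \<alpha> (k * g r) - qint \<alpha> 1 (k * g r))) / k powr (\<alpha> + 1)
      + (layer_gain \<alpha> k (-1) g P1 R1 y1 y2
        + layer_gain \<alpha> k 1 g P2 R2 y3 y4) / 2
    \<le> J"
proof -
  let ?gain = "layer_gain \<alpha> k (-1) g P1 R1 y1 y2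
        + layer_gain \<alpha> k 1 g P2 R2 y3 y4"
  let ?E = "\<lambda>s. vint \<alpha> s - qint \<alpha> k s"
  have gi: "g integrable_on {0..r}" by (rule integrable_continuous_real[OF g])
  have kv: "integral {0..r} (\<lambda>y. 2 * k * g y) = k * v"
    unfolding v[symmetric] integral_mult_right[symmetric] by (rule integral_cong) simp
  have cm: "continuous_on {-r..0} (\<lambda>y. g (- y))" by (intro continuous_on_compose2[OF g] continuous_intros) auto
  have kv': "integral {-r..0} (\<lambda>y. 2 * k * g (- y)) = k * v"
    using Henstock_Kurzweil_Integration.integral_reflect_real[of r 0 "\<lambda>y. 2 * k * g y"] kv by (simp only: minus_zero)
  have kv2: "integral {-r..r} (\<lambda>y. 2 * k * g \<bar>y\<bar>) = 2 * k * v"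
  proof -
    have "(\<lambda>y. 2 * k * g \<bar>y\<bar>) integrable_on {-r..r}"
      by (intro integrable_continuous_real continuous_intros sym_profile_continuous g)
    from Henstock_Kurzweil_Integration.integral_combine[OF _ _ this, of 0] r
    have "integral {-r..r} (\<lambda>y. 2 * k * g \<bar>y\<bar>) = integral {-r..0} (\<lambda>y. 2 * k * g \<bar>y\<bar>) + integral {0..r} (\<lambda>y. 2 * k * g \<bar>y\<bar>)" by simp
    also have "integral {-r..0} (\<lambda>y. 2 * k * g \<bar>y\<bar>) = integral {-r..0} (\<lambda>y. 2 * k * g (- y))" by (rule integral_cong) simp
    also have "integral {0..r} (\<lambda>y. 2 * k * g \<bar>y\<bar>) = integral {0..r} (\<lambda>y. 2 * k * g y)" by (rule integral_cong) simp
    finally show ?thesis using kv kv' by linarith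
  qed
  have B1: "ereal (k * v + ?E (g 0) + 2 * qint \<alpha> k (g m) + ?E (g r) + ?gain) \<le> grushin_perimeter \<alpha> (strip g 0 r)"
    using strip_lower_bound[OF \<alpha> r g k gM P y] unfolding kv by (simp only: add.assoc)
  have u: "(k * x)\<^sup>2 + (- calib_cos k x)\<^sup>2 \<le> 1" "(k * x)\<^sup>2 + (calib_cos k x)\<^sup>2 \<le> 1" if "\<bar>k * x\<bar> \<le> 1" for x
    using calib_cos_sq[OF that] by simp_all
  have cl: "continuous_on UNIV (\<lambda>x. k * x)" "continuous_on UNIV (\<lambda>x. - calib_cos k x)"
    by (intro continuous_intros continuous_calib_cos)+
  have gM': "0 \<le> g (- y) \<and> g (- y) \<le> 1 / k" if "y \<in> {-r..0}" for y using that by (intro gM) auto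
  have mr: "-r \<le> -m" "-m \<le> 0" using m by auto
  have B2: "ereal (k * v + ?E (g 0) + 2 * qint \<alpha> k (g m) + ?E (g r)) \<le> grushin_perimeter \<alpha> (strip (\<lambda>y. g (- y)) (-r) 0)"
    using strip_lower_bound[OF \<alpha> _ cm k gM' cl u(1) cl(1) continuous_calib_cos u(2) mr(1) order_refl order_refl order_refl order_refl mr(2)] r
    unfolding kv' by (simp add: algebra_simps wint_minus layer_gain_def)
  have B3: "ereal (2 * k * v + 2 * ?E (g r) + 4 * qint \<alpha> k (g m) - 2 * qint \<alpha> k (g 0)) \<le> grushin_perimeter \<alpha> (strip (\<lambda>y. g \<bar>y\<bar>) (-r) r)"
    using sym_strip_lower_bound[OF \<alpha> r g k gM m(1)] unfolding kv2 .
  have "((k * v + ?E (g 0) + 2 * qint \<alpha> k (g m) + ?E (g r) + ?gain) + (k * v + ?E (g 0) + 2 * qint \<alpha> k (g m) + ?E (g r))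
     + (2 * k * v + 2 * ?E (g r) + 4 * qint \<alpha> k (g m) - 2 * qint \<alpha> k (g 0))) / 2 \<le> J"
    by (rule ereal_half_le[OF B1 B2 B3]) (use J double_perimeter_profile_set[OF r g, of \<alpha>] in simp)
  moreover have g0: "0 \<le> g 0" "0 \<le> g r" using gM[of 0] gM[of r] r by auto
  have "qint \<alpha> k (g m) = qint \<alpha> 1 1 / k powr (\<alpha> + 1)" using qint_scale[OF k, of "g m" \<alpha>] m k by simp
  moreover have "vint \<alpha> (g 0) = vint \<alpha> (k * g 0) / k powr (\<alpha> + 1)" "vint \<alpha> (g r) = vint \<alpha> (k * g r) / k powr (\<alpha> + 1)"
    using vint_scale[OF k] g0 by auto
  moreover have "qint \<alpha> k (g 0) = qint \<alpha> 1 (k * g 0) / k powr (\<alpha> + 1)" "qint \<alpha> k (g r) = qint \<alpha> 1 (k * g r) / k powr (\<alpha> + 1)"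
    using qint_scale[OF k] g0 by auto
  ultimately show ?thesis by (simp add: add_divide_distrib diff_divide_distrib algebra_simps)
qed

text \<open>With the optimal end points the lower bound is a function \<open>F\<close> of \<open>k\<close> alone, and its only
  minimum is the value of the candidate, attained at \<open>k = h\<close>.\<close>

lemma cand_value_minimal:
  assumes \<alpha>: "\<alpha> \<ge> 0" and h: "h > 0" and k: "k > 0" and v: "v = 2 * upper_area \<alpha> / h powr (\<alpha> + 2)"
  defines "F \<equiv> \<lambda>k. 2 * k * v + (4 * qint \<alpha> 1 1 + (vint \<alpha> (sqrt 3 / 2) - 2 * qint \<alpha> 1 (sqrt 3 / 2))) / k powr (\<alpha> + 1)"
  shows "cand_value \<alpha> h = F h" and "k \<noteq> h \<Longrightarrow> F h < F k"
proof -
  define A where "A = 4 * qint \<alpha> 1 1 + (vint \<alpha> (sqrt 3 / 2) - 2 * qint \<alpha> 1 (sqrt 3 / 2))"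
  have A1: "A = 4 * upper_cos_int \<alpha> + vint \<alpha> (sqrt 3 / 2)" by (simp add: A_def upper_cos_int_def)
  have A2: "A = 4 * upper_area \<alpha> / (\<alpha> + 1)"
    unfolding A1 upper_area_eq(1)[OF \<alpha>] using \<alpha> vint_value[OF \<alpha>, of "sqrt 3 / 2"] by (simp add: field_simps)
  let ?H = "h powr (\<alpha> + 1)"
  have h2: "h powr (\<alpha> + 2) = ?H * h" using h by (simp add: powr_add power2_eq_square)
  have Fk: "F k = 4 * upper_area \<alpha> / ?H * (k / h + (k / h) powr (- (\<alpha> + 1)) / (\<alpha> + 1))" if "k > 0" for k
  proof -
    have "(k / h) powr (- (\<alpha> + 1)) = ?H / k powr (\<alpha> + 1)"
      using that h unfolding powr_minus by (simp add: powr_divide)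
    then show ?thesis
      unfolding F_def A_def[symmetric] A2 v h2 using h \<alpha> that
      by (simp add: divide_simps) (simp add: algebra_simps)
  qed
  show "cand_value \<alpha> h = F h"
    unfolding cand_value_def F_def A_def[symmetric] A1 v h2 using h by (simp add: add_divide_distrib algebra_simps)
  show "F h < F k" if "k \<noteq> h"
  proof -
    have "1 + 1 / (\<alpha> + 1) < k / h + (k / h) powr (- (\<alpha> + 1)) / (\<alpha> + 1)"
      using that h k \<alpha> by (intro scale_min) auto
    moreover have "4 * upper_area \<alpha> / ?H > 0" using upper_area_pos[OF \<alpha>] h by simp
    ultimately have "4 * upper_area \<alpha> / ?H * (1 + 1 / (\<alpha> + 1)) < F k"
      unfolding Fk[OF k] by (rule mult_strict_left_mono)
    then show ?thesis using Fk[OF h] h by simp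
  qed
qed

text \<open>If the set is not worse than the candidate, every inequality in the calibration is an
  equality.\<close>

lemma equality_case:
  assumes \<alpha>: "\<alpha> \<ge> 0" and h: "h > 0" and r: "0 < r" and g: "continuous_on {0..r} g"
    and g0: "\<And>y. y \<in> {0..r} \<Longrightarrow> 0 \<le> g y" and m: "m \<in> {0..r}" "\<And>y. y \<in> {0..r} \<Longrightarrow> g y \<le> g m"
    and v: "integral {0..r} (\<lambda>y. 2 * g y) = 2 * upper_area \<alpha> / h powr (\<alpha> + 2)"
    and J: "double_perimeter \<alpha> (y_profile_set g r) \<le> ereal (cand_value \<alpha> h)"
  shows "g m = 1 / h" "g 0 = sqrt 3 / 2 / h" "g r = 0"
    and "\<And>a b. 0 \<le> a \<Longrightarrow> a \<le> b \<Longrightarrow> b \<le> m \<Longrightarrow>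
       h / (\<alpha> + 3) * (g b powr (\<alpha> + 3) - g a powr (\<alpha> + 3)) = integral {a..b} (\<lambda>y. g y * calib_cos h (g y))"
    and "\<And>a b. m \<le> a \<Longrightarrow> a \<le> b \<Longrightarrow> b \<le> r \<Longrightarrow>
       h / (\<alpha> + 3) * (g b powr (\<alpha> + 3) - g a powr (\<alpha> + 3)) = - integral {a..b} (\<lambda>y. g y * calib_cos h (g y))"
    and "double_perimeter \<alpha> (y_profile_set g r) = ereal (cand_value \<alpha> h)"
proof -
  define v' where "v' = 2 * upper_area \<alpha> / h powr (\<alpha> + 2)"
  have v'pos: "v' > 0" using upper_area_pos[OF \<alpha>] h by (simp add: v'_def)
  have gm: "g m > 0"
  proof (rule ccontr)
    assume "\<not> g m > 0"
    then have "g y = 0" if "y \<in> {0..r}" for y using g0[OF that] m(2)[OF that] by linarith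
    then have "integral {0..r} (\<lambda>y. 2 * g y) = integral {0..r} (\<lambda>y. 0)" by (intro integral_cong) simp
    also have "\<dots> = 0" by simp
    finally show False using v v'pos unfolding v'_def by linarith
  qed
  \<comment> \<open>the largest \<open>k\<close> for which the calibrating field has norm at most \<open>1\<close> on the whole set\<close>
  define k where "k = 1 / g m"
  have k: "k > 0" "g m = 1 / k" using gm by (simp_all add: k_def)
  have gM: "0 \<le> g y \<and> g y \<le> 1 / k" if "y \<in> {0..r}" for y using g0[OF that] m(2)[OF that] k by simp
  note v1 = v[folded v'_def]
  let ?F = "\<lambda>k. 2 * k * v' + (4 * qint \<alpha> 1 1 + (vint \<alpha> (sqrt 3 / 2) - 2 * qint \<alpha> 1 (sqrt 3 / 2))) / k powr (\<alpha> + 1)"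
  note cmp = cand_value_minimal[OF \<alpha> h k(1) v'_def]
  have range: "k * g 0 \<in> {0..1}" "k * g r \<in> {0..1}"
    using gM[of 0] gM[of r] r k(1) by (auto simp: field_simps)
  have K: "k powr (\<alpha> + 1) > 0" using k(1) by simp
  define x0 where "x0 = (vint \<alpha> (k * g 0) - 2 * qint \<alpha> 1 (k * g 0)) - (vint \<alpha> (sqrt 3 / 2) - 2 * qint \<alpha> 1 (sqrt 3 / 2))"
  define xr where "xr = vint \<alpha> (k * g r) - qint \<alpha> 1 (k * g r)"
  have x0b: "x0 > 0" if "k * g 0 \<noteq> sqrt 3 / 2"
    using bottom_cost_min[OF \<alpha> range(1) that] unfolding x0_def by linarith
  have x0a: "x0 \<ge> 0"
    using x0b by (cases "k * g 0 = sqrt 3 / 2") (simp only: x0_def diff_self order_refl, linarith)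
  note x0 = x0a x0b
  have xrb: "xr > 0" if "k * g r \<noteq> 0"
  proof -
    have "k * g r \<in> {0<..1}" using range(2) that unfolding atLeastAtMost_iff greaterThanAtMost_iff by linarith
    from top_cost_pos[OF \<alpha> this] show ?thesis unfolding xr_def by linarith
  qed
  have xra: "xr \<ge> 0"
    using xrb by (cases "k * g r = 0") (simp only: xr_def wint_0 diff_self order_refl, linarith)
  note xr = xra xrb
  have LB: "?F k + (x0 + 2 * xr) / k powr (\<alpha> + 1)
      + (layer_gain \<alpha> k (-1) g P1 R1 y1 y2
        + layer_gain \<alpha> k 1 g P2 R2 y3 y4) / 2 \<le> J"
    if "double_perimeter \<alpha> (y_profile_set g r) \<le> ereal J" and
    P: "continuous_on UNIV P1" "continuous_on UNIV R1" "\<And>x. \<bar>k * x\<bar> \<le> 1 \<Longrightarrow> (P1 x)\<^sup>2 + (R1 x)\<^sup>2 \<le> 1"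
     "continuous_on UNIV P2" "continuous_on UNIV R2" "\<And>x. \<bar>k * x\<bar> \<le> 1 \<Longrightarrow> (P2 x)\<^sup>2 + (R2 x)\<^sup>2 \<le> 1"
    and y: "0 \<le> y1" "y1 \<le> y2" "y2 \<le> m" "m \<le> y3" "y3 \<le> y4" "y4 \<le> r"
    for P1 P2 R1 R2 :: "real \<Rightarrow> real" and y1 y2 y3 y4 J
  proof -
    have e: "?F k + (x0 + 2 * xr) / k powr (\<alpha> + 1) = 2 * k * v' + (4 * qint \<alpha> 1 1 + (vint \<alpha> (k * g 0) - 2 * qint \<alpha> 1 (k * g 0))
       + 2 * (vint \<alpha> (k * g r) - qint \<alpha> 1 (k * g r))) / k powr (\<alpha> + 1)"
      by (simp add: x0_def xr_def add_divide_distrib diff_divide_distrib algebra_simps)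
    show ?thesis unfolding e by (rule perturbed_lower_bound[OF \<alpha> r g k(1) gM m(1) k(2) v1 that(1) P y])
  qed
  have u: "(k * x)\<^sup>2 + (- calib_cos k x)\<^sup>2 \<le> 1" "(k * x)\<^sup>2 + (calib_cos k x)\<^sup>2 \<le> 1" if "\<bar>k * x\<bar> \<le> 1" for x
    using calib_cos_sq[OF that] by simp_all
  have cl: "continuous_on UNIV (\<lambda>x. k * x)" "continuous_on UNIV (\<lambda>x. - calib_cos k x)"
    by (intro continuous_intros continuous_calib_cos)+
  have m0: "0 \<le> m" "m \<le> r" using m by auto
  have LB0: "?F k + (x0 + 2 * xr) / k powr (\<alpha> + 1) \<le> J" if "double_perimeter \<alpha> (y_profile_set g r) \<le> ereal J" for J
    using LB[OF that cl u(1) cl(1) continuous_calib_cos u(2) m0(1) order_refl order_refl order_refl order_refl m0(2)]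
    by (simp add: wint_minus layer_gain_def)
  have nn: "(x0 + 2 * xr) / k powr (\<alpha> + 1) \<ge> 0" using x0 xr K by simp
  have kh: "k = h"
  proof (rule ccontr)
    assume "k \<noteq> h"
    from cmp(2)[OF this] LB0[OF J] cmp(1) nn show False by linarith
  qed
  have "(x0 + 2 * xr) / k powr (\<alpha> + 1) \<le> 0" using LB0[OF J] cmp(1) kh by simp
  then have "x0 + 2 * xr \<le> 0" using K by (simp add: divide_le_0_iff)
  then have z: "x0 = 0" "xr = 0" using x0 xr by auto
  show "g m = 1 / h" using k kh by simp
  show "g 0 = sqrt 3 / 2 / h" using x0(2) z h kh by (auto simp: field_simps)
  show "g r = 0" using xr(2) z h kh by auto
  have W: "wint \<alpha> (\<lambda>x. h * x\<^sup>2) s = 2 * (h / (\<alpha> + 3) * s powr (\<alpha> + 3))" if "s \<ge> 0" for s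
  proof -
    have "wint \<alpha> (\<lambda>x. h * x\<^sup>2) s = integral {-s..s} (\<lambda>x. h * (\<bar>x\<bar> powr (\<alpha> + 2) * 1))"
      unfolding wint_def by (rule integral_spike[of "{0}"]) (auto simp: powr_add)
    also have "\<dots> = h * vint (\<alpha> + 2) s" by (simp add: wint_def)
    also have "\<dots> = 2 * (h / (\<alpha> + 3) * s powr (\<alpha> + 3))" using \<alpha> that by (simp add: vint_value add.assoc)
    finally show ?thesis .
  qed
  have rotc: "continuous_on UNIV (\<lambda>x. h * x * cos (e * x) - \<tau> * calib_cos h x * sin (e * x))"
     "continuous_on UNIV (\<lambda>x. \<tau> * calib_cos h x * cos (e * x) + h * x * sin (e * x))" for e \<tau>
    by (intro continuous_intros continuous_calib_cos)+
  have nn': "(x0 + 2 * xr) / h powr (\<alpha> + 1) = 0" using z by simp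
  show "h / (\<alpha> + 3) * (g b powr (\<alpha> + 3) - g a powr (\<alpha> + 3)) = integral {a..b} (\<lambda>y. g y * calib_cos h (g y))"
    if ab: "0 \<le> a" "a \<le> b" "b \<le> m" for a b
  proof -
    have "wint \<alpha> (\<lambda>x. h * x\<^sup>2) (g b) - wint \<alpha> (\<lambda>x. h * x\<^sup>2) (g a) = - 2 * (-1) * integral {a..b} (\<lambda>y. g y * calib_cos h (g y))"
    proof (rule rotation_gain_deriv[OF \<alpha> _ _ ab(2)])
      show "continuous_on {a..b} g" using ab m by (intro continuous_on_subset[OF g]) auto
      show "0 \<le> g y" if "y \<in> {a..b}" for y using that ab m by (intro g0) auto
      fix e :: real
      note LB[unfolded kh, OF J rotc(1)[of e "-1"] rotc(2)[of "-1" e] rotated_unit[of h _ "-1"] cl(1)[unfolded kh] continuous_calib_cos u(2)[unfolded kh] ab order_refl order_refl m0(2)]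
      then show "layer_gain \<alpha> h (-1) g (\<lambda>x. h * x * cos (e * x) - (-1) * calib_cos h x * sin (e * x))
          (\<lambda>x. (-1) * calib_cos h x * cos (e * x) + h * x * sin (e * x)) a b \<le> 0"
        using cmp(1) nn' kh by (simp add: wint_minus layer_gain_def)
    qed
    moreover have ga: "0 \<le> g a" and gb: "0 \<le> g b" using ab m by (auto intro!: g0)
    ultimately show ?thesis unfolding W[OF ga] W[OF gb] right_diff_distrib by linarith
  qed
  show "h / (\<alpha> + 3) * (g b powr (\<alpha> + 3) - g a powr (\<alpha> + 3)) = - integral {a..b} (\<lambda>y. g y * calib_cos h (g y))"
    if ab: "m \<le> a" "a \<le> b" "b \<le> r" for a b
  proof -
    have "wint \<alpha> (\<lambda>x. h * x\<^sup>2) (g b) - wint \<alpha> (\<lambda>x. h * x\<^sup>2) (g a) = - 2 * 1 * integral {a..b} (\<lambda>y. g y * calib_cos h (g y))"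
    proof (rule rotation_gain_deriv[OF \<alpha> _ _ ab(2)])
      show "continuous_on {a..b} g" using ab m by (intro continuous_on_subset[OF g]) auto
      show "0 \<le> g y" if "y \<in> {a..b}" for y using that ab m by (intro g0) auto
      fix e :: real
      note LB[unfolded kh, OF J cl[unfolded kh] u(1)[unfolded kh] rotc(1)[of e 1] rotc(2)[of 1 e] rotated_unit[of h _ 1] m0(1) order_refl order_refl ab]
      then show "layer_gain \<alpha> h (1) g (\<lambda>x. h * x * cos (e * x) - (1) * calib_cos h x * sin (e * x))
          (\<lambda>x. (1) * calib_cos h x * cos (e * x) + h * x * sin (e * x)) a b \<le> 0"
        using cmp(1) nn' kh by (simp add: wint_minus layer_gain_def)
    qed
    moreover have ga: "0 \<le> g a" and gb: "0 \<le> g b" using ab m by (auto intro!: g0)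
    ultimately show ?thesis unfolding W[OF ga] W[OF gb] right_diff_distrib by linarith
  qed
  show "double_perimeter \<alpha> (y_profile_set g r) = ereal (cand_value \<alpha> h)"
  proof (rule antisym[OF J], rule ccontr)
    assume "\<not> ereal (cand_value \<alpha> h) \<le> double_perimeter \<alpha> (y_profile_set g r)"
    then have "double_perimeter \<alpha> (y_profile_set g r) < ereal (cand_value \<alpha> h)" by simp
    then obtain J where "double_perimeter \<alpha> (y_profile_set g r) < ereal J" "J < cand_value \<alpha> h"
      using ereal_dense2 by fastforce
    then show False using LB0[OF less_imp_le, of J] cmp(1) nn' unfolding kh by linarith
  qed
qed

section \<open>The profile in the case of equality\<close>

lemma iso_profile_continuous: "\<alpha> \<ge> 0 \<Longrightarrow> continuous_on {0..1} (iso_profile \<alpha>)"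
proof -
  assume \<alpha>: "\<alpha> \<ge> 0"
  have "continuous_on {0..1} (\<lambda>x. sine_int \<alpha> (pi / 2) - sine_int \<alpha> (arcsin x))"
  proof (intro continuous_intros continuous_on_compose2[OF sine_int_continuous[OF \<alpha>]])
    show "arcsin ` {0..1} \<subseteq> {0..pi}"
    proof (rule image_subsetI)
      fix x :: real assume x: "x \<in> {0..1}"
      then have "0 \<le> arcsin x" using arcsin_le_arcsin[of 0 x] by simp
      moreover have "arcsin x \<le> pi / 2" using x arcsin_bounded[of x] by simp
      ultimately show "arcsin x \<in> {0..pi}" using pi_gt_zero by simp
    qed
  qed auto
  then show "continuous_on {0..1} (iso_profile \<alpha>)"
    by (subst continuous_on_cong[OF refl iso_profile_eq[OF \<alpha>]])
qed

lemma iso_profile_deriv: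
  assumes \<alpha>: "\<alpha> \<ge> 0" and x: "0 < x" "x < 1"
  shows "(iso_profile \<alpha> has_real_derivative - (x powr (\<alpha> + 1) / calib_cos 1 x)) (at x)"
proof -
  have as: "arcsin x \<in> {0<..<pi}"
    using arcsin_less_arcsin[of 0 x] arcsin_lt_bounded[of x] x by auto
  have c: "sqrt (1 - x\<^sup>2) = calib_cos 1 x" using x by (simp add: calib_cos_def abs_square_le_1)
  have d: "(arcsin has_real_derivative inverse (sqrt (1 - x\<^sup>2))) (at x)"
    using x by (intro DERIV_arcsin) auto
  from DERIV_chain2[OF arc_height_deriv[OF \<alpha> as] d]
  have "((\<lambda>x. - arc_height \<alpha> (arcsin x)) has_real_derivative - (sin (arcsin x) powr (\<alpha> + 1) * inverse (sqrt (1 - x\<^sup>2)))) (at x)"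
    by (rule DERIV_minus)
  then have "((\<lambda>x. - arc_height \<alpha> (arcsin x)) has_real_derivative - (x powr (\<alpha> + 1) / calib_cos 1 x)) (at x)"
    using x c by (simp add: divide_inverse)
  moreover have "eventually (\<lambda>y. - arc_height \<alpha> (arcsin y) = iso_profile \<alpha> y) (nhds x)"
    using eventually_nhds_in_open[of "{0<..<1}" x] x
    by (auto elim!: eventually_mono simp: iso_profile_eq[OF \<alpha>] arc_height_def)
  ultimately show ?thesis
    by (subst DERIV_cong_ev[OF refl _ refl, symmetric]) auto
qed

text \<open>The integrated Euler-Lagrange equation makes \<open>g\<close> differentiable where it is strictly between
  \<open>0\<close> and \<open>1 / h\<close>, and there \<open>iso_profile \<alpha> (h * g y)\<close> has the constant derivative
  \<open>- \<sigma> * h powr (\<alpha> + 1)\<close>.\<close>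

lemma iso_profile_affine:
  assumes \<alpha>: "\<alpha> \<ge> 0" and h: "h > 0" and ab: "a \<le> b" and g: "continuous_on {a..b} g"
    and g0: "\<And>y. y \<in> {a..b} \<Longrightarrow> 0 \<le> g y \<and> g y \<le> 1 / h"
    and gi: "\<And>y. y \<in> {a<..<b} \<Longrightarrow> 0 < g y \<and> g y < 1 / h"
    and ode: "\<And>y. y \<in> {a..b} \<Longrightarrow> h / (\<alpha> + 3) * (g y powr (\<alpha> + 3) - g a powr (\<alpha> + 3)) = \<sigma> * integral {a..y} (\<lambda>y. g y * calib_cos h (g y))"
    and y: "y \<in> {a..b}"
  shows "iso_profile \<alpha> (h * g y) = iso_profile \<alpha> (h * g a) - \<sigma> * h powr (\<alpha> + 1) * (y - a)"
proof (cases "y = a")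
  case True then show ?thesis by simp
next
  case False
  let ?f = "\<lambda>y. iso_profile \<alpha> (h * g y) + \<sigma> * h powr (\<alpha> + 1) * y"
  let ?I = "\<lambda>y. integral {a..y} (\<lambda>y. g y * calib_cos h (g y))"
  have hg: "0 \<le> h * g t \<and> h * g t \<le> 1" if "t \<in> {a..b}" for t
    using g0[OF that] h by (simp add: field_simps)
  have "?f y = ?f a"
  proof (rule DERIV_isconst_end[where f="?f"])
    show "a < y" using y False by auto
    show "continuous_on {a..y} ?f"
      using y hg by (intro continuous_intros continuous_on_compose2[OF iso_profile_continuous[OF \<alpha>]] continuous_on_subset[OF g]) auto
    fix t assume t: "a < t" "t < y"
    then have tab: "t \<in> {a..b}" and tI: "t \<in> {a<..<b}" using y by auto
    have gt: "g t > 0" "h * g t < 1" "0 < h * g t" using gi[OF tI] h by (auto simp: field_simps)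
    have cc: "continuous_on {a..b} (\<lambda>y. g y * calib_cos h (g y))"
      by (intro continuous_intros g continuous_on_compose2[OF continuous_calib_cos[of UNIV]]) auto
    have dI: "(?I has_real_derivative g t * calib_cos h (g t)) (at t)"
      using integral_has_real_derivative[OF cc tab] at_within_interior[of t "{a..b}"] tI by auto
    \<comment> \<open>the equation says that \<open>u = g powr (\<alpha> + 3)\<close>, so \<open>g\<close> is a power of a differentiable function\<close>
    define u where "u s = (\<alpha> + 3) / h * (\<sigma> * ?I s) + g a powr (\<alpha> + 3)" for s
    have u: "u s = g s powr (\<alpha> + 3)" if "s \<in> {a..b}" for s
      unfolding u_def ode[OF that, symmetric] using h \<alpha> by simp
    have du: "(u has_real_derivative (\<alpha> + 3) / h * (\<sigma> * (g t * calib_cos h (g t)))) (at t)"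
      unfolding u_def[abs_def]
      using DERIV_add[OF DERIV_cmult[OF DERIV_cmult[OF dI]] DERIV_const, of "(\<alpha> + 3) / h" \<sigma> "g a powr (\<alpha> + 3)"]
      by (simp only: add_0_right)
    have ut: "u t > 0" using u[OF tab] gt by simp
    have "((\<lambda>s. u s powr (1 / (\<alpha> + 3))) has_real_derivative
       1 / (\<alpha> + 3) * u t powr (1 / (\<alpha> + 3) - 1) * ((\<alpha> + 3) / h * (\<sigma> * (g t * calib_cos h (g t))))) (at t)"
      using DERIV_fun_powr[OF du ut, of "1 / (\<alpha> + 3)"] by simp
    moreover have "eventually (\<lambda>s. u s powr (1 / (\<alpha> + 3)) = g s) (nhds t)"
    proof -
      have "eventually (\<lambda>s. s \<in> {a<..<b}) (nhds t)"
        using tI by (intro eventually_nhds_in_open) auto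
      then show ?thesis
      proof eventually_elim
        case (elim s)
        then have "s \<in> {a..b}" by auto
        from u[OF this] g0[OF this] show ?case using \<alpha> by (simp add: powr_powr)
      qed
    qed
    ultimately have "(g has_real_derivative
       1 / (\<alpha> + 3) * u t powr (1 / (\<alpha> + 3) - 1) * ((\<alpha> + 3) / h * (\<sigma> * (g t * calib_cos h (g t))))) (at t)"
      by (subst DERIV_cong_ev[OF refl _ refl, symmetric]) auto
    also have "1 / (\<alpha> + 3) * u t powr (1 / (\<alpha> + 3) - 1) * ((\<alpha> + 3) / h * (\<sigma> * (g t * calib_cos h (g t)))) = \<sigma> * calib_cos h (g t) / (h * g t powr (\<alpha> + 1))"
    proof -
      have "u t powr (1 / (\<alpha> + 3) - 1) = g t powr ((\<alpha> + 3) * (1 / (\<alpha> + 3) - 1))"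
        unfolding u[OF tab] by (simp add: powr_powr)
      also have "(\<alpha> + 3) * (1 / (\<alpha> + 3) - 1) = - (\<alpha> + 2)" using \<alpha> by (simp add: field_simps)
      also have "g t powr (- (\<alpha> + 2)) = 1 / (g t powr (\<alpha> + 1) * g t)"
      proof -
        have "g t powr (\<alpha> + 2) = g t powr (\<alpha> + 1) * g t"
          using powr_add[of "g t" "\<alpha> + 1" 1] gt by (simp add: add.assoc)
        then show ?thesis unfolding powr_minus_divide by simp
      qed
      finally have e: "u t powr (1 / (\<alpha> + 3) - 1) = 1 / (g t powr (\<alpha> + 1) * g t)" .
      show ?thesis unfolding e using \<alpha> gt h by simp
    qed
    finally have dg: "(g has_real_derivative \<sigma> * calib_cos h (g t) / (h * g t powr (\<alpha> + 1))) (at t)" .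
    have c: "calib_cos 1 (h * g t) = calib_cos h (g t)" by (simp add: calib_cos_def)
    have cpos: "calib_cos h (g t) > 0" using gt by (simp add: calib_cos_def abs_square_less_1)
    have "((\<lambda>s. iso_profile \<alpha> (h * g s)) has_real_derivative
       - ((h * g t) powr (\<alpha> + 1) / calib_cos 1 (h * g t)) * (h * (\<sigma> * calib_cos h (g t) / (h * g t powr (\<alpha> + 1))))) (at t)"
      by (rule DERIV_chain2[OF iso_profile_deriv[OF \<alpha> gt(3,2)] DERIV_cmult[OF dg]])
    also have "- ((h * g t) powr (\<alpha> + 1) / calib_cos 1 (h * g t)) * (h * (\<sigma> * calib_cos h (g t) / (h * g t powr (\<alpha> + 1)))) = - (\<sigma> * h powr (\<alpha> + 1))"
      unfolding c using cpos gt h by (simp add: powr_mult)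
    finally have d1: "((\<lambda>s. iso_profile \<alpha> (h * g s)) has_real_derivative - (\<sigma> * h powr (\<alpha> + 1))) (at t)" .
    from DERIV_add[OF d1 DERIV_cmult[OF DERIV_ident, of "\<sigma> * h powr (\<alpha> + 1)"]]
    show "(?f has_real_derivative 0) (at t)" by simp
  qed
  then show ?thesis by (simp add: algebra_simps)
qed

text \<open>Let \<open>[m1, m2]\<close> span the points where \<open>g\<close> has its maximum \<open>1 / h\<close>. Then \<open>g\<close> is the candidate
  profile cut at its maximum, with a cylinder of height \<open>m2 - m1\<close> inserted. The calibration does
  not detect the cylinder, but the volume does.\<close>

theorem minimizing_profile:
  assumes \<alpha>: "\<alpha> \<ge> 0" and h: "h > 0" and r: "0 < r" and g: "continuous_on {0..r} g"
    and g0: "\<And>y. y \<in> {0..r} \<Longrightarrow> 0 \<le> g y" and gpos: "\<And>y. y \<in> {0<..<r} \<Longrightarrow> 0 < g y"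
    and v: "integral {0..r} (\<lambda>y. 2 * g y) = 2 * upper_area \<alpha> / h powr (\<alpha> + 2)"
    and J: "double_perimeter \<alpha> (y_profile_set g r) \<le> ereal (cand_value \<alpha> h)"
  shows "r = cand_height \<alpha> h" and "\<And>y. y \<in> {0..r} \<Longrightarrow> g y = cand_profile \<alpha> h y"
    and "double_perimeter \<alpha> (y_profile_set g r) = ereal (cand_value \<alpha> h)"
proof -
  let ?H = "h powr (\<alpha> + 1)"
  have H: "?H > 0" using h by simp
  obtain m where m: "m \<in> {0..r}" "\<And>y. y \<in> {0..r} \<Longrightarrow> g y \<le> g m"
    using continuous_attains_sup[OF compact_Icc _ g] r by auto
  have gm: "g m = 1 / h" by (rule equality_case(1)[OF \<alpha> h r g g0 m v J])
  have gM: "0 \<le> g y \<and> g y \<le> 1 / h" if "y \<in> {0..r}" for y using m(2)[OF that] g0[OF that] gm by simp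
  define S where "S = {y \<in> {0..r}. g y = 1 / h}"
  have "closed S" unfolding S_def by (intro continuous_closed_preimage_constant g) auto
  then have S: "compact S" "S \<noteq> {}" "S \<subseteq> {0..r}"
    using m gm by (auto simp: S_def compact_eq_bounded_closed intro: bounded_subset[OF bounded_closed_interval])
  obtain m1 where m1: "m1 \<in> S" "\<And>y. y \<in> S \<Longrightarrow> m1 \<le> y" using compact_attains_inf[OF S(1,2)] by auto
  obtain m2 where m2: "m2 \<in> S" "\<And>y. y \<in> S \<Longrightarrow> y \<le> m2" using compact_attains_sup[OF S(1,2)] by auto
  have m1r: "m1 \<in> {0..r}" "g m1 = 1 / h" and m2r: "m2 \<in> {0..r}" "g m2 = 1 / h" and m12: "m1 \<le> m2"
    using m1 m2 by (auto simp: S_def)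
  have mx: "g y \<le> g m1" if "y \<in> {0..r}" for y using gM[OF that] m1r by simp
  have E2: "g 0 = sqrt 3 / 2 / h" by (rule equality_case(2)[OF \<alpha> h r g g0 m1r(1) mx v J])
  have E3: "g r = 0" by (rule equality_case(3)[OF \<alpha> h r g g0 m1r(1) mx v J])
  have E4: "h / (\<alpha> + 3) * (g b powr (\<alpha> + 3) - g a powr (\<alpha> + 3)) = integral {a..b} (\<lambda>y. g y * calib_cos h (g y))"
    if "0 \<le> a" "a \<le> b" "b \<le> m1" for a b by (rule equality_case(4)[OF \<alpha> h r g g0 m1r(1) mx v J that])
  have E5: "h / (\<alpha> + 3) * (g b powr (\<alpha> + 3) - g a powr (\<alpha> + 3)) = - integral {a..b} (\<lambda>y. g y * calib_cos h (g y))"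
    if "m1 \<le> a" "a \<le> b" "b \<le> r" for a b by (rule equality_case(5)[OF \<alpha> h r g g0 m1r(1) mx v J that])
  show "double_perimeter \<alpha> (y_profile_set g r) = ereal (cand_value \<alpha> h)"
    by (rule equality_case(6)[OF \<alpha> h r g g0 m1r(1) mx v J])
  have s3: "0 < sqrt 3 / 2" "sqrt 3 / 2 < 1" using real_sqrt_less_mono[of 3 4] by auto
  have Inn: "integral {a..b} (\<lambda>y. g y * calib_cos h (g y)) \<ge> 0" if "0 \<le> a" "b \<le> r" for a b
    using that g0 by (intro integral_nonneg integrable_continuous_real continuous_intros continuous_on_subset[OF g]
        continuous_on_compose2[OF continuous_calib_cos[of UNIV]] mult_nonneg_nonneg) (auto simp: calib_cos_def)
  have pm: "x \<le> y" if "x powr (\<alpha> + 3) \<le> y powr (\<alpha> + 3)" "0 \<le> x" "0 \<le> y" for x y :: real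
    using that \<alpha> powr_less_mono2[of "\<alpha> + 3" y x] by (cases "x \<le> y") auto
  have hpos: "h / (\<alpha> + 3) > 0" using h \<alpha> by simp
  have dec: "g b \<le> g a" if "m1 \<le> a" "a \<le> b" "b \<le> r" for a b
  proof (rule pm)
    have "h / (\<alpha> + 3) * (g b powr (\<alpha> + 3) - g a powr (\<alpha> + 3)) \<le> 0"
      using E5[OF that] Inn[of a b] that m1r by simp
    then show "g b powr (\<alpha> + 3) \<le> g a powr (\<alpha> + 3)" using hpos unfolding mult_le_0_iff by linarith
  qed (use that m1r in \<open>auto intro: g0\<close>)
  have lt: "g y < 1 / h" if "y \<in> {0..r}" "y \<notin> {m1..m2}" for y
    using gM[OF that(1)] m1(2)[of y] m2(2)[of y] that by (auto simp: S_def less_le)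
  have mid: "g y = 1 / h" if "y \<in> {m1..m2}" for y
    using dec[of m1 y] dec[of y m2] that m1r m2r by auto
  have iso1: "iso_profile \<alpha> 1 = 0" using iso_profile_sin[OF \<alpha>, of "pi/2"] by (simp add: arc_height_half)
  have left: "iso_profile \<alpha> (h * g y) = offset \<alpha> - ?H * y" if "y \<in> {0..m1}" for y
  proof -
    have "iso_profile \<alpha> (h * g y) = iso_profile \<alpha> (h * g 0) - 1 * ?H * (y - 0)"
    proof (rule iso_profile_affine[OF \<alpha> h _ _ _ _ _ that])
      show "continuous_on {0..m1} g" using m1r by (intro continuous_on_subset[OF g]) auto
      show "0 \<le> g t \<and> g t \<le> 1 / h" if "t \<in> {0..m1}" for t using that m1r by (intro gM) auto
      show "0 < g t \<and> g t < 1 / h" if "t \<in> {0<..<m1}" for t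
        using gpos[of t] lt[of t] that m1r by auto
      show "h / (\<alpha> + 3) * (g t powr (\<alpha> + 3) - g 0 powr (\<alpha> + 3)) = 1 * integral {0..t} (\<lambda>y. g y * calib_cos h (g y))" if "t \<in> {0..m1}" for t
        using E4[of 0 t] that by simp
    qed (use m1r in auto)
    then show ?thesis using E2 h by (simp add: offset_def)
  qed
  have m1v: "?H * m1 = offset \<alpha>" using left[of m1] m1r iso1 h by simp
  have right: "iso_profile \<alpha> (h * g y) = ?H * (y - m2)" if "y \<in> {m2..r}" for y
  proof -
    have "iso_profile \<alpha> (h * g y) = iso_profile \<alpha> (h * g m2) - (-1) * ?H * (y - m2)"
    proof (rule iso_profile_affine[OF \<alpha> h _ _ _ _ _ that])
      show "continuous_on {m2..r} g" using m2r by (intro continuous_on_subset[OF g]) auto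
      show "0 \<le> g t \<and> g t \<le> 1 / h" if "t \<in> {m2..r}" for t using that m2r by (intro gM) auto
      show "0 < g t \<and> g t < 1 / h" if "t \<in> {m2<..<r}" for t
        using gpos[of t] lt[of t] that m2r by auto
      show "h / (\<alpha> + 3) * (g t powr (\<alpha> + 3) - g m2 powr (\<alpha> + 3)) = -1 * integral {m2..t} (\<lambda>y. g y * calib_cos h (g y))" if "t \<in> {m2..r}" for t
        using E5[of m2 t] that m12 by simp
    qed (use m2r in auto)
    then show ?thesis using m2r iso1 h by simp
  qed
  have rv: "?H * (r - m2) = half_height \<alpha>"
    using right[of r] m2r E3 by (simp add: half_height_def)
  have inv: "g y = iso_profile_inv \<alpha> (iso_profile \<alpha> (h * g y)) / h" if "y \<in> {0..r}" for y
  proof -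
    have "h * g y \<in> {0..1}" using gM[OF that] h by (auto simp: field_simps)
    then show ?thesis using iso_profile_inv_iso[OF \<alpha>] h by simp
  qed
  let ?c = "cand_profile \<alpha> h"
  have cleft: "g y = ?c y" if y: "y \<in> {0..m1}" for y
  proof -
    have yr: "y \<in> {0..r}" using y m1r by auto
    have "?H * y \<le> ?H * m1" using y H by (intro mult_left_mono) auto
    then have "\<bar>?H * y - offset \<alpha>\<bar> = offset \<alpha> - ?H * y" using m1v by simp
    then show ?thesis
      by (subst inv[OF yr]) (simp add: left[OF y] cand_profile_def arc_profile_def profile_def)
  qed
  have cright: "g y = ?c (y - (m2 - m1))" if y: "y \<in> {m2..r}" for y
  proof -
    have yr: "y \<in> {0..r}" using y m2r by auto
    have "?H * (y - (m2 - m1)) - offset \<alpha> = ?H * (y - m2)" using m1v by (simp add: algebra_simps)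
    moreover have "?H * (y - m2) \<ge> 0" using y H by simp
    ultimately show ?thesis
      by (subst inv[OF yr]) (simp add: right[OF y] cand_profile_def arc_profile_def profile_def)
  qed
  let ?R = "cand_height \<alpha> h"
  have R: "?R = r - (m2 - m1)"
  proof -
    have "?H * (r - (m2 - m1)) = half_height \<alpha> + offset \<alpha>" using rv m1v by (simp add: algebra_simps)
    then show ?thesis using H by (simp add: cand_height_def field_simps)
  qed
  have eq: "m1 = m2"
  proof -
    have i: "(\<lambda>y. 2 * g y) integrable_on {a..b}" if "0 \<le> a" "b \<le> r" for a b
      using that by (intro integrable_continuous_real continuous_intros continuous_on_subset[OF g]) auto
    have "integral {0..r} (\<lambda>y. 2 * g y) = integral {0..m1} (\<lambda>y. 2 * g y) + integral {m1..m2} (\<lambda>y. 2 * g y) + integral {m2..r} (\<lambda>y. 2 * g y)"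
      using Henstock_Kurzweil_Integration.integral_combine[of 0 m1 r "\<lambda>y. 2 * g y"]
        Henstock_Kurzweil_Integration.integral_combine[of m1 m2 r "\<lambda>y. 2 * g y"] i m1r m2r m12 by auto
    also have "integral {0..m1} (\<lambda>y. 2 * g y) = integral {0..m1} (\<lambda>y. 2 * ?c y)"
      by (rule integral_cong) (simp add: cleft)
    also have "integral {m1..m2} (\<lambda>y. 2 * g y) = integral {m1..m2} (\<lambda>y. 2 * (1 / h))"
      by (rule integral_cong) (simp add: mid)
    also have "\<dots> = 2 * (m2 - m1) / h" using m12 by simp
    also have "integral {m2..r} (\<lambda>y. 2 * g y) = integral {m2..r} (\<lambda>y. 2 * ?c (y - (m2 - m1)))"
      by (rule integral_cong) (simp add: cright)
    also have "\<dots> = integral {m1..?R} (\<lambda>y. 2 * ?c y)"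
    proof -
      have c: "continuous_on {m2 + - (m2 - m1)..r + - (m2 - m1)} (\<lambda>y. 2 * ?c y)"
        using m1r R by (intro continuous_intros continuous_on_subset[OF cand_continuous[OF \<alpha> h]]) auto
      have e: "y + - (m2 - m1) = y - (m2 - m1)" "m2 - (m2 - m1) = m1" for y by simp_all
      show ?thesis using integral_shift[OF c] by (simp only: o_def e R)
    qed
    finally have "integral {0..r} (\<lambda>y. 2 * g y) = (integral {0..m1} (\<lambda>y. 2 * ?c y) + integral {m1..?R} (\<lambda>y. 2 * ?c y)) + 2 * (m2 - m1) / h" by simp
    also have "integral {0..m1} (\<lambda>y. 2 * ?c y) + integral {m1..?R} (\<lambda>y. 2 * ?c y) = integral {0..?R} (\<lambda>y. 2 * ?c y)"
      using R m1r m2r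
      by (intro Henstock_Kurzweil_Integration.integral_combine integrable_continuous_real continuous_intros cand_continuous \<alpha> h) auto
    finally have "2 * (m2 - m1) / h = 0" using v cand_area[OF \<alpha> h] by simp
    then show ?thesis using h by simp
  qed
  show "r = ?R" using R eq by simp
  show "g y = ?c y" if "y \<in> {0..r}" for y
    using cleft[of y] cright[of y] that eq by (cases "y \<le> m1") auto
qed

section \<open>Perimeter and area of the isoperimetric set\<close>

lemma profile_abs: "profile \<alpha> \<bar>s\<bar> = profile \<alpha> s" by (simp add: profile_def)

lemma iso_set_eq:
  assumes "\<alpha> \<ge> 0" shows "iso_set \<alpha> = y_profile_set (profile \<alpha>) (half_height \<alpha>)"
  using le_profile_iff[OF assms] by (auto simp: iso_set_def y_profile_set_def profile_abs)

lemma dilated_iso_set_eq: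
  assumes \<alpha>: "\<alpha> \<ge> 0" and h: "h > 0"
  shows "dilation \<alpha> (1 / h) ` {(x, y). (x, \<bar>y\<bar> - iso_profile \<alpha> (sqrt 3 / 2)) \<in> iso_set \<alpha>} =
    y_profile_set (cand_profile \<alpha> h) (cand_height \<alpha> h)" (is "dilation \<alpha> (1 / h) ` ?S = _")
proof -
  let ?H = "h powr (\<alpha> + 1)"
  have H: "?H > 0" using h by simp
  have "z \<in> dilation \<alpha> (1 / h) ` ?S \<longleftrightarrow> (h * fst z, ?H * snd z) \<in> ?S" for z
  proof
    assume "z \<in> dilation \<alpha> (1 / h) ` ?S"
    then show "(h * fst z, ?H * snd z) \<in> ?S"
      using h by (auto simp: dilation_def powr_divide)
  next
    assume "(h * fst z, ?H * snd z) \<in> ?S"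
    moreover have "dilation \<alpha> (1 / h) (h * fst z, ?H * snd z) = z"
      using h by (cases z) (simp add: dilation_def powr_divide)
    ultimately show "z \<in> dilation \<alpha> (1 / h) ` ?S" by (metis image_eqI)
  qed
  moreover have "(h * x, ?H * y) \<in> ?S \<longleftrightarrow> (x, y) \<in> y_profile_set (cand_profile \<alpha> h) (cand_height \<alpha> h)" for x y
  proof -
    have "(h * x, ?H * y) \<in> ?S \<longleftrightarrow> \<bar>?H * \<bar>y\<bar> - offset \<alpha>\<bar> \<le> iso_profile \<alpha> (h * \<bar>x\<bar>) \<and> h * \<bar>x\<bar> \<le> 1"
      using h by (simp add: iso_set_def offset_def abs_mult)
    also have "\<dots> \<longleftrightarrow> \<bar>?H * \<bar>y\<bar> - offset \<alpha>\<bar> \<le> half_height \<alpha> \<and> h * \<bar>x\<bar> \<le> profile \<alpha> (?H * \<bar>y\<bar> - offset \<alpha>)"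
      using h by (intro le_profile_iff \<alpha>) simp
    also have "\<bar>?H * \<bar>y\<bar> - offset \<alpha>\<bar> \<le> half_height \<alpha> \<longleftrightarrow> \<bar>y\<bar> \<le> cand_height \<alpha> h"
    proof -
      have "0 \<le> ?H * \<bar>y\<bar>" by simp
      then have "\<bar>?H * \<bar>y\<bar> - offset \<alpha>\<bar> \<le> half_height \<alpha> \<longleftrightarrow> ?H * \<bar>y\<bar> \<le> half_height \<alpha> + offset \<alpha>"
        using arc_height_offset(3,4)[OF \<alpha>] by linarith
      also have "\<dots> \<longleftrightarrow> \<bar>y\<bar> \<le> cand_height \<alpha> h" using H by (simp add: cand_height_def field_simps)
      finally show ?thesis .
    qed
    also have "h * \<bar>x\<bar> \<le> profile \<alpha> (?H * \<bar>y\<bar> - offset \<alpha>) \<longleftrightarrow> \<bar>x\<bar> \<le> cand_profile \<alpha> h \<bar>y\<bar>"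
      using h by (simp add: cand_profile_def arc_profile_def field_simps)
    finally show ?thesis by (auto simp: y_profile_set_def)
  qed
  ultimately show ?thesis by auto
qed

lemma iso_set_strip:
  assumes \<alpha>: "\<alpha> \<ge> 0"
  shows "iso_set \<alpha> \<in> sets lebesgue"
    and "ae_eq (iso_set \<alpha>) (strip (profile \<alpha>) (- half_height \<alpha>) (half_height \<alpha>))"
proof -
  have c: "continuous_on {0..half_height \<alpha>} (profile \<alpha>)"
    using half_height_pos[OF \<alpha>] by (intro continuous_on_subset[OF profile_continuous[OF \<alpha>]]) auto
  note P = profile_set_parts[OF half_height_pos[OF \<alpha>] c]
  show "iso_set \<alpha> \<in> sets lebesgue" using P(1) by (simp add: iso_set_eq[OF \<alpha>])
  show "ae_eq (iso_set \<alpha>) (strip (profile \<alpha>) (- half_height \<alpha>) (half_height \<alpha>))"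
    using P(4) by (simp add: iso_set_eq[OF \<alpha>] profile_abs)
qed

lemma iso_set_arc:
  assumes "\<alpha> \<ge> 0"
  shows "arc_profile \<alpha> 1 0 = profile \<alpha>" "arc_y \<alpha> 1 0 0 = - half_height \<alpha>" "arc_y \<alpha> 1 0 pi = half_height \<alpha>"
  using assms by (auto simp: arc_profile_def arc_y_def half_height_arc_height)

lemma ae_eq_emeasure:
  assumes "ae_eq E F" "E \<in> sets lebesgue" "F \<in> sets lebesgue"
  shows "emeasure lebesgue E = emeasure lebesgue F"
  using assms unfolding ae_eq_def
  by (intro emeasure_eq_AE AE_I'[where N="sym_diff E F"]) auto

lemma iso_set_measure:
  assumes \<alpha>: "\<alpha> \<ge> 0"
  shows "measure lebesgue (iso_set \<alpha>) = 2 * integral {0..pi} (\<lambda>t. sin t powr (\<alpha> + 2))"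
proof -
  have S: "strip (profile \<alpha>) (- half_height \<alpha>) (half_height \<alpha>) \<in> sets lebesgue"
    using strip_borel[OF profile_continuous[OF \<alpha>]] by simp
  have "emeasure lebesgue (iso_set \<alpha>) = ennreal (integral {- half_height \<alpha>..half_height \<alpha>} (\<lambda>y. 2 * profile \<alpha> y))"
    using ae_eq_emeasure[OF iso_set_strip(2,1)[OF \<alpha>] S] strip_measure[OF profile_continuous[OF \<alpha>] profile_range(1)[OF \<alpha>]] by simp
  also have "integral {- half_height \<alpha>..half_height \<alpha>} (\<lambda>y. 2 * profile \<alpha> y) = 2 * integral {0..pi} (\<lambda>t. sin t powr (\<alpha> + 2))"
    using arc_area[OF \<alpha>, of 1 0 pi 0] unfolding iso_set_arc[OF \<alpha>] by simp
  finally have "emeasure lebesgue (iso_set \<alpha>) = ennreal (2 * integral {0..pi} (\<lambda>t. sin t powr (\<alpha> + 2)))" .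
  moreover have "integral {0..pi} (\<lambda>t. sin t powr (\<alpha> + 2)) \<ge> 0"
    by (intro integral_nonneg sin_powr_integrable) (use \<alpha> in auto)
  ultimately show ?thesis by (simp add: measure_def)
qed

lemma iso_set_perimeter:
  assumes \<alpha>: "\<alpha> \<ge> 0"
  shows "grushin_perimeter \<alpha> (iso_set \<alpha>) = ereal (2 * integral {0..pi} (\<lambda>t. sin t powr \<alpha>))"
proof -
  let ?l = "- half_height \<alpha>" and ?r = "half_height \<alpha>"
  have r: "?r > 0" by (rule half_height_pos[OF \<alpha>])
  have S: "strip (profile \<alpha>) ?l ?r \<in> sets lebesgue"
    using strip_borel[OF profile_continuous[OF \<alpha>]] by simp
  have eq: "grushin_perimeter \<alpha> (iso_set \<alpha>) = grushin_perimeter \<alpha> (strip (profile \<alpha>) ?l ?r)"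
    by (rule grushin_perimeter_cong[OF iso_set_strip(2,1)[OF \<alpha>] S])
  have upper: "grushin_perimeter \<alpha> (strip (profile \<alpha>) ?l ?r) \<le> ereal (2 * integral {0..pi} (\<lambda>t. sin t powr \<alpha>))"
    using arc_perimeter_bound[OF \<alpha>, of 1 0 pi 0] unfolding iso_set_arc[OF \<alpha>] by (simp add: wint_0)
  have p0: "profile \<alpha> 0 = 1" using profile_arc_height[OF \<alpha>, of "pi/2"] by (simp add: arc_height_half)
  have pr: "profile \<alpha> ?r = 0" using profile_arc_height[OF \<alpha>, of pi] by (simp add: half_height_arc_height[OF \<alpha>])
  have pl: "profile \<alpha> ?l = 0" using pr by (simp add: profile_minus)
  have u: "(1 * x)\<^sup>2 + (- calib_cos 1 x)\<^sup>2 \<le> 1" "(1 * x)\<^sup>2 + (calib_cos 1 x)\<^sup>2 \<le> 1" if "\<bar>1 * x\<bar> \<le> 1" for x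
    using calib_cos_sq[OF that] by simp_all
  have cl: "continuous_on UNIV (\<lambda>x::real. 1 * x)" "continuous_on UNIV (\<lambda>x. - calib_cos 1 x)"
    by (intro continuous_intros continuous_calib_cos)+
  have lr: "?l < ?r" "?l \<le> 0" "0 \<le> ?r" using r by auto
  have "ereal (integral {?l..?r} (\<lambda>y. 2 * profile \<alpha> y) + 2 * qint \<alpha> 1 1) \<le> grushin_perimeter \<alpha> (strip (profile \<alpha>) ?l ?r)"
    using strip_lower_bound[OF \<alpha> lr(1) profile_continuous[OF \<alpha>] zero_less_one _ cl u(1) cl(1) continuous_calib_cos u(2)
        lr(2) order_refl order_refl order_refl order_refl lr(3)] profile_range[OF \<alpha>]
    by (simp add: p0 pr pl wint_0 wint_minus layer_gain_def)
  also have "integral {?l..?r} (\<lambda>y. 2 * profile \<alpha> y) + 2 * qint \<alpha> 1 1 = 2 * integral {0..pi} (\<lambda>t. sin t powr \<alpha>)"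
    using arc_area[OF \<alpha>, of 1 0 pi 0] upper_area_eq(3)[OF \<alpha>] unfolding iso_set_arc[OF \<alpha>] by simp
  finally show ?thesis using upper eq by simp
qed

lemma sin_third_bounds:
  assumes t: "t \<in> {0..pi/3}"
  shows "0 \<le> sin t" "sin t \<le> sqrt 3 / 2" "cos t > 0"
proof -
  have p: "pi / 3 < pi / 2" using pi_gt_zero by linarith
  have b: "0 \<le> t" "t \<le> pi / 3" using t by auto
  then have b: "0 \<le> t" "t \<le> pi / 3" "t < pi / 2" "pi / 3 \<le> pi / 2" using p by linarith+
  show "0 \<le> sin t" using b by (intro sin_ge_zero) auto
  show "cos t > 0" using b by (intro cos_gt_zero_pi) auto
  show "sin t \<le> sqrt 3 / 2"
    unfolding sin_third_values(1)[symmetric] using b by (intro sin_monotone_2pi_le) auto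
qed

text \<open>The substitution \<open>x = sin t\<close>.\<close>

lemma sin_substitution:
  fixes f :: "real \<Rightarrow> real"
  assumes f: "continuous_on {0..sqrt 3 / 2} f"
  shows "integral {0..sqrt 3 / 2} (\<lambda>x. f x / sqrt (1 - x\<^sup>2)) = integral {0..pi/3} (\<lambda>t. f (sin t))"
proof -
  have nz: "1 - x\<^sup>2 > 0" if "x \<in> {0..sqrt 3 / 2}" for x
  proof -
    have "x\<^sup>2 \<le> (sqrt 3 / 2)\<^sup>2" using that by (intro power_mono) auto
    then show ?thesis by (simp add: power_divide)
  qed
  have "((\<lambda>t. cos t *\<^sub>R (f (sin t) / sqrt (1 - (sin t)\<^sup>2))) has_integral
      integral {sin 0..sin (pi/3)} (\<lambda>x. f x / sqrt (1 - x\<^sup>2))) {0..pi/3}"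
  proof (rule has_integral_substitution)
    show "continuous_on {0..sqrt 3 / 2} (\<lambda>x. f x / sqrt (1 - x\<^sup>2))"
      using nz by (intro continuous_intros f) force
    show "sin ` {0..pi/3} \<subseteq> {0..sqrt 3 / 2}"
    proof (rule image_subsetI)
      fix t assume "t \<in> {0..pi/3}"
      from sin_third_bounds(1,2)[OF this] show "sin t \<in> {0..sqrt 3 / 2}" by simp
    qed
    show "(sin has_real_derivative cos t) (at t within {0..pi/3})" for t
      by (rule has_field_derivative_at_within[OF DERIV_sin])
  qed (auto simp: sin_third_values)
  then have "((\<lambda>t. f (sin t)) has_integral integral {0..sqrt 3 / 2} (\<lambda>x. f x / sqrt (1 - x\<^sup>2))) {0..pi/3}"
    unfolding sin_third_values sin_zero
  proof (rule has_integral_eq[rotated])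
    fix t assume "t \<in> {0..pi/3}"
    then have "cos t > 0" by (rule sin_third_bounds)
    moreover have "1 - (sin t)\<^sup>2 = (cos t)\<^sup>2" by (simp add: cos_squared_eq)
    ultimately show "cos t *\<^sub>R (f (sin t) / sqrt (1 - (sin t)\<^sup>2)) = f (sin t)" by simp
  qed
  then show ?thesis by (rule integral_unique[symmetric])
qed

lemma scale_factor_properties:
  assumes \<alpha>: "\<alpha> \<ge> 0" and v: "v > 0"
  shows "scale_factor \<alpha> v > 0" and "v = 2 * upper_area \<alpha> / scale_factor \<alpha> v powr (\<alpha> + 2)"
proof -
  have "continuous_on {0..sqrt 3 / 2} (\<lambda>t. t powr (\<alpha> + 2))"
    using \<alpha> by (intro continuous_on_powr' continuous_intros) auto
  from sin_substitution[OF this]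
  have I: "integral {0..sqrt 3 / 2} (\<lambda>t. t powr (\<alpha> + 2) / sqrt (1 - t\<^sup>2)) = integral {0..pi/3} (\<lambda>t. sin t powr (\<alpha> + 2))" .
  have "integral {0..pi/3} (\<lambda>t. sin t powr (\<alpha> + 2)) + upper_area \<alpha> = integral {0..pi} (\<lambda>t. sin t powr (\<alpha> + 2))"
    unfolding upper_area_def using \<alpha>
    by (intro Henstock_Kurzweil_Integration.integral_combine sin_powr_integrable) auto
  then have base: "measure lebesgue (iso_set \<alpha>) - 2 * integral {0..sqrt 3 / 2} (\<lambda>t. t powr (\<alpha> + 2) / sqrt (1 - t\<^sup>2)) = 2 * upper_area \<alpha>"
    unfolding I iso_set_measure[OF \<alpha>] by simp
  have h: "scale_factor \<alpha> v = (2 * upper_area \<alpha> / v) powr (1 / (\<alpha> + 2))"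
    unfolding scale_factor_def base by simp
  have pos: "2 * upper_area \<alpha> / v > 0" using upper_area_pos[OF \<alpha>] v by simp
  show "scale_factor \<alpha> v > 0" unfolding h powr_gt_zero using pos by linarith
  have e: "1 / (\<alpha> + 2) * (\<alpha> + 2) = 1" using \<alpha> by simp
  have "scale_factor \<alpha> v powr (\<alpha> + 2) = 2 * upper_area \<alpha> / v"
    unfolding h powr_powr e by (rule powr_one[OF less_imp_le[OF pos]])
  then show "v = 2 * upper_area \<alpha> / scale_factor \<alpha> v powr (\<alpha> + 2)"
    using v upper_area_pos[OF \<alpha>] by simp
qed

text \<open>Here \<open>t powr \<alpha>\<close> is replaced by the continuous weight, which changes the integrand only at
  \<open>t = 0\<close>.\<close>

lemma cand_value_formula:
  assumes \<alpha>: "\<alpha> \<ge> 0" and h: "h > 0"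
  shows "ereal (cand_value \<alpha> h) = ereal (2 / h powr (\<alpha> + 1)) *
      (grushin_perimeter \<alpha> (iso_set \<alpha>) +
       ereal (integral {0..sqrt 3 / 2} (\<lambda>t. t powr \<alpha> * (1 - 2 / sqrt (1 - t\<^sup>2)))))"
proof -
  have w: "continuous_on {0..sqrt 3 / 2} (weight \<alpha>)" by (rule continuous_weight[OF \<alpha>])
  have nz: "1 - x\<^sup>2 \<noteq> 0" if "x \<in> {0..sqrt 3 / 2}" for x
  proof -
    have "x\<^sup>2 \<le> (sqrt 3 / 2)\<^sup>2" using that by (intro power_mono) auto
    then show ?thesis by (auto simp: power_divide)
  qed
  have "integral {0..sqrt 3 / 2} (\<lambda>t. t powr \<alpha> * (1 - 2 / sqrt (1 - t\<^sup>2)))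
      = integral {0..sqrt 3 / 2} (\<lambda>t. weight \<alpha> t - 2 * (weight \<alpha> t / sqrt (1 - t\<^sup>2)))"
  proof (rule integral_spike[of "{0}"])
    show "weight \<alpha> t - 2 * (weight \<alpha> t / sqrt (1 - t\<^sup>2)) = t powr \<alpha> * (1 - 2 / sqrt (1 - t\<^sup>2))"
      if "t \<in> {0..sqrt 3 / 2} - {0}" for t
      using that by (simp add: weight_eq right_diff_distrib)
  qed auto
  also have "\<dots> = integral {0..sqrt 3 / 2} (weight \<alpha>) - 2 * integral {0..sqrt 3 / 2} (\<lambda>t. weight \<alpha> t / sqrt (1 - t\<^sup>2))"
  proof -
    have "(\<lambda>t. weight \<alpha> t / sqrt (1 - t\<^sup>2)) integrable_on {0..sqrt 3 / 2}"
      using nz by (intro integrable_continuous_real continuous_intros w) auto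
    from integral_diff[OF integrable_continuous_real[OF w] integrable_on_mult_right[OF this, of 2]]
    show ?thesis unfolding integral_mult_right .
  qed
  also have "integral {0..sqrt 3 / 2} (\<lambda>t. weight \<alpha> t / sqrt (1 - t\<^sup>2)) = integral {0..pi/3} (\<lambda>t. weight \<alpha> (sin t))"
    by (rule sin_substitution[OF w])
  also have "\<dots> = integral {0..pi/3} (\<lambda>t. sin t powr \<alpha>)"
  proof (rule integral_spike[of "{0}"])
    show "sin t powr \<alpha> = weight \<alpha> (sin t)" if "t \<in> {0..pi/3} - {0}" for t
      using that sin_gt_zero[of t] by (simp add: weight_eq)
  qed auto
  also have "integral {0..sqrt 3 / 2} (weight \<alpha>) = vint \<alpha> (sqrt 3 / 2) / 2"
  proof -
    have "((\<lambda>x. x powr \<alpha>) has_integral (sqrt 3 / 2) powr (\<alpha> + 1) / (\<alpha> + 1)) {0..sqrt 3 / 2}"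
      using has_integral_powr_from_0[of \<alpha> "sqrt 3 / 2"] \<alpha> by simp
    then have "(weight \<alpha> has_integral (sqrt 3 / 2) powr (\<alpha> + 1) / (\<alpha> + 1)) {0..sqrt 3 / 2}"
      by (rule has_integral_spike_finite[of "{0}", rotated -1]) (auto simp: weight_eq)
    then have "integral {0..sqrt 3 / 2} (weight \<alpha>) = (sqrt 3 / 2) powr (\<alpha> + 1) / (\<alpha> + 1)" by (rule integral_unique)
    moreover have "vint \<alpha> (sqrt 3 / 2) = 2 * ((sqrt 3 / 2) powr (\<alpha> + 1) / (\<alpha> + 1))"
      using vint_value[OF \<alpha>, of "sqrt 3 / 2"] by simp
    ultimately show ?thesis by linarith
  qed
  finally have I: "integral {0..sqrt 3 / 2} (\<lambda>t. t powr \<alpha> * (1 - 2 / sqrt (1 - t\<^sup>2))) =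
     vint \<alpha> (sqrt 3 / 2) / 2 - 2 * integral {0..pi/3} (\<lambda>t. sin t powr \<alpha>)" .
  have c: "integral {0..pi/3} (\<lambda>t. sin t powr \<alpha>) + integral {pi/3..pi} (\<lambda>t. sin t powr \<alpha>) = integral {0..pi} (\<lambda>t. sin t powr \<alpha>)"
    using \<alpha> by (intro Henstock_Kurzweil_Integration.integral_combine sin_powr_integrable) auto
  have "cand_value \<alpha> h = 2 / h powr (\<alpha> + 1) * (2 * integral {0..pi} (\<lambda>t. sin t powr \<alpha>) + (vint \<alpha> (sqrt 3 / 2) / 2 - 2 * integral {0..pi/3} (\<lambda>t. sin t powr \<alpha>)))"
    unfolding cand_value_def upper_area_eq(2)[OF \<alpha>, symmetric] c[symmetric] using h by (simp add: field_simps)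
  then show ?thesis unfolding iso_set_perimeter[OF \<alpha>] I by simp
qed

section \<open>Regularity of the candidate profile\<close>

text \<open>A class of functions on \<open>]0, pi[\<close> that is closed under differentiation followed by division by
  any power of the sine. All derivatives of the profile are functions of this class, applied to the
  angle.\<close>

inductive trig_powers :: "(real \<Rightarrow> real) \<Rightarrow> bool" where
  base: "trig_powers (\<lambda>t. sin t powr p * cos t ^ n)"
| scale: "trig_powers f \<Longrightarrow> trig_powers (\<lambda>t. c * f t)"
| sum: "trig_powers f \<Longrightarrow> trig_powers f' \<Longrightarrow> trig_powers (\<lambda>t. f t + f' t)"

lemma trig_powers_deriv:
  assumes "trig_powers f"
  shows "\<exists>f'. trig_powers f' \<and> (\<forall>t\<in>{0<..<pi}. (f has_real_derivative f' t * sin t powr q) (at t))"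
  using assms
proof induction
  case (base p n)
  let ?f' = "\<lambda>t. p * (sin t powr (p - 1 - q) * cos t ^ (n + 1)) + (- real n) * (sin t powr (p + 1 - q) * cos t ^ (n - 1))"
  have "trig_powers ?f'" by (intro trig_powers.intros)
  moreover have "((\<lambda>t. sin t powr p * cos t ^ n) has_real_derivative ?f' t * sin t powr q) (at t)" if t: "t \<in> {0<..<pi}" for t
  proof -
    have s: "sin t > 0" using t by (intro sin_gt_zero) auto
    have "((\<lambda>t. sin t powr p) has_real_derivative p * sin t powr (p - 1) * cos t) (at t)"
      using DERIV_fun_powr[OF DERIV_sin s, of p] by simp
    moreover have "((\<lambda>t. cos t ^ n) has_real_derivative real n * (- sin t * cos t ^ (n - Suc 0))) (at t)"
      by (rule DERIV_power[OF DERIV_cos])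
    ultimately have D: "((\<lambda>t. sin t powr p * cos t ^ n) has_real_derivative
       p * sin t powr (p - 1) * cos t * cos t ^ n + real n * (- sin t * cos t ^ (n - Suc 0)) * sin t powr p) (at t)"
      by (rule DERIV_mult)
    have e: "sin t powr (p - 1 - q) * sin t powr q = sin t powr (p - 1)"
      "sin t powr (p + 1 - q) * sin t powr q = sin t powr p * sin t"
      using s powr_add[of "sin t" "p - 1 - q" q] powr_add[of "sin t" "p + 1 - q" q] powr_add[of "sin t" p 1] by simp_all
    have "?f' t * sin t powr q = p * cos t ^ (n + 1) * (sin t powr (p - 1 - q) * sin t powr q)
        + (- real n) * cos t ^ (n - 1) * (sin t powr (p + 1 - q) * sin t powr q)"
      by (simp add: algebra_simps)
    also have "\<dots> = p * sin t powr (p - 1) * cos t * cos t ^ n + real n * (- sin t * cos t ^ (n - Suc 0)) * sin t powr p"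
      unfolding e by simp
    finally have "?f' t * sin t powr q = p * sin t powr (p - 1) * cos t * cos t ^ n + real n * (- sin t * cos t ^ (n - Suc 0)) * sin t powr p" .
    then show ?thesis using D by simp
  qed
  ultimately show ?case by blast
next
  case (scale f c)
  then obtain f' where "trig_powers f'" "\<And>t. t\<in>{0<..<pi} \<Longrightarrow> (f has_real_derivative f' t * sin t powr q) (at t)" by blast
  then show ?case
    by (intro exI[of _ "\<lambda>t. c * f' t"]) (auto intro: trig_powers.scale DERIV_cmult simp: mult.assoc)
next
  case (sum f k)
  then obtain f' k' where "trig_powers f'" "\<And>t. t\<in>{0<..<pi} \<Longrightarrow> (f has_real_derivative f' t * sin t powr q) (at t)"
    "trig_powers k'" "\<And>t. t\<in>{0<..<pi} \<Longrightarrow> (k has_real_derivative k' t * sin t powr q) (at t)" by blast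
  then show ?case
    by (intro exI[of _ "\<lambda>t. f' t + k' t"]) (auto intro: trig_powers.sum DERIV_add simp: distrib_right)
qed

lemma smooth_trig_compose:
  assumes U: "open U" and \<Theta>: "\<And>y. y \<in> U \<Longrightarrow> \<Theta> y \<in> {0<..<pi}"
    "\<And>y. y \<in> U \<Longrightarrow> (\<Theta> has_real_derivative c / sin (\<Theta> y) powr q) (at y)"
    and f: "trig_powers f" "\<And>y. y \<in> U \<Longrightarrow> g y = f (\<Theta> y)"
  shows "smooth_on_open U g"
proof -
  have step: "\<exists>k'. trig_powers k' \<and> (\<forall>y\<in>U. (G has_real_derivative k' (\<Theta> y)) (at y))"
    if k: "trig_powers k" "\<And>y. y \<in> U \<Longrightarrow> G y = k (\<Theta> y)" for G k
  proof -
    obtain k' where k': "trig_powers k'" "\<And>t. t\<in>{0<..<pi} \<Longrightarrow> (k has_real_derivative k' t * sin t powr q) (at t)"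
      using trig_powers_deriv[OF k(1)] by blast
    have "(G has_real_derivative c * k' (\<Theta> y)) (at y)" if y: "y \<in> U" for y
    proof -
      have "sin (\<Theta> y) > 0" using \<Theta>(1)[OF y] by (intro sin_gt_zero) auto
      moreover have "((\<lambda>y. k (\<Theta> y)) has_real_derivative k' (\<Theta> y) * sin (\<Theta> y) powr q * (c / sin (\<Theta> y) powr q)) (at y)"
        by (rule DERIV_chain2[OF k'(2)[OF \<Theta>(1)[OF y]] \<Theta>(2)[OF y]])
      ultimately have "((\<lambda>y. k (\<Theta> y)) has_real_derivative c * k' (\<Theta> y)) (at y)"
        by (simp add: mult.commute)
      moreover have "eventually (\<lambda>y. G y = k (\<Theta> y)) (nhds y)"
        using eventually_nhds_in_open[OF U y] k(2) by (auto elim: eventually_mono)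
      ultimately show ?thesis by (subst DERIV_cong_ev[OF refl _ refl]) auto
    qed
    then show ?thesis using trig_powers.scale[OF k'(1), of c] by blast
  qed
  have "\<exists>k. trig_powers k \<and> (\<forall>y\<in>U. (deriv ^^ n) g y = k (\<Theta> y))" for n
  proof (induction n)
    case 0 then show ?case using f by auto
  next
    case (Suc n)
    then obtain k where "trig_powers k" "\<And>y. y \<in> U \<Longrightarrow> (deriv ^^ n) g y = k (\<Theta> y)" by blast
    from step[OF this] obtain k' where "trig_powers k'" "\<And>y. y \<in> U \<Longrightarrow> ((deriv ^^ n) g has_real_derivative k' (\<Theta> y)) (at y)" by blast
    then show ?case by (intro exI[of _ k']) (auto intro: DERIV_imp_deriv)
  qed
  then show ?thesis unfolding smooth_on_open_def
    using step real_differentiable_def by (metis (no_types, lifting))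
qed

text \<open>The parameter of the boundary point of the candidate at height \<open>y\<close>.\<close>

definition cand_angle :: "real \<Rightarrow> real \<Rightarrow> real \<Rightarrow> real" where
  "cand_angle \<alpha> h y = angle \<alpha> (h powr (\<alpha> + 1) * y - offset \<alpha>)"

lemma cand_arg_range:
  assumes \<alpha>: "\<alpha> \<ge> 0" and h: "h > 0"
  shows "y \<in> {0..cand_height \<alpha> h} \<Longrightarrow> h powr (\<alpha> + 1) * y - offset \<alpha> \<in> {- half_height \<alpha>..half_height \<alpha>}"
    and "y \<in> {0<..<cand_height \<alpha> h} \<Longrightarrow> h powr (\<alpha> + 1) * y - offset \<alpha> \<in> {- half_height \<alpha><..<half_height \<alpha>}"
proof -
  let ?H = "h powr (\<alpha> + 1)"
  have H: "?H > 0" using h by simp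
  have o: "offset \<alpha> < half_height \<alpha>" by (rule arc_height_offset(4)[OF \<alpha>])
  show "?H * y - offset \<alpha> \<in> {- half_height \<alpha>..half_height \<alpha>}" if y: "y \<in> {0..cand_height \<alpha> h}"
  proof -
    have "0 \<le> ?H * y" "?H * y \<le> half_height \<alpha> + offset \<alpha>" using y H by (auto simp: cand_height_def field_simps)
    then show ?thesis using o by auto
  qed
  show "?H * y - offset \<alpha> \<in> {- half_height \<alpha><..<half_height \<alpha>}" if y: "y \<in> {0<..<cand_height \<alpha> h}"
  proof -
    have "0 < ?H * y" "?H * y < half_height \<alpha> + offset \<alpha>" using y H by (auto simp: cand_height_def field_simps)
    then show ?thesis using o by auto
  qed
qed

lemma cand_profile_angle:
  assumes \<alpha>: "\<alpha> \<ge> 0" and h: "h > 0" and y: "y \<in> {0..cand_height \<alpha> h}"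
  shows "cand_profile \<alpha> h y = sin (cand_angle \<alpha> h y) / h"
  using profile_angle[OF \<alpha> cand_arg_range(1)[OF \<alpha> h y]]
  by (simp add: cand_profile_def arc_profile_def cand_angle_def)

lemma cand_angle_interior:
  assumes \<alpha>: "\<alpha> \<ge> 0" and h: "h > 0" and y: "y \<in> {0<..<cand_height \<alpha> h}"
  shows "cand_angle \<alpha> h y \<in> {0<..<pi}"
    and "(cand_angle \<alpha> h has_real_derivative h powr (\<alpha> + 1) / sin (cand_angle \<alpha> h y) powr (\<alpha> + 1)) (at y)"
proof -
  show "cand_angle \<alpha> h y \<in> {0<..<pi}"
    unfolding cand_angle_def by (rule angle_interior[OF \<alpha> cand_arg_range(2)[OF \<alpha> h y]])
  have "((\<lambda>y. h powr (\<alpha> + 1) * y - offset \<alpha>) has_real_derivative h powr (\<alpha> + 1)) (at y)"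
    using DERIV_diff[OF DERIV_cmult[OF DERIV_ident] DERIV_const, of "h powr (\<alpha> + 1)"] by simp
  from DERIV_chain2[OF angle_deriv[OF \<alpha> cand_arg_range(2)[OF \<alpha> h y]] this]
  show "(cand_angle \<alpha> h has_real_derivative h powr (\<alpha> + 1) / sin (cand_angle \<alpha> h y) powr (\<alpha> + 1)) (at y)"
    by (simp add: cand_angle_def[abs_def] divide_inverse mult.commute)
qed

lemma cand_angle_continuous:
  assumes \<alpha>: "\<alpha> \<ge> 0" and h: "h > 0"
  shows "continuous_on {0..cand_height \<alpha> h} (cand_angle \<alpha> h)"
  unfolding cand_angle_def
  by (intro continuous_on_compose2[OF angle_continuous[OF \<alpha>]] continuous_intros) (use cand_arg_range(1)[OF \<alpha> h] in auto)

lemma cand_angle_ends: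
  assumes \<alpha>: "\<alpha> \<ge> 0" and h: "h > 0"
  shows "cand_angle \<alpha> h 0 = pi / 3" "cand_angle \<alpha> h (cand_height \<alpha> h) = pi"
proof -
  show "cand_angle \<alpha> h 0 = pi / 3"
    using angle_arc_height[OF \<alpha>, of "pi/3"] by (simp add: cand_angle_def arc_height_offset[OF \<alpha>])
  have "h powr (\<alpha> + 1) * cand_height \<alpha> h - offset \<alpha> = arc_height \<alpha> pi"
    using h by (simp add: cand_height_def half_height_arc_height[OF \<alpha>])
  then show "cand_angle \<alpha> h (cand_height \<alpha> h) = pi"
    using angle_arc_height[OF \<alpha>, of pi] by (simp add: cand_angle_def)
qed

lemma cand_ends:
  assumes \<alpha>: "\<alpha> \<ge> 0" and h: "h > 0"
  shows "cand_profile \<alpha> h 0 = sqrt 3 / 2 / h" "cand_profile \<alpha> h (cand_height \<alpha> h) = 0"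
  using cand_height_pos[OF \<alpha> h] by (simp_all add: cand_profile_angle[OF \<alpha> h] cand_angle_ends[OF \<alpha> h] sin_third_values)

lemma cand_regularity:
  assumes \<alpha>: "\<alpha> \<ge> 0" and h: "h > 0" and r: "r = cand_height \<alpha> h"
    and g: "\<And>y. y \<in> {0..r} \<Longrightarrow> g y = cand_profile \<alpha> h y"
  shows "smooth_on_open {0<..<r} g"
    and "filterlim (deriv g) at_bot (at_left r)"
    and "\<exists>d. (deriv g \<longlongrightarrow> d) (at_right 0) \<and> g 0 powr \<alpha> * d = 1 / sqrt 3"
proof -
  let ?H = "h powr (\<alpha> + 1)" and ?\<Theta> = "cand_angle \<alpha> h"
  have r0: "r > 0" using cand_height_pos[OF \<alpha> h] r by simp
  have g\<Theta>: "g y = sin (?\<Theta> y) / h" if "y \<in> {0..r}" for y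
    using g[OF that] cand_profile_angle[OF \<alpha> h, of y] that r by simp
  have I: "?\<Theta> y \<in> {0<..<pi}" "(?\<Theta> has_real_derivative ?H / sin (?\<Theta> y) powr (\<alpha> + 1)) (at y)" if "y \<in> {0<..<r}" for y
    using cand_angle_interior[OF \<alpha> h, of y] that r by auto
  have tp: "trig_powers (\<lambda>t. 1 / h * (sin t powr 1 * cos t ^ 0))" by (intro trig_powers.intros)
  show "smooth_on_open {0<..<r} g"
  proof (rule smooth_trig_compose[OF _ I tp])
    show "g y = 1 / h * (sin (?\<Theta> y) powr 1 * cos (?\<Theta> y) ^ 0)" if y: "y \<in> {0<..<r}" for y
      using g\<Theta>[of y] y I(1)[OF y] sin_gt_zero[of "?\<Theta> y"] by simp
  qed auto
  have dg: "deriv g y = (?H / h) * cos (?\<Theta> y) * inverse (sin (?\<Theta> y) powr (\<alpha> + 1))" if y: "y \<in> {0<..<r}" for y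
  proof -
    have "((\<lambda>y. sin (?\<Theta> y) / h) has_real_derivative cos (?\<Theta> y) * (?H / sin (?\<Theta> y) powr (\<alpha> + 1)) / h) (at y)"
      by (intro DERIV_cdivide DERIV_chain2[OF DERIV_sin] I(2) y)
    moreover have "eventually (\<lambda>y. g y = sin (?\<Theta> y) / h) (nhds y)"
      using eventually_nhds_in_open[of "{0<..<r}" y] y g\<Theta> by (auto elim!: eventually_mono)
    ultimately have "(g has_real_derivative cos (?\<Theta> y) * (?H / sin (?\<Theta> y) powr (\<alpha> + 1)) / h) (at y)"
      by (subst DERIV_cong_ev[OF refl _ refl]) auto
    then show ?thesis by (simp add: DERIV_imp_deriv divide_inverse mult_ac)
  qed
  have c\<Theta>: "continuous_on {0..r} ?\<Theta>" using cand_angle_continuous[OF \<alpha> h] r by simp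
  have evl: "eventually (\<lambda>y. y \<in> {0<..<r}) (at_left r)"
    using r0 by (intro eventually_at_leftI[of 0]) auto
  have evr: "eventually (\<lambda>y. y \<in> {0<..<r}) (at_right 0)"
    using r0 by (intro eventually_at_rightI[of 0 r]) auto
  have Tl: "(?\<Theta> \<longlongrightarrow> pi) (at_left r)"
  proof -
    have "(?\<Theta> \<longlongrightarrow> ?\<Theta> r) (at r within {0..r})" using c\<Theta> r0 by (auto simp: continuous_on_def)
    then show ?thesis using r0 cand_angle_ends(2)[OF \<alpha> h] r by (simp add: at_within_Icc_at_left)
  qed
  have Tr: "(?\<Theta> \<longlongrightarrow> pi / 3) (at_right 0)"
  proof -
    have "(?\<Theta> \<longlongrightarrow> ?\<Theta> 0) (at 0 within {0..r})" using c\<Theta> r0 by (auto simp: continuous_on_def)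
    then show ?thesis using r0 cand_angle_ends(1)[OF \<alpha> h] by (simp add: at_within_Icc_at_right)
  qed
  show "filterlim (deriv g) at_bot (at_left r)"
  proof -
    have "((\<lambda>y. sin (?\<Theta> y) powr (\<alpha> + 1)) \<longlongrightarrow> sin pi powr (\<alpha> + 1)) (at_left r)"
    proof (rule tendsto_powr'[OF tendsto_sin[OF Tl] tendsto_const])
      show "sin pi \<noteq> 0 \<or> 0 < \<alpha> + 1 \<and> (\<forall>\<^sub>F y in at_left r. 0 \<le> sin (?\<Theta> y))"
      proof -
        have "\<forall>\<^sub>F y in at_left r. 0 \<le> sin (?\<Theta> y)"
          using evl
        proof eventually_elim
          case (elim y)
          then show ?case using I(1)[OF elim] sin_gt_zero[of "?\<Theta> y"] by simp
        qed
        then show ?thesis using \<alpha> by simp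
      qed
    qed
    then have "filterlim (\<lambda>y. inverse (sin (?\<Theta> y) powr (\<alpha> + 1))) at_top (at_left r)"
    proof (intro filterlim_inverse_at_top)
      show "eventually (\<lambda>y. 0 < sin (?\<Theta> y) powr (\<alpha> + 1)) (at_left r)"
        using evl
      proof eventually_elim
        case (elim y)
        then show ?case using I(1)[OF elim] sin_gt_zero[of "?\<Theta> y"] by simp
      qed
    qed simp
    moreover have "((\<lambda>y. (?H / h) * cos (?\<Theta> y)) \<longlongrightarrow> (?H / h) * cos pi) (at_left r)"
      by (intro tendsto_intros Tl)
    moreover have "(?H / h) * cos pi < 0" using h by simp
    ultimately have "filterlim (\<lambda>y. (?H / h) * cos (?\<Theta> y) * inverse (sin (?\<Theta> y) powr (\<alpha> + 1))) at_bot (at_left r)"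
      by (intro filterlim_tendsto_neg_mult_at_bot)
    moreover have "eventually (\<lambda>y. deriv g y = (?H / h) * cos (?\<Theta> y) * inverse (sin (?\<Theta> y) powr (\<alpha> + 1))) (at_left r)"
      using evl by eventually_elim (rule dg)
    ultimately show ?thesis by (subst filterlim_cong[OF refl refl])
  qed
  show "\<exists>d. (deriv g \<longlongrightarrow> d) (at_right 0) \<and> g 0 powr \<alpha> * d = 1 / sqrt 3"
  proof (intro exI conjI)
    let ?d = "(?H / h) * cos (pi / 3) * inverse (sin (pi / 3) powr (\<alpha> + 1))"
    have s: "sin (pi / 3) \<noteq> 0" by (simp add: sin_third_values)
    have "((\<lambda>y. (?H / h) * cos (?\<Theta> y) * inverse (sin (?\<Theta> y) powr (\<alpha> + 1))) \<longlongrightarrow> ?d) (at_right 0)"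
      using s by (intro tendsto_intros Tr) auto
    moreover have "eventually (\<lambda>y. deriv g y = (?H / h) * cos (?\<Theta> y) * inverse (sin (?\<Theta> y) powr (\<alpha> + 1))) (at_right 0)"
      using evr by eventually_elim (rule dg)
    ultimately show "(deriv g \<longlongrightarrow> ?d) (at_right 0)" by (subst tendsto_cong)
    have g0: "g 0 = sqrt 3 / 2 / h" using g[of 0] r0 cand_ends(1)[OF \<alpha> h] by simp
    let ?a = "sqrt 3 / 2 :: real"
    have a: "?a > 0" by simp
    have "g 0 powr \<alpha> = ?a powr \<alpha> / h powr \<alpha>" unfolding g0 by (rule powr_divide)
    moreover have "?H = h powr \<alpha> * h" using h by (simp add: powr_add)
    moreover have "?a powr (\<alpha> + 1) = ?a powr \<alpha> * ?a" using a by (simp add: powr_add)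
    moreover have "h powr \<alpha> > 0" "?a powr \<alpha> > 0" using h a by simp_all
    ultimately show "g 0 powr \<alpha> * ?d = 1 / sqrt 3"
      unfolding sin_third_values cos_60 using h by (simp add: field_simps)
  qed
qed

section \<open>Regular minimizers\<close>

lemma cand_admissible:
  assumes \<alpha>: "\<alpha> \<ge> 0" and h: "h > 0" and v: "v = 2 * upper_area \<alpha> / h powr (\<alpha> + 2)"
  shows "y_profile_set (cand_profile \<alpha> h) (cand_height \<alpha> h) \<in> admissible v"
proof -
  let ?g = "cand_profile \<alpha> h" and ?r = "cand_height \<alpha> h"
  have c: "continuous_on {0..?r} ?g" by (rule cand_continuous[OF \<alpha> h])
  have cm: "continuous_on {-?r..0} (\<lambda>y. ?g (- y))" by (intro continuous_on_compose2[OF c] continuous_intros) auto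
  note P = profile_set_parts[OF cand_height_pos[OF \<alpha> h] c]
  have S: "strip ?g 0 ?r \<in> sets lebesgue" "strip (\<lambda>y. ?g (- y)) (- ?r) 0 \<in> sets lebesgue"
    using strip_borel[OF c] strip_borel[OF cm] by auto
  have nn: "0 \<le> ?g y" if "y \<in> {0..?r}" for y
    using profile_range(1)[OF \<alpha> cand_arg_range(1)[OF \<alpha> h that]] h by (simp add: cand_profile_def arc_profile_def)
  have nn': "0 \<le> ?g (- y)" if "y \<in> {-?r..0}" for y using that by (intro nn) auto
  have "integral {-?r..-0} (\<lambda>y. 2 * ?g (- y)) = integral {0..?r} (\<lambda>y. 2 * ?g y)"
    by (rule Henstock_Kurzweil_Integration.integral_reflect_real)
  then show ?thesis
    unfolding admissible_def
    using P(1) ae_eq_emeasure[OF P(5) P(2) S(1)] ae_eq_emeasure[OF P(6) P(3) S(2)] strip_measure[OF c nn] strip_measure[OF cm nn']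
      cand_area[OF \<alpha> h] v by simp
qed

lemma double_perimeter_cong:
  assumes ae: "ae_eq E F" and E: "E \<in> sets lebesgue" and F: "F \<in> sets lebesgue"
  shows "double_perimeter \<alpha> E = double_perimeter \<alpha> F"
    and "emeasure lebesgue (upper_part E) = emeasure lebesgue (upper_part F)"
proof -
  note m = parts_measurable
  have sub: "ae_eq X Y" if "sym_diff X Y \<subseteq> sym_diff E F" "X \<in> sets lebesgue" "Y \<in> sets lebesgue" for X Y
    using ae unfolding ae_eq_def by (rule null_sets_subset) (use that in auto)
  have u: "ae_eq (upper_part E) (upper_part F)" and l: "ae_eq (lower_part E) (lower_part F)"
    by (rule sub; use m E F in \<open>auto simp: upper_part_def lower_part_def\<close>)+
  show "double_perimeter \<alpha> E = double_perimeter \<alpha> F"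
    unfolding double_perimeter_def
    using grushin_perimeter_cong[OF ae E F] grushin_perimeter_cong[OF u m(1)[OF E] m(1)[OF F]]
      grushin_perimeter_cong[OF l m(2)[OF E] m(2)[OF F]] by simp
  show "emeasure lebesgue (upper_part E) = emeasure lebesgue (upper_part F)"
    by (rule ae_eq_emeasure[OF u m(1)[OF E] m(1)[OF F]])
qed

text \<open>The convex set \<open>Psi \<alpha> ` upper_part _\<close> contains the axis at the heights in \<open>]0, r]\<close> and a
  point off the axis at height \<open>s\<close>, hence points off the axis at all heights in \<open>]0, r[\<close>.\<close>

lemma convex_profile_pos:
  assumes \<alpha>: "\<alpha> \<ge> 0" and conv: "y_transformed_convex \<alpha> (y_profile_set g r)"
    and g0: "\<And>y. y \<in> {0..r} \<Longrightarrow> 0 \<le> g y" and s: "s \<in> {0<..<r}" "g s > 0" and y: "y \<in> {0<..<r}"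
  shows "g y > 0"
proof -
  let ?K = "Psi \<alpha> ` upper_part (y_profile_set g r)"
  have K: "convex ?K" using conv by (simp add: y_transformed_convex_def)
  have axis: "(0, t) \<in> ?K" if "t \<in> {0<..r}" for t
    using that g0[of t] by (intro image_eqI[of _ _ "(0, t)"]) (auto simp: Psi_def upper_part_def y_profile_set_def)
  define \<xi> where "\<xi> = g s powr (\<alpha> + 1) / (\<alpha> + 1)"
  have \<xi>: "\<xi> > 0" using s \<alpha> by (simp add: \<xi>_def)
  have side: "(\<xi>, s) \<in> ?K"
    using s by (intro image_eqI[of _ _ "(g s, s)"]) (auto simp: Psi_def upper_part_def y_profile_set_def \<xi>_def)
  \<comment> \<open>the point of the axis on the other side of \<open>y\<close>; height \<open>0\<close> itself is not in the upper part\<close>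
  define t where "t = (if y < s then y / 2 else r)"
  have t: "t \<in> {0<..r}" using y by (auto simp: t_def)
  define c where "c = (y - t) / (s - t)"
  have st: "s - t \<noteq> 0" using s y by (auto simp: t_def)
  then have "c * (s - t) = y - t" by (simp add: c_def)
  then have cy: "y = c * s + (1 - c) * t" by (simp add: algebra_simps)
  have c: "0 < c" "c \<le> 1"
  proof -
    have "0 < c \<and> c \<le> 1"
    proof (cases "y < s")
      case True then show ?thesis using y by (auto simp: c_def t_def field_simps)
    next
      case False then show ?thesis using y s by (auto simp: c_def t_def field_simps)
    qed
    then show "0 < c" "c \<le> 1" by auto
  qed
  have "c *\<^sub>R (\<xi>, s) + (1 - c) *\<^sub>R (0, t) \<in> ?K"
    using c by (intro convexD[OF K side axis[OF t]]) auto
  then have "(c * \<xi>, y) \<in> ?K" using cy by simp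
  then obtain x where x: "\<bar>x\<bar> \<le> g \<bar>y\<bar>" "c * \<xi> = sgn x * (\<bar>x\<bar> powr (\<alpha> + 1) / (\<alpha> + 1))"
    by (auto simp: Psi_def upper_part_def y_profile_set_def)
  have "c * \<xi> > 0" using c \<xi> by simp
  then have "x \<noteq> 0" using x(2) by auto
  then show ?thesis using x(1) y by auto
qed

text \<open>The candidate is admissible, so a minimizer is not worse than the candidate, and
  \<open>minimizing_profile\<close> applies.\<close>

lemma regular_minimizer_explicit:
  assumes \<alpha>: "\<alpha> \<ge> 0" and v: "v > 0" and min: "y_regular_minimizer \<alpha> v E g r" and h: "h = scale_factor \<alpha> v"
  shows "h > 0" "r = cand_height \<alpha> h" "\<And>y. y \<in> {0..r} \<Longrightarrow> g y = cand_profile \<alpha> h y"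
    and "ae_eq E (y_profile_set (cand_profile \<alpha> h) (cand_height \<alpha> h))"
    and "double_perimeter \<alpha> E = ereal (cand_value \<alpha> h)" "E \<in> sets lebesgue"
proof -
  show h0: "h > 0" using scale_factor_properties(1)[OF \<alpha> v] h by simp
  have vh: "v = 2 * upper_area \<alpha> / h powr (\<alpha> + 2)" using scale_factor_properties(2)[OF \<alpha> v] h by simp
  have M: "is_minimizer \<alpha> v E" "0 < r" "continuous_on {0..r} g" "\<And>y. y \<in> {0..r} \<Longrightarrow> 0 \<le> g y"
    "ae_eq E (y_profile_set g r)" "y_transformed_convex \<alpha> (y_profile_set g r)"
    using min unfolding y_regular_minimizer_def by auto
  have adm: "E \<in> admissible v" using M(1) by (simp add: is_minimizer_def)
  show E: "E \<in> sets lebesgue" using adm by (simp add: admissible_def)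
  note P = profile_set_parts[OF M(2,3)]
  have S: "strip g 0 r \<in> sets lebesgue" using strip_borel[OF M(3)] by simp
  have "ennreal v = ennreal (integral {0..r} (\<lambda>y. 2 * g y))"
    using adm double_perimeter_cong(2)[OF M(5) E P(1)] ae_eq_emeasure[OF P(5,2) S] strip_measure[OF M(3,4)]
    by (simp add: admissible_def)
  moreover have "integral {0..r} (\<lambda>y. 2 * g y) \<ge> 0"
    using M(3,4) by (intro integral_nonneg integrable_continuous_real continuous_intros) auto
  ultimately have area: "integral {0..r} (\<lambda>y. 2 * g y) = v" using v by simp
  have dE: "double_perimeter \<alpha> E = double_perimeter \<alpha> (y_profile_set g r)"
    by (rule double_perimeter_cong(1)[OF M(5) E P(1)])
  have "double_perimeter \<alpha> E \<le> double_perimeter \<alpha> (y_profile_set (cand_profile \<alpha> h) (cand_height \<alpha> h))"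
    using M(1) cand_admissible[OF \<alpha> h0 vh] by (simp add: is_minimizer_def)
  also have "\<dots> \<le> ereal (cand_value \<alpha> h)" by (rule cand_upper[OF \<alpha> h0])
  finally have J: "double_perimeter \<alpha> (y_profile_set g r) \<le> ereal (cand_value \<alpha> h)" by (simp add: dE)
  have "\<exists>s\<in>{0<..<r}. g s > 0"
  proof (rule ccontr)
    assume "\<not> ?thesis"
    then have z: "g s = 0" if "s \<in> {0<..<r}" for s using M(4)[of s] that by force
    have "integral {0..r} (\<lambda>y. 2 * g y) = integral {0..r} (\<lambda>y. 0)"
      by (rule integral_spike[of "{0, r}"]) (use z in auto)
    then show False using area v by simp
  qed
  then obtain s where s: "s \<in> {0<..<r}" "g s > 0" by blast
  have pos: "0 < g y" if "y \<in> {0<..<r}" for y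
    by (rule convex_profile_pos[OF \<alpha> M(6,4) s that])
  have area': "integral {0..r} (\<lambda>y. 2 * g y) = 2 * upper_area \<alpha> / h powr (\<alpha> + 2)" using area vh by simp
  show r: "r = cand_height \<alpha> h" by (rule minimizing_profile(1)[OF \<alpha> h0 M(2,3,4) pos area' J])
  show gc: "g y = cand_profile \<alpha> h y" if "y \<in> {0..r}" for y
    by (rule minimizing_profile(2)[OF \<alpha> h0 M(2,3,4) pos area' J that])
  show "double_perimeter \<alpha> E = ereal (cand_value \<alpha> h)"
    unfolding dE by (rule minimizing_profile(3)[OF \<alpha> h0 M(2,3,4) pos area' J])
  have "y_profile_set g r = y_profile_set (cand_profile \<alpha> h) (cand_height \<alpha> h)"
    using gc r by (auto simp: y_profile_set_def)
  then show "ae_eq E (y_profile_set (cand_profile \<alpha> h) (cand_height \<alpha> h))" using M(5) by simp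
qed

lemma ae_eq_sym_trans:
  assumes "ae_eq E G" "ae_eq F G" "E \<in> sets lebesgue" "F \<in> sets lebesgue"
  shows "ae_eq E F"
  unfolding ae_eq_def
proof (rule null_sets_subset)
  show "sym_diff E G \<union> sym_diff F G \<in> null_sets lebesgue"
    using assms(1,2) unfolding ae_eq_def by (rule null_sets.Un)
qed (use assms in auto)

theorem theorem5p4:
  fixes \<alpha> v r h :: real and E :: "(real \<times> real) set" and g :: "real \<Rightarrow> real"
  assumes "\<alpha> \<ge> 0" and "v > 0"
    and "y_regular_minimizer \<alpha> v E g r"
    and "h = scale_factor \<alpha> v"
  shows "(\<forall>E' g' r'. y_regular_minimizer \<alpha> v E' g' r' \<longrightarrow> ae_eq E' E) \<and>
    ae_eq E (dilation \<alpha> (1 / h) `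
          {(x, y). (x, \<bar>y\<bar> - iso_profile \<alpha> (sqrt 3 / 2)) \<in> iso_set \<alpha>}) \<and>
    (\<forall>y \<in> {0..r}. g y =
       1 / h * iso_profile_inv \<alpha> \<bar>h powr (\<alpha> + 1) * y - iso_profile \<alpha> (sqrt 3 / 2)\<bar>) \<and>
    smooth_on_open {0<..<r} g \<and>
    r = h powr (- (\<alpha> + 1)) * (iso_profile \<alpha> 0 + iso_profile \<alpha> (sqrt 3 / 2)) \<and>
    g 0 > 0 \<and> g r = 0 \<and>
    filterlim (deriv g) at_bot (at_left r) \<and>
    (\<exists>d. (deriv g \<longlongrightarrow> d) (at_right 0) \<and> g 0 powr \<alpha> * d = 1 / sqrt 3) \<and>
    (INF E' \<in> admissible v. double_perimeter \<alpha> E') = double_perimeter \<alpha> E \<and>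
    double_perimeter \<alpha> E = ereal (2 / h powr (\<alpha> + 1)) *
      (grushin_perimeter \<alpha> (iso_set \<alpha>) +
       ereal (integral {0..sqrt 3 / 2} (\<lambda>t. t powr \<alpha> * (1 - 2 / sqrt (1 - t\<^sup>2)))))"
proof (intro conjI)
  note \<alpha> = assms(1)
  note R = regular_minimizer_explicit[OF assms]
  have r0: "r > 0" using R(2) cand_height_pos[OF \<alpha> R(1)] by simp
  have g: "g y = cand_profile \<alpha> h y" if "y \<in> {0..r}" for y by (rule R(3)[OF that])
  show "\<forall>E' g' r'. y_regular_minimizer \<alpha> v E' g' r' \<longrightarrow> ae_eq E' E"
  proof (intro allI impI)
    fix E' g' r' assume E': "y_regular_minimizer \<alpha> v E' g' r'"
    note R' = regular_minimizer_explicit[OF assms(1,2) E' assms(4)]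
    show "ae_eq E' E" by (rule ae_eq_sym_trans[OF R'(4) R(4) R'(6) R(6)])
  qed
  show "ae_eq E (dilation \<alpha> (1 / h) ` {(x, y). (x, \<bar>y\<bar> - iso_profile \<alpha> (sqrt 3 / 2)) \<in> iso_set \<alpha>})"
    unfolding dilated_iso_set_eq[OF \<alpha> R(1)] by (rule R(4))
  show "\<forall>y\<in>{0..r}. g y = 1 / h * iso_profile_inv \<alpha> \<bar>h powr (\<alpha> + 1) * y - iso_profile \<alpha> (sqrt 3 / 2)\<bar>"
  proof
    fix y assume y: "y \<in> {0..r}"
    show "g y = 1 / h * iso_profile_inv \<alpha> \<bar>h powr (\<alpha> + 1) * y - iso_profile \<alpha> (sqrt 3 / 2)\<bar>"
      unfolding g[OF y] cand_profile_def arc_profile_def profile_def offset_def by simp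
  qed
  show "r = h powr (- (\<alpha> + 1)) * (iso_profile \<alpha> 0 + iso_profile \<alpha> (sqrt 3 / 2))"
    using R(2) unfolding cand_height_def half_height_def offset_def powr_minus divide_inverse by (simp only: mult.commute)
  show "g 0 > 0" using g[of 0] r0 cand_ends(1)[OF \<alpha> R(1)] R(1) by simp
  show "g r = 0" using g[of r] r0 cand_ends(2)[OF \<alpha> R(1)] R(2) by simp
  show "smooth_on_open {0<..<r} g" by (rule cand_regularity(1)[OF \<alpha> R(1,2) g])
  show "filterlim (deriv g) at_bot (at_left r)" by (rule cand_regularity(2)[OF \<alpha> R(1,2) g])
  show "\<exists>d. (deriv g \<longlongrightarrow> d) (at_right 0) \<and> g 0 powr \<alpha> * d = 1 / sqrt 3"
    by (rule cand_regularity(3)[OF \<alpha> R(1,2) g])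
  have "is_minimizer \<alpha> v E" using assms(3) by (simp add: y_regular_minimizer_def)
  then show "(INF E' \<in> admissible v. double_perimeter \<alpha> E') = double_perimeter \<alpha> E"
    unfolding is_minimizer_def by (intro antisym INF_lower INF_greatest) auto
  show "double_perimeter \<alpha> E = ereal (2 / h powr (\<alpha> + 1)) *
      (grushin_perimeter \<alpha> (iso_set \<alpha>) +
       ereal (integral {0..sqrt 3 / 2} (\<lambda>t. t powr \<alpha> * (1 - 2 / sqrt (1 - t\<^sup>2)))))"
    unfolding R(5) by (rule cand_value_formula[OF \<alpha> R(1)])
qed

end
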